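(* Let $U\subseteq M$ be open, $l\in\mathbb C^\times$, and let $f:U\to\mathbb C$ be an eigenfunction of the Laplace-Beltrami operator with eigenvalue $\lambda\in\mathbb C$ ($-\Delta f=\lambda f$). Then the union of the following three sets is a basis of $V_U^{(2)}(l,f)$: $$\{h_+(-t_1)\cdots h_+(-t_{r/2})h_-(-t_{r/2+1})\cdots h_-(-t_r)f:\ r\ge0\text{ even},\ t_1\ge\cdots\ge t_{r/2}\ge1,\ t_{r/2+1}\ge\cdots\ge t_r\ge1\},$$ $$\{h_+(-t_1)\cdots h_+(-t_{r/2})h_-(-t_{r/2+1})\cdots h_-(-t_k)h_-(0)^{r-k}f:\ r\ge0\text{ even},\ r/2\le k\le r-1,\ t_1\ge\cdots\ge t_{r/2}\ge1,\ t_{r/2+1}\ge\cdots\ge t_k\ge1\},$$ $$\{h_-(-t_1)\cdots h_-(-t_{r/2})h_+(-t_{r/2+1})\cdots h_+(-t_k)h_+(0)^{r-k}f:\ r\ge0\text{ even},\ r/2\le k\le r-1,\ t_1\ge\cdots\ge t_{r/2}\ge1,\ t_{r/2+1}\ge\cdots\ge t_k\ge1\}.$$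
   Context: Geometry: $M$ is a two-dimensional, connected, complete, orientable Riemannian manifold of constant sectional curvature $K\neq0$; $E=\mathbb C\otimes_{\mathbb R}TM$ with complex-linearly extended Levi-Civita connection $\nabla$ and complex-bilinearly extended metric $(\cdot,\cdot)$. Fix $p\in M$, an orthonormal basis $e_1,e_2$ of $T_pM$, and $h_\pm=e_1\mp\sqrt{-1}e_2\in E_p$, so $(h_\pm,h_\pm)=0$, $(h_+,h_-)=2$. $\Pi(T(E))$ is the algebra of parallel sections of $T(E)=\bigoplus_kE^{\otimes k}$, identified by evaluation at $p$ with the subalgebra of the tensor algebra $T(E_p)$ spanned by the words $h_{i_1}\otimes\cdots\otimes h_{i_k}$ with as many $+$ as $-$. $X\in\Pi(E^{\otimes k})$ acts on $C^\infty(U)$ (complex valued) by $g\mapsto(\nabla^kg)(X)$, with $(\nabla^kg)(Z_1,\dots,Z_k)=(\nabla_{Z_1}(\nabla^{k-1}g))(Z_2,\dots,Z_k)$. Eigenfunctions are nonzero. Modes: for a left $T(E_p)$-module $S$ put $F(S)=T(\widehat E_{p,-})\otimes S$, $\widehat E_{p,-}=E_p\otimes t^{-1}\mathbb C[t^{-1}]$. For $a\in E_p$: $a(-m)$ ($m>0$) is left multiplication by $a\otimes t^{-m}$; $a(0)$ acts as $1\otimes a$ through $S$; $a(m)$ ($m>0$) kills $1\otimes S$ and satisfies $a(m)b(-n)=b(-n)a(m)+m(a,b)\delta_{m,n}l$. Set $a(x)=\sum_na(n)x^{-n-1}$; normal ordering ${:}\ {:}$ places negative modes first, then positive modes, then zero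 modes, preserving relative order in each group. $V=V(l,\mathbf 1)$ has basis the words $v=h_{i_1}(-m_1)\cdots h_{i_s}(-m_s)\mathbf 1$ with $m_j\in\mathbb Z_+$ and as many $+$ as $-$; it acts on $F(S)$ by $Y(v,x)={:}\prod_{j=1}^s\frac1{(m_j-1)!}\frac{d^{m_j-1}}{dx^{m_j-1}}h_{i_j}(x){:}=\sum_nv_nx^{-n-1}$ (product in the order $j=1,\dots,s$). $V_U(l,f)$ is the span of all $v_nf$ inside $F(S)$ with $S=T(E_p)\otimes_{\Pi(T(E))}C^\infty(U)$, where $f$ stands for $1\otimes(1\otimes f)$; it is graded by $\mathrm{wt}\,f=0$, each $h_\pm(-t)$ ($t>0$) adding $t$ and each $h_\pm(0)$ adding $0$. Submodules are graded subspaces stable under all $v_n$ ($v\in V,n\in\mathbb Z$). Quotients: identify $\pm$ with $\pm1$. For signs $j_1,\dots,j_r$ put $s_q=j_q+\cdots+j_r$ for $q\le r$, $s_{r+1}=0$, and $C_{j_1,\dots,j_r}(\lambda)=\prod_{q:\,|s_q|<|s_{q+1}|}\bigl(-\lambda+|s_{q+1}|(|s_{q+1}|-1)K\bigr)$. $V_U^{(1)}(l,f)$ is the quotient of $V_U(l,f)$ by the submodule generated by all $$h_{j_1}(-t_1)\cdots h_{j_k}(-t_k)h_{j_{k+1}}(0)\cdots h_{j_r}(0)f-C_{j_{k+1},\dots,j_r}(\lambda)\,h_{j_1}(-t_1)\cdots h_{j_k}(-t_k)h_{\epsilon}(0)^Nf,$$ where $t_1,\dots,t_k\in\mathbb Z_+$,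 $\sum_{q=1}^rj_q=0$, $N=|\sum_{q=k+1}^rj_q|$, $\epsilon=\mathrm{sgn}(\sum_{q=k+1}^rj_q)$ (no $h_\epsilon(0)$ if $N=0$). $V_U^{(2)}(l,f)$ is the quotient of $V_U^{(1)}(l,f)$ by the submodule generated by all $$h_{j_1}(-t_1)\cdots h_{j_k}(-t_k)h_{j_{k+1}}(0)\cdots h_{j_r}(0)f-h_{j_{\tau(1)}}(-t_{\tau(1)})\cdots h_{j_{\tau(k)}}(-t_{\tau(k)})h_{j_{k+1}}(0)\cdots h_{j_r}(0)f$$ with $t_1,\dots,t_k\in\mathbb{Z}_+$, $\sum_{q=1}^rj_q=0$, $\tau\in S_k$. *)

theory Defs
  imports "HOL-Analysis.Analysis" "HOL-Library.Poly_Mapping" "HOL-Combinatorics.Permutations"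
begin

section \<open>Smooth surfaces\<close>

text \<open>A chart is a domain together with a coordinate map that is only relevant on the domain.
  The manifold is a whole type of class t2_space and second_countable_topology.\<close>

type_synonym 'm chart = "'m set \<times> ('m \<Rightarrow> real^2)"

abbreviation dom_ch :: "'m chart \<Rightarrow> 'm set" where "dom_ch c \<equiv> fst c"
abbreviation crd :: "'m chart \<Rightarrow> 'm \<Rightarrow> real^2" where "crd c \<equiv> snd c"
abbreviation img_ch :: "'m chart \<Rightarrow> (real^2) set" where "img_ch c \<equiv> crd c ` dom_ch c"
abbreviation par :: "'m chart \<Rightarrow> real^2 \<Rightarrow> 'm" where "par c \<equiv> inv_into (dom_ch c) (crd c)"

definition pd :: "2 \<Rightarrow> (real^2 \<Rightarrow> 'b::real_normed_vector) \<Rightarrow> real^2 \<Rightarrow> 'b" where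
  "pd i F y = frechet_derivative F (at y) (axis i 1)"

text \<open>On an open set this is C-infinity: all iterated partial derivatives exist and are
  (Frechet-)differentiable, hence continuous.\<close>

definition smooth_on :: "(real^2) set \<Rightarrow> (real^2 \<Rightarrow> 'b::real_normed_vector) \<Rightarrow> bool" where
  "smooth_on S F \<longleftrightarrow> (\<forall>is. \<forall>y\<in>S. (foldr pd is F) differentiable (at y))"

definition smooth_atlas :: "('m::topological_space) chart set \<Rightarrow> bool" where
  "smooth_atlas A \<longleftrightarrow>
     (\<forall>c\<in>A. open (dom_ch c) \<and> open (img_ch c) \<and>
            homeomorphism (dom_ch c) (img_ch c) (crd c) (par c)) \<and>
     (\<Union>c\<in>A. dom_ch c) = UNIV \<and>
     (\<forall>c\<in>A. \<forall>c'\<in>A. smooth_on (crd c ` (dom_ch c \<inter> dom_ch c')) (crd c' \<circ> par c))"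

text \<open>Jacobian matrix at a point of the change of coordinates from the first to the second chart;
  tangent vectors transform by multiplication with it.\<close>

definition jac :: "'m chart \<Rightarrow> 'm chart \<Rightarrow> 'm \<Rightarrow> real^2^2" where
  "jac c c' q = matrix (frechet_derivative (crd c' \<circ> par c) (at (crd c q)))"

definition orientable :: "('m::topological_space) chart set \<Rightarrow> bool" where
  "orientable A \<longleftrightarrow>
     (\<exists>B. smooth_atlas B \<and> smooth_atlas (A \<union> B) \<and>
          (\<forall>c\<in>B. \<forall>c'\<in>B. \<forall>q\<in>dom_ch c \<inter> dom_ch c'. det (jac c c' q) > 0))"

section \<open>Riemannian structure, in local coordinates\<close>

text \<open>The metric is given by its coefficient matrix in every chart of the atlas, as a function of
  the coordinates.\<close>

record 'm surface =
  atlas :: "'m chart set"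
  metric :: "'m chart \<Rightarrow> real^2 \<Rightarrow> real^2^2"

definition riemannian_surface :: "('m::{t2_space,second_countable_topology}) surface \<Rightarrow> bool" where
  "riemannian_surface M \<longleftrightarrow>
     smooth_atlas (atlas M) \<and>
     (\<forall>c\<in>atlas M. smooth_on (img_ch c) (metric M c) \<and>
        (\<forall>y\<in>img_ch c. transpose (metric M c y) = metric M c y \<and>
           (\<forall>v. v \<noteq> 0 \<longrightarrow> v \<bullet> (metric M c y *v v) > 0))) \<and>
     (\<forall>c\<in>atlas M. \<forall>c'\<in>atlas M. \<forall>q\<in>dom_ch c \<inter> dom_ch c'.
        metric M c (crd c q) =
          transpose (jac c c' q) ** metric M c' (crd c' q) ** jac c c' q)"

text \<open>Christoffel symbols of the Levi-Civita connection, with upper index k.\<close>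

definition christoffel :: "(real^2 \<Rightarrow> real^2^2) \<Rightarrow> 2 \<Rightarrow> 2 \<Rightarrow> 2 \<Rightarrow> real^2 \<Rightarrow> real" where
  "christoffel G k i j y =
     (1/2) * (\<Sum>m\<in>UNIV. matrix_inv (G y) $ k $ m *
       (pd i (\<lambda>z. G z $ j $ m) y + pd j (\<lambda>z. G z $ i $ m) y - pd m (\<lambda>z. G z $ i $ j) y))"

text \<open>The vector R(u,v)w, with the sign convention
  R(u,v) = [nabla_u, nabla_v] - nabla_[u,v].\<close>

definition curvature :: "(real^2 \<Rightarrow> real^2^2) \<Rightarrow> real^2 \<Rightarrow> real^2 \<Rightarrow> real^2 \<Rightarrow> real^2 \<Rightarrow> real^2" where
  "curvature G y u v w = (\<chi> n. \<Sum>i\<in>UNIV. \<Sum>j\<in>UNIV. \<Sum>k\<in>UNIV.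
     (pd i (christoffel G n j k) y - pd j (christoffel G n i k) y
       + (\<Sum>m\<in>UNIV. christoffel G n i m y * christoffel G m j k y
                   - christoffel G n j m y * christoffel G m i k y))
     * u $ i * v $ j * w $ k)"

definition sectional_curvature :: "(real^2 \<Rightarrow> real^2^2) \<Rightarrow> real^2 \<Rightarrow> real^2 \<Rightarrow> real^2 \<Rightarrow> real" where
  "sectional_curvature G y u v =
     (u \<bullet> (G y *v curvature G y u v v)) /
     ((u \<bullet> (G y *v u)) * (v \<bullet> (G y *v v)) - (u \<bullet> (G y *v v))\<^sup>2)"

definition constant_curvature :: "'m surface \<Rightarrow> real \<Rightarrow> bool" where
  "constant_curvature M K \<longleftrightarrow>
     (\<forall>c\<in>atlas M. \<forall>y\<in>img_ch c. \<forall>u v. u \<noteq> v \<and> independent {u, v} \<longrightarrow>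
        sectional_curvature (metric M c) y u v = K)"

definition geodesic :: "('m::topological_space) surface \<Rightarrow> (real \<Rightarrow> 'm) \<Rightarrow> bool" where
  "geodesic M \<gamma> \<longleftrightarrow> continuous_on UNIV \<gamma> \<and>
     (\<forall>c\<in>atlas M. \<forall>t. \<gamma> t \<in> dom_ch c \<longrightarrow>
        (let x = crd c \<circ> \<gamma>; x' = (\<lambda>s. vector_derivative x (at s)) in
          x differentiable (at t) \<and> x' differentiable (at t) \<and>
          (\<forall>k. vector_derivative x' (at t) $ k
               + (\<Sum>i\<in>UNIV. \<Sum>j\<in>UNIV. christoffel (metric M c) k i j (x t) * x' t $ i * x' t $ j) = 0)))"

text \<open>Geodesic completeness: every initial vector is the initial velocity of a geodesic defined
  on the whole real line.\<close>

definition complete_surface :: "('m::topological_space) surface \<Rightarrow> bool" where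
  "complete_surface M \<longleftrightarrow>
     (\<forall>c\<in>atlas M. \<forall>q\<in>dom_ch c. \<forall>v. \<exists>\<gamma>. geodesic M \<gamma> \<and> \<gamma> 0 = q \<and>
        vector_derivative (crd c \<circ> \<gamma>) (at 0) = v)"

section \<open>Functions, iterated covariant derivatives, parallel sections\<close>

text \<open>Smooth complex functions on an open set U, encoded as functions on the whole type that
  vanish outside U.\<close>

definition C_inf :: "('m::topological_space) surface \<Rightarrow> 'm set \<Rightarrow> ('m \<Rightarrow> complex) set" where
  "C_inf M U = {g. (\<forall>c\<in>atlas M. smooth_on (crd c ` (dom_ch c \<inter> U)) (g \<circ> par c)) \<and>
                  (\<forall>q. q \<notin> U \<longrightarrow> g q = 0)}"

text \<open>Components of covariant tensor fields are indexed by lists; the direction of differentiation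
  becomes the first index.\<close>

definition cov_deriv ::
    "(real^2 \<Rightarrow> real^2^2) \<Rightarrow> (2 list \<Rightarrow> real^2 \<Rightarrow> complex) \<Rightarrow> 2 list \<Rightarrow> real^2 \<Rightarrow> complex" where
  "cov_deriv G T I y = (case I of [] \<Rightarrow> 0 | i # J \<Rightarrow>
     pd i (T J) y
       - (\<Sum>a<length J. \<Sum>m\<in>UNIV. of_real (christoffel G m i (J ! a) y) * T (J[a := m]) y))"

definition nabla_pow ::
    "(real^2 \<Rightarrow> real^2^2) \<Rightarrow> nat \<Rightarrow> (real^2 \<Rightarrow> complex) \<Rightarrow> 2 list \<Rightarrow> real^2 \<Rightarrow> complex" where
  "nabla_pow G k u = (cov_deriv G ^^ k) (\<lambda>I y. if I = [] then u y else 0)"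

text \<open>Laplace-Beltrami operator in coordinates: the metric trace of the second covariant
  derivative.\<close>

definition laplacian :: "(real^2 \<Rightarrow> real^2^2) \<Rightarrow> (real^2 \<Rightarrow> complex) \<Rightarrow> real^2 \<Rightarrow> complex" where
  "laplacian G u y =
     (\<Sum>i\<in>UNIV. \<Sum>j\<in>UNIV. of_real (matrix_inv (G y) $ i $ j) * nabla_pow G 2 u [i, j] y)"

definition eigenfunction ::
    "('m::topological_space) surface \<Rightarrow> 'm set \<Rightarrow> complex \<Rightarrow> ('m \<Rightarrow> complex) \<Rightarrow> bool" where
  "eigenfunction M U lam f \<longleftrightarrow> f \<in> C_inf M U \<and> (\<exists>q\<in>U. f q \<noteq> 0) \<and>
     (\<forall>c\<in>atlas M. \<forall>q\<in>dom_ch c \<inter> U.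
        - laplacian (metric M c) (f \<circ> par c) (crd c q) = lam * f q)"

text \<open>A section of the k-fold tensor power of the complexified tangent bundle is given by its
  components in all charts.\<close>

definition parallel_section ::
    "('m::topological_space) surface \<Rightarrow> nat \<Rightarrow> ('m chart \<Rightarrow> 2 list \<Rightarrow> real^2 \<Rightarrow> complex) \<Rightarrow> bool" where
  "parallel_section M k X \<longleftrightarrow>
     (\<forall>c\<in>atlas M. \<forall>I. length I = k \<longrightarrow> smooth_on (img_ch c) (X c I)) \<and>
     (\<forall>c\<in>atlas M. \<forall>c'\<in>atlas M. \<forall>q\<in>dom_ch c \<inter> dom_ch c'. \<forall>I. length I = k \<longrightarrow>
        X c' I (crd c' q) =
          (\<Sum>J\<in>{J. length J = k}. (\<Prod>a<k. of_real (jac c c' q $ (I ! a) $ (J ! a))) * X c J (crd c q))) \<and>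
     (\<forall>c\<in>atlas M. \<forall>y\<in>img_ch c. \<forall>I. length I = k \<longrightarrow> (\<forall>i.
        pd i (X c I) y
          + (\<Sum>a<k. \<Sum>m\<in>UNIV. of_real (christoffel (metric M c) (I ! a) i m y) * X c (I[a := m]) y) = 0))"

text \<open>The function h equals (nabla^k g)(X) on U. Being a contraction of tensor fields, the
  right-hand side does not depend on the chart, and we say that h is given by it in all charts.\<close>

definition acts_to :: "('m::topological_space) surface \<Rightarrow> 'm set \<Rightarrow> nat \<Rightarrow>
    ('m chart \<Rightarrow> 2 list \<Rightarrow> real^2 \<Rightarrow> complex) \<Rightarrow> ('m \<Rightarrow> complex) \<Rightarrow> ('m \<Rightarrow> complex) \<Rightarrow> bool" where
  "acts_to M U k X g h \<longleftrightarrow>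
     (\<forall>c\<in>atlas M. \<forall>q\<in>dom_ch c \<inter> U.
        h q = (\<Sum>I\<in>{I. length I = k}. X c I (crd c q) * nabla_pow (metric M c) k (g \<circ> par c) I (crd c q)))"

text \<open>Tangent vectors at p are given by their components in the chart c.\<close>

definition orthonormal_frame :: "'m surface \<Rightarrow> 'm chart \<Rightarrow> 'm \<Rightarrow> real^2 \<Rightarrow> real^2 \<Rightarrow> bool" where
  "orthonormal_frame M c p e1 e2 \<longleftrightarrow>
     (let G = metric M c (crd c p) in
       e1 \<bullet> (G *v e1) = 1 \<and> e2 \<bullet> (G *v e2) = 1 \<and> e1 \<bullet> (G *v e2) = 0)"

text \<open>Signs are Booleans, True standing for +.\<close>

definition sg :: "bool \<Rightarrow> int" where "sg s = (if s then 1 else - 1)"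

definition hvec :: "real^2 \<Rightarrow> real^2 \<Rightarrow> bool \<Rightarrow> complex^2" where
  "hvec e1 e2 s = (\<chi> i. of_real (e1 $ i) - of_int (sg s) * \<i> * of_real (e2 $ i))"

text \<open>The value of X at p is the linear combination, with coefficients a, of the tensors
  h_w1 \<otimes> ... \<otimes> h_wk over the words w of length k.\<close>

definition value_at :: "'m chart \<Rightarrow> 'm \<Rightarrow> real^2 \<Rightarrow> real^2 \<Rightarrow> nat \<Rightarrow>
    ('m chart \<Rightarrow> 2 list \<Rightarrow> real^2 \<Rightarrow> complex) \<Rightarrow> (bool list \<Rightarrow> complex) \<Rightarrow> bool" where
  "value_at c p e1 e2 k X a \<longleftrightarrow>
     (\<forall>I. length I = k \<longrightarrow>
        X c I (crd c p) = (\<Sum>w\<in>{w. length w = k}. a w * (\<Prod>b<k. hvec e1 e2 (w ! b) $ (I ! b))))"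

section \<open>Finitely supported complex linear combinations\<close>

definition scal :: "complex \<Rightarrow> ('k \<Rightarrow>\<^sub>0 complex) \<Rightarrow> ('k \<Rightarrow>\<^sub>0 complex)" where
  "scal a u = Poly_Mapping.map ((*) a) u"

lemma lookup_scal [simp]: "Poly_Mapping.lookup (scal a u) k = a * Poly_Mapping.lookup u k"
  by (simp add: scal_def Poly_Mapping.map.rep_eq when_def)

interpretation lc: vector_space "scal :: complex \<Rightarrow> ('k \<Rightarrow>\<^sub>0 complex) \<Rightarrow> _"
  by unfold_locales (auto intro!: poly_mapping_eqI simp: lookup_add algebra_simps)

definition lin_ext :: "('k \<Rightarrow> ('j \<Rightarrow>\<^sub>0 complex)) \<Rightarrow> ('k \<Rightarrow>\<^sub>0 complex) \<Rightarrow> ('j \<Rightarrow>\<^sub>0 complex)" where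
  "lin_ext \<phi> u = (\<Sum>x\<in>Poly_Mapping.keys u. scal (Poly_Mapping.lookup u x) (\<phi> x))"

section \<open>The module F(S)\<close>

text \<open>
  With words in h_+, h_- as basis of the tensor algebra of E_p, the module F(S), for
  S = T(E_p) tensored over the parallel sections with C-infinity(U), is presented as a
  quotient of the free complex vector space on triples (ns, w, g). Such a triple stands for
  \<open>h_{s1}(-t1) ... h_{sk}(-tk) \<otimes> (h_{w1} \<otimes> ... \<otimes> h_{wr} \<otimes> g)\<close>,
  where ns = [(s1,t1),...,(sk,tk)] with positive t's. All vector spaces below are
  represented as subspaces of the free space containing the relations of F(S), and elements of
  quotients by representatives.\<close>

type_synonym 'm key = "(bool \<times> nat) list \<times> bool list \<times> ('m \<Rightarrow> complex)"
type_synonym 'm fock = "'m key \<Rightarrow>\<^sub>0 complex"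

abbreviation ket :: "(bool \<times> nat) list \<Rightarrow> bool list \<Rightarrow> ('m \<Rightarrow> complex) \<Rightarrow> 'm fock" where
  "ket ns w g \<equiv> Poly_Mapping.single (ns, w, g) 1"

text \<open>Relations of F(S): linearity in the function, and the tensor product over the algebra of
  parallel sections, which acts on words from the right through its values at p.
  That algebra is graded, so homogeneous elements X suffice.\<close>

definition F_rel :: "('m::topological_space) surface \<Rightarrow> 'm chart \<Rightarrow> 'm \<Rightarrow> real^2 \<Rightarrow> real^2 \<Rightarrow> 'm set
    \<Rightarrow> 'm fock set" where
  "F_rel M c p e1 e2 U = lc.span (
     {ket ns w (\<lambda>q. a * g q + b * h q) - scal a (ket ns w g) - scal b (ket ns w h) | ns w a b g h.
        (\<forall>(s,t)\<in>set ns. t \<ge> 1) \<and> g \<in> C_inf M U \<and> h \<in> C_inf M U} \<union>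
     {(\<Sum>v\<in>{v. length v = k}. scal (a v) (ket ns (w @ v) g)) - ket ns w h | ns w k X a g h.
        (\<forall>(s,t)\<in>set ns. t \<ge> 1) \<and> g \<in> C_inf M U \<and> h \<in> C_inf M U \<and>
        parallel_section M k X \<and> value_at c p e1 e2 k X a \<and> acts_to M U k X g h})"

text \<open>The bilinear form on E_p: \<open>(h_+,h_+) = (h_-,h_-) = 0\<close> and \<open>(h_+,h_-) = 2\<close>.\<close>

definition hform :: "bool \<Rightarrow> bool \<Rightarrow> complex" where
  "hform s s' = (if s = s' then 0 else 2)"

definition create :: "bool \<Rightarrow> nat \<Rightarrow> 'm fock \<Rightarrow> 'm fock" where
  "create s t = lin_ext (\<lambda>(ns, w, g). ket ((s, t) # ns) w g)"

definition zero_mode :: "bool \<Rightarrow> 'm fock \<Rightarrow> 'm fock" where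
  "zero_mode s = lin_ext (\<lambda>(ns, w, g). ket ns (s # w) g)"

text \<open>A positive mode \<open>a(m)\<close> on basis elements, by
  \<open>a(m) b(-n) = b(-n) a(m) + m (a,b) \<delta>_{m,n} l\<close> and \<open>a(m) (1 \<otimes> S) = 0\<close>.\<close>

fun annihil_ket :: "complex \<Rightarrow> bool \<Rightarrow> nat \<Rightarrow> (bool \<times> nat) list \<Rightarrow> bool list \<Rightarrow> ('m \<Rightarrow> complex) \<Rightarrow> 'm fock" where
  "annihil_ket l s m [] w g = 0"
| "annihil_ket l s m ((b, n) # ns) w g =
     create b n (annihil_ket l s m ns w g)
     + (if m = n then scal (of_nat m * hform s b * l) (ket ns w g) else 0)"

definition hmode :: "complex \<Rightarrow> bool \<Rightarrow> int \<Rightarrow> 'm fock \<Rightarrow> 'm fock" where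
  "hmode l s n = (if n < 0 then create s (nat (- n))
     else if n = 0 then zero_mode s
     else lin_ext (\<lambda>(ns, w, g). annihil_ket l s (nat n) ns w g))"

definition hmodes :: "complex \<Rightarrow> (bool \<times> int) list \<Rightarrow> 'm fock \<Rightarrow> 'm fock" where
  "hmodes l as u = foldr (\<lambda>(s, n). hmode l s n) as u"

definition normal_order :: "(bool \<times> int) list \<Rightarrow> (bool \<times> int) list" where
  "normal_order as = filter (\<lambda>a. snd a < 0) as @ filter (\<lambda>a. snd a > 0) as @ filter (\<lambda>a. snd a = 0) as"

section \<open>The vertex algebra V and its action\<close>

text \<open>The word \<open>h_{i1}(-m1) ... h_{is}(-ms) 1\<close> is the list [(i1,m1),...,(is,ms)].\<close>

definition V_alg :: "((bool \<times> nat) list \<Rightarrow>\<^sub>0 complex) set" where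
  "V_alg = {v. \<forall>x\<in>Poly_Mapping.keys v. (\<forall>(i, m)\<in>set x. m \<ge> 1) \<and>
                 count_list (map fst x) True = count_list (map fst x) False}"

text \<open>Since \<open>1/(m-1)! d^{m-1}/dx^{m-1} x^{-n-1} = ((-n-1) gchoose (m-1)) x^{-n-m}\<close>, the coefficient of
  \<open>x^{-n-1}\<close> in the normally ordered product is the following sum over mode numbers
  \<open>n_1, ..., n_s\<close>. Applied to any vector only finitely many summands are nonzero.\<close>

definition word_mode :: "complex \<Rightarrow> (bool \<times> nat) list \<Rightarrow> int \<Rightarrow> 'm fock \<Rightarrow> 'm fock" where
  "word_mode l x n u = Sum_any (\<lambda>ns :: int list.
     if length ns = length x \<and> (\<Sum>j<length x. ns ! j + int (snd (x ! j))) = n + 1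
     then scal (\<Prod>j<length x. (of_int (- (ns ! j) - 1)) gchoose (snd (x ! j) - 1))
            (hmodes l (normal_order (zip (map fst x) ns)) u)
     else 0)"

definition vmode :: "complex \<Rightarrow> ((bool \<times> nat) list \<Rightarrow>\<^sub>0 complex) \<Rightarrow> int \<Rightarrow> 'm fock \<Rightarrow> 'm fock" where
  "vmode l v n u = lin_ext (\<lambda>x. word_mode l x n u) v"

section \<open>The module generated by f and its quotients\<close>

text \<open>The parameter R below is the space of relations of F(S).\<close>

abbreviation fvec :: "('m \<Rightarrow> complex) \<Rightarrow> 'm fock" where "fvec f \<equiv> ket [] [] f"

definition V_U :: "'m fock set \<Rightarrow> complex \<Rightarrow> ('m \<Rightarrow> complex) \<Rightarrow> 'm fock set" where
  "V_U R l f = lc.span (R \<union> {vmode l v n (fvec f) | v n. v \<in> V_alg})"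

definition wt :: "'m key \<Rightarrow> nat" where
  "wt x = sum_list (map snd (fst x))"

definition wt_part :: "nat \<Rightarrow> 'm fock \<Rightarrow> 'm fock" where
  "wt_part d u = (\<Sum>x\<in>{x\<in>Poly_Mapping.keys u. wt x = d}. Poly_Mapping.single x (Poly_Mapping.lookup u x))"

text \<open>Graded subspaces of \<open>V_U(l,f)\<close> stable under all \<open>v_n\<close>. Submodules of a quotient of
  \<open>V_U(l,f)\<close> by N are the submodules of \<open>V_U(l,f)\<close> that contain N.\<close>

definition submodule_VU :: "'m fock set \<Rightarrow> complex \<Rightarrow> ('m \<Rightarrow> complex) \<Rightarrow> 'm fock set \<Rightarrow> bool" where
  "submodule_VU R l f N \<longleftrightarrow>
     lc.subspace N \<and> R \<subseteq> N \<and> N \<subseteq> V_U R l f \<and>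
     (\<forall>u\<in>N. \<forall>d. wt_part d u \<in> N) \<and>
     (\<forall>v\<in>V_alg. \<forall>n. \<forall>u\<in>N. vmode l v n u \<in> N)"

definition gen_submodule :: "'m fock set \<Rightarrow> complex \<Rightarrow> ('m \<Rightarrow> complex) \<Rightarrow> 'm fock set \<Rightarrow> 'm fock set" where
  "gen_submodule R l f Y = \<Inter>{N. submodule_VU R l f N \<and> Y \<subseteq> N}"

definition Cfactor :: "complex \<Rightarrow> real \<Rightarrow> bool list \<Rightarrow> complex" where
  "Cfactor lam K js = (let s = (\<lambda>q. sum_list (map sg (drop q js))) in
     \<Prod>q\<in>{q. q < length js \<and> \<bar>s q\<bar> < \<bar>s (Suc q)\<bar>}.
       - lam + of_int (\<bar>s (Suc q)\<bar> * (\<bar>s (Suc q)\<bar> - 1)) * of_real K)"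

definition neg :: "(bool \<times> nat) list \<Rightarrow> (bool \<times> int) list" where
  "neg as = map (\<lambda>(s, t). (s, - int t)) as"

definition zer :: "bool list \<Rightarrow> (bool \<times> int) list" where
  "zer js = map (\<lambda>s. (s, 0)) js"

text \<open>In both families below, as = [(j_1,t_1),...,(j_k,t_k)] and js = [j_{k+1},...,j_r].\<close>

definition gens1 :: "complex \<Rightarrow> complex \<Rightarrow> real \<Rightarrow> ('m \<Rightarrow> complex) \<Rightarrow> 'm fock set" where
  "gens1 l lam K f =
     {hmodes l (neg as @ zer js) (fvec f)
        - scal (Cfactor lam K js)
            (hmodes l (neg as @ zer (replicate (nat \<bar>sum_list (map sg js)\<bar>) (sum_list (map sg js) > 0))) (fvec f))
      | as js. (\<forall>(s, t)\<in>set as. t \<ge> 1) \<and> sum_list (map sg (map fst as @ js)) = 0}"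

definition gens2 :: "complex \<Rightarrow> ('m \<Rightarrow> complex) \<Rightarrow> 'm fock set" where
  "gens2 l f =
     {hmodes l (neg as @ zer js) (fvec f)
        - hmodes l (neg (map (\<lambda>q. as ! \<tau> q) [0..<length as]) @ zer js) (fvec f)
      | as js \<tau>. (\<forall>(s, t)\<in>set as. t \<ge> 1) \<and> sum_list (map sg (map fst as @ js)) = 0 \<and>
          \<tau> permutes {..<length as}}"

text \<open>The quotients \<open>V_U^{(1)}(l,f)\<close> and \<open>V_U^{(2)}(l,f)\<close> are \<open>V_U(l,f)\<close> modulo the following
  submodules.\<close>

definition kernel1 :: "'m fock set \<Rightarrow> complex \<Rightarrow> complex \<Rightarrow> real \<Rightarrow> ('m \<Rightarrow> complex) \<Rightarrow> 'm fock set" where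
  "kernel1 R l lam K f = gen_submodule R l f (gens1 l lam K f)"

definition kernel2 :: "'m fock set \<Rightarrow> complex \<Rightarrow> complex \<Rightarrow> real \<Rightarrow> ('m \<Rightarrow> complex) \<Rightarrow> 'm fock set" where
  "kernel2 R l lam K f = gen_submodule R l f (kernel1 R l lam K f \<union> gens2 l f)"

text \<open>The classes of the elements of B are pairwise distinct and form a basis of V modulo N.\<close>

definition quotient_basis :: "('k \<Rightarrow>\<^sub>0 complex) set \<Rightarrow> ('k \<Rightarrow>\<^sub>0 complex) set \<Rightarrow> ('k \<Rightarrow>\<^sub>0 complex) set \<Rightarrow> bool" where
  "quotient_basis V N B \<longleftrightarrow>
     B \<subseteq> V \<and>
     (\<forall>u\<in>V. \<exists>b\<in>lc.span B. u - b \<in> N) \<and>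
     (\<forall>T a. finite T \<and> T \<subseteq> B \<and> (\<Sum>b\<in>T. scal (a b) b) \<in> N \<longrightarrow> (\<forall>b\<in>T. a b = 0))"

text \<open>A non-increasing list of positive integers.\<close>

definition partition_list :: "nat list \<Rightarrow> bool" where
  "partition_list ts \<longleftrightarrow> sorted_wrt (\<ge>) ts \<and> (\<forall>t\<in>set ts. t \<ge> 1)"

text \<open>\<open>h_s(-t_1) ... h_s(-t_i) h_{s'}(-t'_1) ... h_{s'}(-t'_j) h_{s'}(0)^z f\<close>, where s' is the sign
  opposite to s.\<close>

definition basis_vec :: "complex \<Rightarrow> ('m \<Rightarrow> complex) \<Rightarrow> bool \<Rightarrow> nat list \<Rightarrow> nat list \<Rightarrow> nat \<Rightarrow> 'm fock" where
  "basis_vec l f s ts ts' z =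
     hmodes l (neg (map (Pair s) ts) @ neg (map (Pair (\<not> s)) ts') @ zer (replicate z (\<not> s))) (fvec f)"

end

theory Submission
  imports Defs
begin

text \<open>The generators of the two kernels rewrite every product of modes into one of the listed vectors,
  so spanning amounts to the fact that \<open>V_U(l,f)\<close> consists of all single balanced products of modes,
  which follows by inverting a triangular system. Linear independence says that the relations are
  consistent with the geometry of M. In a local isotropic frame \<open>h_+, h_-\<close> the covariant derivatives of
  a function become words in operators \<open>D_+, D_-\<close> with \<open>[D_+, D_-] = -2nK\<close> on weight n, so that a
  balanced word acts on the eigenfunction f as multiplication by \<open>Cfactor\<close>. A parallel section has
  components \<open>x_w\<close> with \<open>d x_w = -n x_w A\<close>, n being the weight of w and dA a nonzero multiple of K
  times the area form: unbalanced components vanish and balanced ones are locally constant.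
  Hence the tensor algebra is a free right module over the parallel sections, on the words
  without balanced suffix. Evaluating the longest balanced suffix of each word at a point where f does
  not vanish, in a frame transported to that point, defines a linear map on F(S) that is compatible
  with the modes, kills all relations and sends the listed vectors to nonzero multiples of distinct
  basis vectors.\<close>

section \<open>Calculus of partial derivatives\<close>

text \<open>The kernels are intersections of submodules, so independence needs one explicit
  submodule that contains all generators and meets the span of the listed vectors only in 0; it is
  the kernel of \<open>model\<close> on \<open>graded 0\<close>. Submodules are tested with modes of
  balanced words, but these are composed of single modes, each of which leaves the balanced part;
  hence the family \<open>graded \<tau>\<close> over all charges. Replacing letters by scalars makes
  sense for the eigenfunction f alone. Other functions enter only through relations, which
  \<open>model\<close> kills, so compatibility with zero modes is claimed on
  \<open>graded \<tau>\<close> only. The base point p may lie outside U, so functions are evaluated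
  elsewhere, and the coefficients of parallel sections at p must reappear there: this is why frames
  are transported. From geometry to algebra pass only the numbers \<open>E g w\<close> with the five
  properties of \<open>word_action\<close>. The constants arise as follows: (h_+,h_-) = 2 makes
  h_+h_- + h_-h_+ twice the inverse metric, so either order acts on f as -lam, and moving past
  further letters adds 2jK for 0 < j < n, in total n(n-1)K.\<close>

lemma pd_has_derivative: "(F has_derivative F') (at y) \<Longrightarrow> pd i F y = F' (axis i 1)"
  unfolding pd_def by (metis frechet_derivative_at)

lemma differentiable_transform_open:
  assumes "open S" "y \<in> S" "\<And>z. z \<in> S \<Longrightarrow> F z = G z" "F differentiable (at y)"
  shows "G differentiable (at y)"
  using assms has_derivative_transform_within_open unfolding differentiable_def by blast

lemma pd_transform_open:
  assumes "open S" "y \<in> S" "\<And>z. z \<in> S \<Longrightarrow> F z = G z"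
  shows "pd i F y = pd i G y"
proof -
  have "(F has_derivative D) (at y) \<longleftrightarrow> (G has_derivative D) (at y)" for D
    using has_derivative_transform_within_open[OF _ assms(1,2), of F D UNIV G]
      has_derivative_transform_within_open[OF _ assms(1,2), of G D UNIV F] assms(3) by auto
  then show ?thesis
    by (simp add: pd_def frechet_derivative_def)
qed

lemma pd_const [simp]: "pd i (\<lambda>z. a) y = 0"
  by (rule pd_has_derivative[where F' = "\<lambda>_. 0"]) simp

lemma pd_add:
  assumes "F differentiable (at y)" "G differentiable (at y)"
  shows "pd i (\<lambda>z. F z + G z) y = pd i F y + pd i G y"
  using pd_has_derivative[OF has_derivative_add[OF assms[unfolded frechet_derivative_works]]]
  by (simp add: pd_def)

lemma pd_diff:
  assumes "F differentiable (at y)" "G differentiable (at y)"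
  shows "pd i (\<lambda>z. F z - G z) y = pd i F y - pd i G y"
  using pd_has_derivative[OF has_derivative_diff[OF assms[unfolded frechet_derivative_works]]]
  by (simp add: pd_def)

lemma pd_minus:
  assumes "F differentiable (at y)"
  shows "pd i (\<lambda>z. - F z) y = - pd i F y"
  using pd_has_derivative[OF has_derivative_minus[OF assms[unfolded frechet_derivative_works]]]
  by (simp add: pd_def)

lemma pd_mult:
  fixes F G :: "real^2 \<Rightarrow> 'b::real_normed_algebra"
  assumes "F differentiable (at y)" "G differentiable (at y)"
  shows "pd i (\<lambda>z. F z * G z) y = pd i F y * G y + F y * pd i G y"
  using pd_has_derivative[OF has_derivative_mult[OF assms[unfolded frechet_derivative_works]]]
  by (simp add: pd_def)

lemma pd_sum:
  assumes "\<And>a. a \<in> A \<Longrightarrow> F a differentiable (at y)"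
  shows "pd i (\<lambda>z. \<Sum>a\<in>A. F a z) y = (\<Sum>a\<in>A. pd i (F a) y)"
proof -
  have "((\<lambda>z. \<Sum>a\<in>A. F a z) has_derivative (\<lambda>h. \<Sum>a\<in>A. frechet_derivative (F a) (at y) h)) (at y)"
    by (intro has_derivative_sum) (use assms frechet_derivative_works in blast)
  from pd_has_derivative[OF this] show ?thesis
    by (simp add: pd_def)
qed

lemma pd_bounded_linear:
  assumes "bounded_linear L" "F differentiable (at y)"
  shows "pd i (\<lambda>z. L (F z)) y = L (pd i F y)"
  using pd_has_derivative[OF bounded_linear.has_derivative[OF assms(1) assms(2)[unfolded frechet_derivative_works]]]
  by (simp add: pd_def)

lemma differentiable_bounded_linear:
  assumes "bounded_linear L" "F differentiable (at y)"
  shows "(\<lambda>z. L (F z)) differentiable (at y)"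
  using bounded_linear.has_derivative[OF assms(1)] assms(2) unfolding differentiable_def by blast

lemma differentiable_transform_real:
  assumes "(g has_real_derivative d) (at (F y))" "F differentiable (at y)"
  shows "(\<lambda>z. g (F z)) differentiable (at y)" "pd i (\<lambda>z. g (F z)) y = d * pd i F y"
proof -
  have D: "((\<lambda>z. g (F z)) has_derivative (\<lambda>h. d * frechet_derivative F (at y) h)) (at y)"
    using diff_chain_at[OF assms(2)[unfolded frechet_derivative_works]
        assms(1)[unfolded has_field_derivative_def]]
    by (simp add: o_def)
  show "(\<lambda>z. g (F z)) differentiable (at y)"
    using D differentiable_def by blast
  show "pd i (\<lambda>z. g (F z)) y = d * pd i F y"
    using pd_has_derivative[OF D] by (simp add: pd_def)
qed

lemma constant_if_pd_zero:
  fixes F :: "real^2 \<Rightarrow> 'b::real_normed_vector"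
  assumes "convex S" "open S" "x \<in> S" "y \<in> S"
    and diff: "\<And>z. z \<in> S \<Longrightarrow> F differentiable (at z)"
    and zero: "\<And>z i. z \<in> S \<Longrightarrow> pd i F z = 0"
  shows "F x = F y"
proof -
  have "(F has_derivative (\<lambda>h. 0)) (at z within S)" if z: "z \<in> S" for z
  proof -
    have D: "(F has_derivative frechet_derivative F (at z)) (at z)"
      using diff[OF z] frechet_derivative_works by blast
    then have L: "linear (frechet_derivative F (at z))"
      using has_derivative_linear by blast
    have "frechet_derivative F (at z) h = 0" for h
    proof -
      have "frechet_derivative F (at z) h
          = frechet_derivative F (at z) (\<Sum>i\<in>UNIV. h $ i *\<^sub>R axis i 1)"
        using basis_expansion[of h] by (simp add: scalar_mult_eq_scaleR)
      also have "\<dots> = 0"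
        using zero[OF z] by (simp add: linear_sum[OF L] linear_cmul[OF L] pd_def)
      finally show ?thesis .
    qed
    then have "frechet_derivative F (at z) = (\<lambda>h. 0)"
      by blast
    with D show ?thesis
      by (simp add: has_derivative_at_withinI)
  qed
  then obtain a where "\<And>z. z \<in> S \<Longrightarrow> F z = a"
    using has_derivative_zero_constant[OF assms(1)] by blast
  with assms(3,4) show ?thesis by simp
qed

lemma pd_affine_line:
  fixes F :: "real^2 \<Rightarrow> real"
  assumes "F differentiable (at (y + t *\<^sub>R axis i 1))"
  shows "((\<lambda>t. F (y + t *\<^sub>R axis i 1)) has_real_derivative pd i F (y + t *\<^sub>R axis i 1)) (at t)"
proof -
  let ?z = "y + t *\<^sub>R axis i 1"
  have D: "(F has_derivative frechet_derivative F (at ?z)) (at ?z)"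
    using assms frechet_derivative_works by blast
  have l: "((\<lambda>t. y + t *\<^sub>R axis i 1) has_derivative (\<lambda>h. h *\<^sub>R axis i 1)) (at t)"
    by (auto intro!: derivative_eq_intros)
  have "((\<lambda>t. F (y + t *\<^sub>R axis i 1)) has_derivative (\<lambda>h. frechet_derivative F (at ?z) (h *\<^sub>R axis i 1))) (at t)"
    using diff_chain_at[OF l D] by (simp add: o_def)
  moreover have "frechet_derivative F (at ?z) (h *\<^sub>R axis i 1) = h * pd i F ?z" for h
    using linear_cmul[OF has_derivative_linear[OF D]] by (simp add: pd_def)
  ultimately show ?thesis
    by (simp add: has_field_derivative_def mult_commute_abs)
qed

text \<open>The mean value theorem along axis i, applied to the difference of F across the square,
  and then along axis j, applied to \<open>pd i F\<close>. The second difference of F is symmetric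
  in i and j, which is what forces the mixed partials to agree.\<close>

lemma mean_value_square:
  fixes F :: "real^2 \<Rightarrow> real"
  assumes "h > 0" and ball: "\<And>s t. 0 \<le> s \<Longrightarrow> s \<le> h \<Longrightarrow> 0 \<le> t \<Longrightarrow> t \<le> h \<Longrightarrow> y + s *\<^sub>R axis i 1 + t *\<^sub>R axis j 1 \<in> S"
    and dF: "\<And>z. z \<in> S \<Longrightarrow> F differentiable (at z)"
    and dpF: "\<And>z. z \<in> S \<Longrightarrow> pd i F differentiable (at z)"
  shows "\<exists>s t. 0 < s \<and> s < h \<and> 0 < t \<and> t < h \<and>
    F (y + h *\<^sub>R axis i 1 + h *\<^sub>R axis j 1) - F (y + h *\<^sub>R axis i 1) - F (y + h *\<^sub>R axis j 1) + F y
      = h * h * pd j (pd i F) (y + s *\<^sub>R axis i 1 + t *\<^sub>R axis j 1)"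
proof -
  let ?a = "axis i (1::real) :: real^2" and ?b = "axis j (1::real) :: real^2"
  let ?u = "\<lambda>s. F ((y + h *\<^sub>R ?b) + s *\<^sub>R ?a) - F (y + s *\<^sub>R ?a)"
  have "\<exists>s. s > 0 \<and> s < h \<and> ?u h - ?u 0
      = (h - 0) * (pd i F ((y + h *\<^sub>R ?b) + s *\<^sub>R ?a) - pd i F (y + s *\<^sub>R ?a))"
  proof (rule MVT2[OF assms(1)])
    fix s assume s: "0 \<le> s" "s \<le> h"
    have 1: "y + h *\<^sub>R ?b + s *\<^sub>R ?a \<in> S"
      using ball[of s h] s assms(1) by (simp add: algebra_simps)
    have 2: "y + s *\<^sub>R ?a \<in> S"
      using ball[of s 0] s assms(1) by simp
    show "(?u has_real_derivative (pd i F ((y + h *\<^sub>R ?b) + s *\<^sub>R ?a) - pd i F (y + s *\<^sub>R ?a))) (at s)"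
      by (intro DERIV_diff pd_affine_line dF 1 2)
  qed
  then obtain s where s: "0 < s" "s < h"
    and e1: "?u h - ?u 0 = h * (pd i F ((y + h *\<^sub>R ?b) + s *\<^sub>R ?a) - pd i F (y + s *\<^sub>R ?a))"
    by auto
  let ?v = "\<lambda>t. pd i F ((y + s *\<^sub>R ?a) + t *\<^sub>R ?b)"
  have "\<exists>t. t > 0 \<and> t < h \<and> ?v h - ?v 0 = (h - 0) * pd j (pd i F) ((y + s *\<^sub>R ?a) + t *\<^sub>R ?b)"
  proof (rule MVT2[OF assms(1)])
    fix t assume t: "0 \<le> t" "t \<le> h"
    show "(?v has_real_derivative pd j (pd i F) ((y + s *\<^sub>R ?a) + t *\<^sub>R ?b)) (at t)"
      by (intro pd_affine_line dpF ball) (use s t in auto)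
  qed
  then obtain t where t: "0 < t" "t < h"
    and e2: "?v h - ?v 0 = h * pd j (pd i F) ((y + s *\<^sub>R ?a) + t *\<^sub>R ?b)"
    by auto
  have "?u h - ?u 0 = h * (?v h - ?v 0)"
    using e1 by (simp add: algebra_simps)
  then have "?u h - ?u 0 = h * h * pd j (pd i F) ((y + s *\<^sub>R ?a) + t *\<^sub>R ?b)"
    unfolding e2 by simp
  then have "F (y + h *\<^sub>R axis i 1 + h *\<^sub>R axis j 1) - F (y + h *\<^sub>R axis i 1) - F (y + h *\<^sub>R axis j 1) + F y
      = h * h * pd j (pd i F) (y + s *\<^sub>R axis i 1 + t *\<^sub>R axis j 1)"
    by (simp add: add.commute add.left_commute)
  with s t show ?thesis by blast
qed

lemma pd_commute_real:
  fixes F :: "real^2 \<Rightarrow> real"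
  assumes "open S" "y \<in> S"
    and dF: "\<And>z. z \<in> S \<Longrightarrow> F differentiable (at z)"
    and dpF: "\<And>z i. z \<in> S \<Longrightarrow> pd i F differentiable (at z)"
    and cont: "\<And>i j. isCont (pd i (pd j F)) y"
  shows "pd i (pd j F) y = pd j (pd i F) y"
proof (rule ccontr)
  assume ne: "pd i (pd j F) y \<noteq> pd j (pd i F) y"
  \<comment> \<open>Half the gap: equal mixed partials at two points near y, each within e of its
    value at y, would put the gap strictly below 2e.\<close>
  define e where "e = \<bar>pd i (pd j F) y - pd j (pd i F) y\<bar> / 2"
  have e: "e > 0" using ne by (simp add: e_def)
  obtain d1 where d1: "d1 > 0" "\<And>z. dist z y < d1 \<Longrightarrow> \<bar>pd i (pd j F) z - pd i (pd j F) y\<bar> < e"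
    using cont[of i j] e unfolding continuous_at_eps_delta dist_real_def by blast
  obtain d2 where d2: "d2 > 0" "\<And>z. dist z y < d2 \<Longrightarrow> \<bar>pd j (pd i F) z - pd j (pd i F) y\<bar> < e"
    using cont[of j i] e unfolding continuous_at_eps_delta dist_real_def by blast
  obtain d3 where d3: "d3 > 0" "ball y d3 \<subseteq> S"
    using assms(1,2) openE by blast
  \<comment> \<open>A third, so that two steps of length at most h stay strictly inside all three
    radii.\<close>
  define h where "h = min d1 (min d2 d3) / 3"
  have h: "h > 0" using d1 d2 d3 by (simp add: h_def)
  have near: "dist (y + s *\<^sub>R axis i 1 + t *\<^sub>R axis j 1) y < min d1 (min d2 d3)"
    if "0 \<le> s" "s \<le> h" "0 \<le> t" "t \<le> h" for s t and i j :: 2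
  proof -
    have "dist (y + s *\<^sub>R axis i 1 + t *\<^sub>R axis j 1) y
        = norm (s *\<^sub>R axis i (1::real) + t *\<^sub>R axis j 1 :: real^2)"
      by (simp add: dist_norm add.assoc)
    also have "\<dots> \<le> norm (s *\<^sub>R axis i (1::real) :: real^2) + norm (t *\<^sub>R axis j (1::real) :: real^2)"
      by (rule norm_triangle_ineq)
    also have "\<dots> \<le> h + h"
      using that by simp
    also have "\<dots> < min d1 (min d2 d3)"
      using d1(1) d2(1) d3(1) unfolding h_def min_def by (auto split: if_splits)
    finally show ?thesis .
  qed
  then have inS: "y + s *\<^sub>R axis i 1 + t *\<^sub>R axis j 1 \<in> S"
    if "0 \<le> s" "s \<le> h" "0 \<le> t" "t \<le> h" for s t and i j :: 2
    using that d3(2) by (force simp: dist_commute)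
  obtain s t where st: "0 < s" "s < h" "0 < t" "t < h"
    "F (y + h *\<^sub>R axis i 1 + h *\<^sub>R axis j 1) - F (y + h *\<^sub>R axis i 1) - F (y + h *\<^sub>R axis j 1) + F y
      = h * h * pd j (pd i F) (y + s *\<^sub>R axis i 1 + t *\<^sub>R axis j 1)"
    using mean_value_square[OF h inS dF dpF, of i j] by blast
  obtain s' t' where st': "0 < s'" "s' < h" "0 < t'" "t' < h"
    "F (y + h *\<^sub>R axis j 1 + h *\<^sub>R axis i 1) - F (y + h *\<^sub>R axis j 1) - F (y + h *\<^sub>R axis i 1) + F y
      = h * h * pd i (pd j F) (y + s' *\<^sub>R axis j 1 + t' *\<^sub>R axis i 1)"
    using mean_value_square[OF h inS dF dpF, of j i] by blast
  have sw: "y + h *\<^sub>R axis j 1 + h *\<^sub>R axis i 1 = y + h *\<^sub>R axis i 1 + h *\<^sub>R axis j 1"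
    by simp
  have "h * h * pd j (pd i F) (y + s *\<^sub>R axis i 1 + t *\<^sub>R axis j 1)
      = h * h * pd i (pd j F) (y + s' *\<^sub>R axis j 1 + t' *\<^sub>R axis i 1)"
    using st(5) st'(5) unfolding sw by linarith
  then have eq: "pd j (pd i F) (y + s *\<^sub>R axis i 1 + t *\<^sub>R axis j 1)
      = pd i (pd j F) (y + s' *\<^sub>R axis j 1 + t' *\<^sub>R axis i 1)"
    using h by simp
  have "\<bar>pd j (pd i F) (y + s *\<^sub>R axis i 1 + t *\<^sub>R axis j 1) - pd j (pd i F) y\<bar> < e"
    by (rule d2(2)) (use near[of s t i j] st in auto)
  moreover have "\<bar>pd i (pd j F) (y + s' *\<^sub>R axis j 1 + t' *\<^sub>R axis i 1) - pd i (pd j F) y\<bar> < e"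
    by (rule d1(2)) (use near[of s' t' j i] st' in auto)
  ultimately have "\<bar>pd i (pd j F) y - pd j (pd i F) y\<bar> < e + e"
    unfolding eq by linarith
  then show False
    by (simp add: e_def)
qed

section \<open>Smooth functions\<close>

lemma smooth_on_iff:
  "smooth_on S F \<longleftrightarrow> (\<forall>y\<in>S. F differentiable (at y)) \<and> (\<forall>i. smooth_on S (pd i F))"
proof
  assume *: "smooth_on S F"
  have "foldr pd [] F differentiable (at y)" if "y \<in> S" for y
    using * that unfolding smooth_on_def by blast
  moreover have "foldr pd (is @ [i]) F differentiable (at y)" if "y \<in> S" for y i "is"
    using * that unfolding smooth_on_def by blast
  ultimately show "(\<forall>y\<in>S. F differentiable (at y)) \<and> (\<forall>i. smooth_on S (pd i F))"
    by (simp add: smooth_on_def)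
next
  assume *: "(\<forall>y\<in>S. F differentiable (at y)) \<and> (\<forall>i. smooth_on S (pd i F))"
  have "foldr pd is F differentiable (at y)" if "y \<in> S" for y "is"
    \<comment> \<open>\<open>foldr\<close> applies the last index first, so the innermost derivative
      is split off at the end of the list.\<close>
    using * that by (cases "is" rule: rev_cases) (auto simp: smooth_on_def)
  then show "smooth_on S F"
    by (simp add: smooth_on_def)
qed

lemma smooth_on_differentiable: "smooth_on S F \<Longrightarrow> y \<in> S \<Longrightarrow> F differentiable (at y)"
  using smooth_on_iff by blast

lemma smooth_on_pd: "smooth_on S F \<Longrightarrow> smooth_on S (pd i F)"
  using smooth_on_iff by blast

lemma smooth_on_subset: "smooth_on S F \<Longrightarrow> T \<subseteq> S \<Longrightarrow> smooth_on T F"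
  by (auto simp: smooth_on_def)

lemma smooth_on_transform:
  assumes "open S" "smooth_on S F" "\<And>z. z \<in> S \<Longrightarrow> F z = G z"
  shows "smooth_on S G"
proof -
  have "\<forall>z\<in>S. foldr pd is F z = foldr pd is G z" for "is"
    by (induction "is") (use assms in \<open>auto intro!: pd_transform_open[OF assms(1)]\<close>)
  then show ?thesis
    using assms differentiable_transform_open[OF assms(1)] unfolding smooth_on_def by blast
qed

lemma smooth_on_bounded_linear:
  assumes "open S" "bounded_linear L" "smooth_on S F"
  shows "smooth_on S (\<lambda>z. L (F z))"
proof -
  have *: "\<forall>z\<in>S. foldr pd is (\<lambda>z. L (F z)) z = L (foldr pd is F z)" for "is"
  proof (induction "is")
    case (Cons i "is")
    have "pd i (foldr pd is (\<lambda>z. L (F z))) z = L (pd i (foldr pd is F) z)" if z: "z \<in> S" for z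
    proof -
      have "foldr pd is F differentiable (at z)"
        using assms(3) z by (auto simp: smooth_on_def)
      then show ?thesis
        using pd_transform_open[OF assms(1) z, of "foldr pd is (\<lambda>z. L (F z))" "\<lambda>z. L (foldr pd is F z)" i]
          Cons pd_bounded_linear[OF assms(2)] by metis
    qed
    then show ?case by simp
  qed simp
  have "foldr pd is (\<lambda>z. L (F z)) differentiable (at z)" if z: "z \<in> S" for z "is"
  proof (rule differentiable_transform_open[OF assms(1) z])
    show "(\<lambda>z. L (foldr pd is F z)) differentiable (at z)"
      using assms(3) z by (intro differentiable_bounded_linear[OF assms(2)]) (auto simp: smooth_on_def)
  qed (use * in auto)
  then show ?thesis
    by (simp add: smooth_on_def)
qed

text \<open>If the partial derivatives of the members of X lie in the algebra generated by X and the
  smooth functions, then this algebra is closed under partial differentiation, hence consists of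
  smooth functions. This yields closure under products (X empty) and under inverse square roots.\<close>

inductive smooth_alg ::
    "(real^2) set \<Rightarrow> (real^2 \<Rightarrow> 'b::real_normed_algebra) set \<Rightarrow> (real^2 \<Rightarrow> 'b) \<Rightarrow> bool"
  for S X where
  gen: "F \<in> X \<Longrightarrow> smooth_alg S X F"
| smooth: "smooth_on S F \<Longrightarrow> smooth_alg S X F"
| add: "smooth_alg S X F \<Longrightarrow> smooth_alg S X G \<Longrightarrow> smooth_alg S X (\<lambda>z. F z + G z)"
| mult: "smooth_alg S X F \<Longrightarrow> smooth_alg S X G \<Longrightarrow> smooth_alg S X (\<lambda>z. F z * G z)"

lemma smooth_on_alg:
  assumes "open S" "smooth_alg S X F"
    and X: "\<And>F. F \<in> X \<Longrightarrow> (\<forall>y\<in>S. F differentiable (at y)) \<and>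
      (\<forall>i. \<exists>F'. smooth_alg S X F' \<and> (\<forall>y\<in>S. pd i F y = F' y))"
  shows "smooth_on S F"
proof -
  \<comment> \<open>\<open>pd i F\<close> is controlled only on S, so the algebra is asked for a
    member F' that agrees with it there.\<close>
  have step: "(\<forall>y\<in>S. F differentiable (at y)) \<and>
      (\<forall>i. \<exists>F'. smooth_alg S X F' \<and> (\<forall>y\<in>S. pd i F y = F' y))" if "smooth_alg S X F" for F
    using that
  proof induction
    case (gen F)
    then show ?case by (rule X)
  next
    case (smooth F)
    then show ?case
      using smooth_on_differentiable smooth_on_pd smooth_alg.smooth by blast
  next
    case (add F G)
    have "\<exists>F'. smooth_alg S X F' \<and> (\<forall>y\<in>S. pd i (\<lambda>z. F z + G z) y = F' y)" for i
    proof -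
      obtain F' G' where "smooth_alg S X F'" "\<forall>y\<in>S. pd i F y = F' y"
        "smooth_alg S X G'" "\<forall>y\<in>S. pd i G y = G' y"
        using add.IH by blast
      then show ?thesis
        using add.IH
        by (intro exI[of _ "\<lambda>z. F' z + G' z"]) (auto simp: pd_add intro: smooth_alg.intros)
    qed
    then show ?case
      using add.IH by (auto intro: differentiable_add)
  next
    case (mult F G)
    have "\<exists>F'. smooth_alg S X F' \<and> (\<forall>y\<in>S. pd i (\<lambda>z. F z * G z) y = F' y)" for i
    proof -
      obtain F' G' where "smooth_alg S X F'" "\<forall>y\<in>S. pd i F y = F' y"
        "smooth_alg S X G'" "\<forall>y\<in>S. pd i G y = G' y"
        using mult.IH by blast
      then show ?thesis
        using mult.IH mult.hyps
        by (intro exI[of _ "\<lambda>z. F' z * G z + F z * G' z"])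
          (auto simp: pd_mult intro!: smooth_alg.add smooth_alg.mult)
    qed
    then show ?case
      using mult.IH by (auto intro: differentiable_mult)
  qed
  have "\<exists>F'. smooth_alg S X F' \<and> (\<forall>y\<in>S. foldr pd is F y = F' y)" for "is"
  proof (induction "is")
    case Nil
    then show ?case using assms(2) by auto
  next
    case (Cons i "is")
    then obtain F' where F': "smooth_alg S X F'" "\<forall>y\<in>S. foldr pd is F y = F' y"
      by blast
    obtain F'' where "smooth_alg S X F''" "\<forall>y\<in>S. pd i F' y = F'' y"
      using step[OF F'(1)] by blast
    then show ?case
      using pd_transform_open[OF assms(1), of _ "foldr pd is F" F' i] F'(2) by auto
  qed
  then have "foldr pd is F differentiable (at y)" if "y \<in> S" for "is" y
    using differentiable_transform_open[OF assms(1) that, of _ "foldr pd is F"] step that by metis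
  then show ?thesis
    by (simp add: smooth_on_def)
qed

lemma smooth_on_add:
  assumes "open S" "smooth_on S F" "smooth_on S G"
  shows "smooth_on S (\<lambda>z. F z + G z :: 'b::real_normed_algebra)"
  by (rule smooth_on_alg[OF assms(1), where X = "{}"]) (use assms in \<open>auto intro: smooth_alg.intros\<close>)

lemma smooth_on_mult:
  assumes "open S" "smooth_on S F" "smooth_on S G"
  shows "smooth_on S (\<lambda>z. F z * G z :: 'b::real_normed_algebra)"
  by (rule smooth_on_alg[OF assms(1), where X = "{}"]) (use assms in \<open>auto intro: smooth_alg.intros\<close>)

lemma smooth_on_const: "smooth_on S (\<lambda>z. a)"
proof -
  have pd0: "pd i (\<lambda>z::real^2. b) = (\<lambda>z. 0)" for i and b :: 'a
    by (rule ext) simp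
  have "\<exists>b. foldr pd is (\<lambda>z. a) = (\<lambda>z. b)" for "is"
    by (induction "is") (auto simp: pd0)
  then show ?thesis
    unfolding smooth_on_def by (metis differentiable_const)
qed

lemma smooth_on_minus: "open S \<Longrightarrow> smooth_on S F \<Longrightarrow> smooth_on S (\<lambda>z. - F z)"
  by (rule smooth_on_bounded_linear) (auto intro: bounded_linear_minus bounded_linear_ident)

lemma smooth_on_diff:
  assumes "open S" "smooth_on S F" "smooth_on S G"
  shows "smooth_on S (\<lambda>z. F z - G z :: 'b::real_normed_algebra)"
  using smooth_on_add[OF assms(1,2) smooth_on_minus[OF assms(1,3)]] by simp

lemma smooth_on_sum:
  assumes "open S" "\<And>a. a \<in> A \<Longrightarrow> smooth_on S (F a)"
  shows "smooth_on S (\<lambda>z. \<Sum>a\<in>A. F a z :: 'b::real_normed_algebra)"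
  using assms(2)
  by (induction A rule: infinite_finite_induct)
    (auto intro: smooth_on_const smooth_on_add[OF assms(1)])

lemma smooth_on_of_real:
  assumes "open S" "smooth_on S F"
  shows "smooth_on S (\<lambda>z. of_real (F z) :: complex)"
  by (rule smooth_on_bounded_linear[OF assms(1) bounded_linear_of_real assms(2)])

lemma smooth_on_nth:
  assumes "open S" "smooth_on S F"
  shows "smooth_on S (\<lambda>z. F z $ i)"
  by (rule smooth_on_bounded_linear[OF assms(1) bounded_linear_vec_nth assms(2)])

text \<open>The derivative of R = F^(-1/2) is -1/2 R^3 times that of F, hence again in the algebra
  generated by R and the smooth functions.\<close>

lemma smooth_on_inverse_sqrt:
  fixes F :: "real^2 \<Rightarrow> real"
  assumes "open S" "smooth_on S F" and pos: "\<And>z. z \<in> S \<Longrightarrow> F z > 0"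
  shows "smooth_on S (\<lambda>z. inverse (sqrt (F z)))"
proof -
  let ?R = "\<lambda>z. inverse (sqrt (F z))"
  have R: "smooth_alg S {?R} ?R"
    by (rule smooth_alg.gen) simp
  have dF: "F differentiable (at y)" if "y \<in> S" for y
    using smooth_on_differentiable[OF assms(2) that] .
  have D: "((\<lambda>t. inverse (sqrt t)) has_real_derivative - (1/2) * inverse (sqrt t) ^ 3) (at t)"
    if "t > 0" for t
  proof -
    have "((\<lambda>t. inverse (sqrt t)) has_real_derivative
        - (inverse (sqrt t) * (inverse (sqrt t) / 2) * inverse (sqrt t))) (at t)"
      by (rule DERIV_inverse'[OF DERIV_real_sqrt]) (use that in auto)
    then show ?thesis
      by (simp add: power3_eq_cube mult.assoc mult.commute)
  qed
  have "(\<forall>y\<in>S. ?R differentiable (at y)) \<and>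
      (\<forall>i. \<exists>F'. smooth_alg S {?R} F' \<and> (\<forall>y\<in>S. pd i ?R y = F' y))"
  proof (intro conjI ballI allI)
    fix y assume "y \<in> S"
    then show "?R differentiable (at y)"
      using differentiable_transform_real(1)[OF D dF] pos by blast
  next
    fix i
    show "\<exists>F'. smooth_alg S {?R} F' \<and> (\<forall>y\<in>S. pd i ?R y = F' y)"
    proof (intro exI conjI ballI)
      show "smooth_alg S {?R} (\<lambda>z. (- (1/2)) * (?R z * (?R z * ?R z)) * pd i F z)"
        by (intro smooth_alg.mult R smooth_alg.smooth smooth_on_const smooth_on_pd assms)
    next
      fix y assume "y \<in> S"
      then show "pd i ?R y = (- (1/2)) * (?R y * (?R y * ?R y)) * pd i F y"
        using differentiable_transform_real(2)[OF D dF] pos by (simp add: power3_eq_cube)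
    qed
  qed
  then show ?thesis
    by (intro smooth_on_alg[OF assms(1) R]) auto
qed

lemma smooth_on_inverse:
  fixes F :: "real^2 \<Rightarrow> real"
  assumes "open S" "smooth_on S F" and pos: "\<And>z. z \<in> S \<Longrightarrow> F z > 0"
  shows "smooth_on S (\<lambda>z. inverse (F z))"
proof (rule smooth_on_transform[OF assms(1)])
  show "smooth_on S (\<lambda>z. inverse (sqrt (F z)) * inverse (sqrt (F z)))"
    by (intro smooth_on_mult smooth_on_inverse_sqrt assms)
  show "inverse (sqrt (F z)) * inverse (sqrt (F z)) = inverse (F z)" if "z \<in> S" for z
    using pos[OF that] by (simp flip: inverse_mult_distrib)
qed

lemma pd_commute_smooth_real:
  fixes F :: "real^2 \<Rightarrow> real"
  assumes "open S" "smooth_on S F" "y \<in> S"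
  shows "pd i (pd j F) y = pd j (pd i F) y"
proof (rule pd_commute_real[OF assms(1,3)])
  show "isCont (pd i (pd j F)) y" for i j
    by (intro differentiable_imp_continuous_within smooth_on_differentiable[OF _ assms(3)] smooth_on_pd assms)
qed (use assms smooth_on_differentiable smooth_on_pd in blast)+

lemma pd_commute:
  fixes F :: "real^2 \<Rightarrow> complex"
  assumes "open S" "smooth_on S F" "y \<in> S"
  shows "pd i (pd j F) y = pd j (pd i F) y"
proof -
  have *: "L (pd i (pd j F) y) = L (pd j (pd i F) y)" if L: "bounded_linear L" for L :: "complex \<Rightarrow> real"
  proof -
    have s: "smooth_on S (\<lambda>z. L (F z))"
      by (rule smooth_on_bounded_linear[OF assms(1) L assms(2)])
    have "L (pd i (pd j F) y) = pd i (pd j (\<lambda>z. L (F z))) y" for i j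
    proof -
      have "L (pd i (pd j F) y) = pd i (\<lambda>z. L (pd j F z)) y"
        by (rule pd_bounded_linear[OF L, symmetric])
          (use assms smooth_on_pd smooth_on_differentiable in blast)
      also have "\<dots> = pd i (pd j (\<lambda>z. L (F z))) y"
        by (rule pd_transform_open[OF assms(1,3)])
          (use assms pd_bounded_linear[OF L] smooth_on_differentiable in metis)
      finally show ?thesis .
    qed
    then show ?thesis
      using pd_commute_smooth_real[OF assms(1) s assms(3)] by metis
  qed
  show ?thesis
    using *[OF bounded_linear_Re] *[OF bounded_linear_Im] by (simp add: complex_eq_iff)
qed

section \<open>Contraction of tensor components with a frame\<close>

abbreviation weight :: "bool list \<Rightarrow> int" where
  "weight w \<equiv> sum_list (map sg w)"

lemma sg_simps [simp]: "sg True = 1" "sg False = - 1"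
  by (simp_all add: sg_def)

text \<open>The value T(h_w1,...,h_wk) of a covariant tensor on frame vectors or, when h is a
  coframe, a component of a contravariant tensor. The recursion consumes the first index, the one
  that \<open>cov_deriv\<close> adds.\<close>

fun contract :: "(bool \<Rightarrow> 2 \<Rightarrow> complex) \<Rightarrow> bool list \<Rightarrow> (2 list \<Rightarrow> complex) \<Rightarrow> complex" where
  "contract h [] T = T []"
| "contract h (s # w) T = (\<Sum>i\<in>UNIV. h s i * contract h w (\<lambda>I. T (i # I)))"

lemma contract_cong:
  assumes "\<And>I. length I = length w \<Longrightarrow> T I = T' I"
  shows "contract h w T = contract h w T'"
  using assms
proof (induction w arbitrary: T T')
  case (Cons s w)
  have "contract h w (\<lambda>I. T (i # I)) = contract h w (\<lambda>I. T' (i # I))" for i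
    by (rule Cons.IH) (simp add: Cons.prems)
  then show ?case by simp
qed simp

lemma contract_zero: "contract h w (\<lambda>I. 0) = 0"
  by (induction w) auto

lemma contract_diff: "contract h w (\<lambda>I. T I - T' I) = contract h w T - contract h w T'"
  by (induction w arbitrary: T T') (simp_all add: right_diff_distrib sum_subtractf)

lemma contract_scale: "contract h w (\<lambda>I. a * T I) = a * contract h w T"
  by (induction w arbitrary: T) (simp_all add: sum_distrib_left mult.left_commute)

lemma contract_add: "contract h w (\<lambda>I. T I + T' I) = contract h w T + contract h w T'"
  by (induction w arbitrary: T T') (simp_all add: distrib_left sum.distrib)

lemma contract_sum: "contract h w (\<lambda>I. \<Sum>a\<in>A. T a I) = (\<Sum>a\<in>A. contract h w (T a))"
  by (induction A rule: infinite_finite_induct) (simp_all add: contract_zero contract_add)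

text \<open>The derivation extending P to all tensor slots. With P built from Christoffel symbols it
  gives, up to sign, the correction terms of \<open>cov_deriv\<close> and of the parallel
  equation.\<close>

definition slot_act :: "(2 \<Rightarrow> 2 \<Rightarrow> complex) \<Rightarrow> (2 list \<Rightarrow> complex) \<Rightarrow> 2 list \<Rightarrow> complex" where
  "slot_act P T J = (\<Sum>a<length J. \<Sum>m\<in>UNIV. P (J ! a) m * T (J[a := m]))"

lemma slot_act_Nil [simp]: "slot_act P T [] = 0"
  by (simp add: slot_act_def)

lemma slot_act_Cons:
  "slot_act P T (j # J) = (\<Sum>m\<in>UNIV. P j m * T (m # J)) + slot_act P (\<lambda>I. T (j # I)) J"
  by (simp add: slot_act_def sum.lessThan_Suc_shift del: sum.lessThan_Suc)

lemma contract_differentiable: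
  assumes "\<And>s m. (\<lambda>z. h z s m) differentiable (at y)"
    and "\<And>I. length I = length w \<Longrightarrow> (\<lambda>z. T z I) differentiable (at y)"
  shows "(\<lambda>z. contract (h z) w (T z)) differentiable (at y)"
  using assms(2)
proof (induction w arbitrary: T)
  case (Cons s w)
  show ?case
    by (simp, intro differentiable_sum differentiable_mult assms(1) Cons.IH ballI)
      (auto intro: Cons.prems)
qed simp

lemma contract_smooth:
  assumes "open S" "\<And>s m. smooth_on S (\<lambda>z. h z s m)"
    and "\<And>I. length I = length w \<Longrightarrow> smooth_on S (\<lambda>z. T z I)"
  shows "smooth_on S (\<lambda>z. contract (h z) w (T z))"
  using assms(3)
proof (induction w arbitrary: T)
  case (Cons s w)
  show ?case
    by (simp, intro smooth_on_sum smooth_on_mult assms(1,2) Cons.IH) (auto intro: Cons.prems)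
qed simp

text \<open>Leibniz rule along a frame whose derivative has a scalar part, carrying the sign of the
  letter, and a matrix part. The matrix parts complete the derivative of T to a covariant one, and
  the scalar parts add up to the weight. For the coframe \<open>cv\<close>, compared with
  \<open>hv\<close>, A changes sign and P becomes minus its transpose.\<close>

lemma pd_contract:
  assumes h: "\<And>s m. (\<lambda>z. h z s m) differentiable (at y)"
    and dh: "\<And>s m. pd i (\<lambda>z. h z s m) y = of_int (sg s) * A * h y s m - (\<Sum>j\<in>UNIV. h y s j * P j m)"
    and T: "\<And>I. length I = length w \<Longrightarrow> (\<lambda>z. T z I) differentiable (at y)"
  shows "pd i (\<lambda>z. contract (h z) w (T z)) y =
    contract (h y) w (\<lambda>I. pd i (\<lambda>z. T z I) y - slot_act P (T y) I)
      + of_int (weight w) * A * contract (h y) w (T y)"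
  using T
proof (induction w arbitrary: T)
  case Nil
  then show ?case by simp
next
  case (Cons s w)
  let ?C = "\<lambda>j. contract (h y) w (\<lambda>I. T y (j # I))"
  let ?Q = "\<lambda>j. contract (h y) w (\<lambda>I. pd i (\<lambda>z. T z (j # I)) y - slot_act P (\<lambda>I. T y (j # I)) I)"
  have d: "(\<lambda>z. contract (h z) w (\<lambda>I. T z (j # I))) differentiable (at y)" for j
    by (intro contract_differentiable h) (auto intro: Cons.prems)
  have "pd i (\<lambda>z. contract (h z) (s # w) (T z)) y
      = (\<Sum>j\<in>UNIV. pd i (\<lambda>z. h z s j * contract (h z) w (\<lambda>I. T z (j # I))) y)"
    by (simp add: pd_sum[OF differentiable_mult[OF h d]])
  also have "\<dots> = (\<Sum>j\<in>UNIV. pd i (\<lambda>z. h z s j) y * ?C j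
      + h y s j * (?Q j + of_int (weight w) * A * ?C j))"
    by (intro sum.cong refl, subst pd_mult[OF h d], subst Cons.IH) (auto intro: Cons.prems)
  also have "\<dots> = (\<Sum>j\<in>UNIV. h y s j * ?Q j) - (\<Sum>j\<in>UNIV. (\<Sum>m\<in>UNIV. h y s m * P m j) * ?C j)
      + of_int (weight (s # w)) * A * (\<Sum>j\<in>UNIV. h y s j * ?C j)"
    by (simp add: dh algebra_simps sum.distrib sum_subtractf sum_distrib_left)
  also have "(\<Sum>j\<in>UNIV. (\<Sum>m\<in>UNIV. h y s m * P m j) * ?C j)
      = (\<Sum>m\<in>UNIV. h y s m * contract (h y) w (\<lambda>I. \<Sum>j\<in>UNIV. P m j * T y (j # I)))"
    unfolding contract_sum contract_scale sum_distrib_left sum_distrib_right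
    by (subst sum.swap) (simp add: mult.assoc)
  also have "(\<Sum>j\<in>UNIV. h y s j * ?Q j)
      - (\<Sum>m\<in>UNIV. h y s m * contract (h y) w (\<lambda>I. \<Sum>j\<in>UNIV. P m j * T y (j # I)))
      = contract (h y) (s # w) (\<lambda>I. pd i (\<lambda>z. T z I) y - slot_act P (T y) I)"
    by (simp add: slot_act_Cons contract_diff contract_add right_diff_distrib distrib_left
        sum_subtractf sum.distrib)
  finally show ?case
    by (simp only: contract.simps)
qed

lemma finite_lists_of_length [simp]: "finite {w :: 'a::finite list. length w = k}"
  using finite_lists_length_eq[of "UNIV :: 'a set" k] by simp

lemma sum_lists_Suc:
  fixes F :: "'a::finite list \<Rightarrow> 'b::comm_monoid_add"
  shows "(\<Sum>w\<in>{w. length w = Suc k}. F w) = (\<Sum>s\<in>UNIV. \<Sum>w\<in>{w. length w = k}. F (s # w))"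
proof -
  have "{w :: 'a list. length w = Suc k} = (\<lambda>(s, w). s # w) ` (UNIV \<times> {w. length w = k})"
    by (auto simp: length_Suc_conv)
  moreover have "inj_on (\<lambda>(s, w). s # w) (UNIV \<times> {w :: 'a list. length w = k})"
    by (auto simp: inj_on_def)
  ultimately show ?thesis
    by (simp add: sum.reindex sum.cartesian_product case_prod_unfold)
qed

lemma contract_eq_sum:
  "contract h w T = (\<Sum>I\<in>{I. length I = length w}. (\<Prod>b<length w. h (w ! b) (I ! b)) * T I)"
proof (induction w arbitrary: T)
  case (Cons s w)
  then show ?case
    by (simp add: sum_lists_Suc prod.lessThan_Suc_shift sum_distrib_left mult.assoc
        del: prod.lessThan_Suc)
qed simp

lemma contract_dual_basis:
  assumes "\<And>s s'. (\<Sum>i\<in>UNIV. \<theta> s i * h s' i) = (if s = s' then 1 else 0)"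
    and "length w = length w'"
  shows "contract \<theta> w (\<lambda>I. \<Prod>b<length w'. h (w' ! b) (I ! b)) = (if w = w' then 1 else 0)"
  using assms(2)
proof (induction w w' rule: list_induct2)
  case (Cons s w s' w')
  then have "contract \<theta> (s # w) (\<lambda>I. \<Prod>b<length (s' # w'). h ((s' # w') ! b) (I ! b))
      = (\<Sum>i\<in>UNIV. \<theta> s i * h s' i) * (if w = w' then 1 else 0)"
    by (simp add: prod.lessThan_Suc_shift contract_scale sum_distrib_right mult.assoc del: prod.lessThan_Suc)
  then show ?case
    using assms(1) by simp
qed simp

lemma dual_basis_expansion:
  assumes "\<And>i j. (\<Sum>s\<in>UNIV. h s i * \<theta> s j) = (if i = j then 1 else 0)"
    and "length I = k"
  shows "X I = (\<Sum>w\<in>{w. length w = k}. contract \<theta> w X * (\<Prod>b<k. h (w ! b) (I ! b)))"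
  using assms(2)
proof (induction k arbitrary: I X)
  case (Suc k)
  then obtain i J where I: "I = i # J" "length J = k"
    by (auto simp: length_Suc_conv)
  have "(\<Sum>w\<in>{w. length w = Suc k}. contract \<theta> w X * (\<Prod>b<Suc k. h (w ! b) (I ! b)))
      = (\<Sum>s\<in>UNIV. \<Sum>w\<in>{w. length w = k}. \<Sum>j\<in>UNIV. (h s i * \<theta> s j) *
          (contract \<theta> w (\<lambda>I. X (j # I)) * (\<Prod>b<k. h (w ! b) (J ! b))))"
    by (simp add: sum_lists_Suc prod.lessThan_Suc_shift I sum_distrib_left sum_distrib_right mult_ac
        del: prod.lessThan_Suc)
  also have "\<dots> = (\<Sum>s\<in>UNIV. \<Sum>j\<in>UNIV. \<Sum>w\<in>{w. length w = k}. (h s i * \<theta> s j) *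
          (contract \<theta> w (\<lambda>I. X (j # I)) * (\<Prod>b<k. h (w ! b) (J ! b))))"
    by (intro sum.cong refl sum.swap)
  also have "\<dots> = (\<Sum>s\<in>UNIV. \<Sum>j\<in>UNIV. (h s i * \<theta> s j) * X (j # J))"
    by (simp add: sum_distrib_left[symmetric] Suc.IH[OF I(2), symmetric])
  also have "\<dots> = (\<Sum>j\<in>UNIV. (\<Sum>s\<in>UNIV. h s i * \<theta> s j) * X (j # J))"
    unfolding sum_distrib_right by (rule sum.swap)
  also have "\<dots> = X I"
    unfolding assms(1) I by (simp add: if_distrib if_distribR cong: if_cong)
  finally show ?case by simp
qed simp

section \<open>Orthonormal frames on a surface patch\<close>

text \<open>One chart with its metric in coordinates. The constant vectors a1 and a2 seed a
  Gram-Schmidt frame on the whole patch; if they are orthonormal at one point, the frame extends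
  them from there.\<close>

locale surface_patch =
  fixes G :: "real^2 \<Rightarrow> real^2^2" and \<Omega> :: "(real^2) set" and K :: real and a1 a2 :: "real^2"
  assumes open_patch: "open \<Omega>"
    and smooth_G: "smooth_on \<Omega> G"
    and sym_G: "\<And>y. y \<in> \<Omega> \<Longrightarrow> transpose (G y) = G y"
    and pos_G: "\<And>y v. y \<in> \<Omega> \<Longrightarrow> v \<noteq> 0 \<Longrightarrow> v \<bullet> (G y *v v) > 0"
    and curv_G: "\<And>y u v. y \<in> \<Omega> \<Longrightarrow> u \<noteq> v \<Longrightarrow> independent {u, v} \<Longrightarrow> sectional_curvature G y u v = K"
    and a1_nonzero: "a1 \<noteq> 0" and a2_indep: "\<And>x. a2 \<noteq> x *\<^sub>R a1"
begin

definition ip :: "real^2 \<Rightarrow> real^2 \<Rightarrow> real^2 \<Rightarrow> real" where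
  "ip y u v = u \<bullet> (G y *v v)"

lemma ip_expand: "ip y u v = (\<Sum>j\<in>UNIV. \<Sum>k\<in>UNIV. G y $ j $ k * (u $ j * v $ k))"
  by (simp add: ip_def inner_vec_def matrix_vector_mult_def sum_distrib_left mult_ac)

lemma ip_bilinear:
  "ip y (u + u') v = ip y u v + ip y u' v" "ip y (u - u') v = ip y u v - ip y u' v"
  "ip y (x *\<^sub>R u) v = x * ip y u v"
  "ip y u (v + v') = ip y u v + ip y u v'" "ip y u (v - v') = ip y u v - ip y u v'"
  "ip y u (x *\<^sub>R v) = x * ip y u v"
  by (simp_all add: ip_def inner_add_left inner_diff_left matrix_vector_right_distrib
      matrix_vector_mult_diff_distrib inner_add_right inner_diff_right matrix_vector_mult_scaleR)

lemma ip_minus_right: "ip y u (- v) = - ip y u v"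
  using ip_bilinear(6)[of y u "- 1" v] by simp

lemma G_sym:
  assumes "y \<in> \<Omega>"
  shows "G y $ j $ k = G y $ k $ j"
proof -
  have "transpose (G y) $ k $ j = G y $ j $ k"
    by (simp add: transpose_def)
  then show ?thesis
    using sym_G[OF assms] by simp
qed

lemma ip_commute:
  assumes "y \<in> \<Omega>"
  shows "ip y u v = ip y v u"
  using G_sym[OF assms, of 1 2] by (simp add: ip_expand sum_2 algebra_simps)

lemma smooth_G_entry: "smooth_on \<Omega> (\<lambda>z. G z $ j $ k)"
  using smooth_on_nth[OF open_patch smooth_on_nth[OF open_patch smooth_G]] .

lemma smooth_ip:
  assumes "\<And>m. smooth_on \<Omega> (\<lambda>z. u z $ m)" "\<And>m. smooth_on \<Omega> (\<lambda>z. v z $ m)"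
  shows "smooth_on \<Omega> (\<lambda>z. ip z (u z) (v z))"
  unfolding ip_expand by (intro smooth_on_sum smooth_on_mult open_patch smooth_G_entry assms)

section \<open>The Gram-Schmidt frame and the inverse metric\<close>

definition E1 :: "real^2 \<Rightarrow> real^2" where
  "E1 y = inverse (sqrt (ip y a1 a1)) *\<^sub>R a1"

definition perp2 :: "real^2 \<Rightarrow> real^2" where
  "perp2 y = a2 - (ip y a1 a2 * inverse (ip y a1 a1)) *\<^sub>R a1"

definition E2 :: "real^2 \<Rightarrow> real^2" where
  "E2 y = inverse (sqrt (ip y (perp2 y) (perp2 y))) *\<^sub>R perp2 y"

lemma ip_a1_pos: "y \<in> \<Omega> \<Longrightarrow> ip y a1 a1 > 0"
  unfolding ip_def by (rule pos_G[OF _ a1_nonzero])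

lemma ip_perp2_pos: "y \<in> \<Omega> \<Longrightarrow> ip y (perp2 y) (perp2 y) > 0"
  unfolding ip_def by (rule pos_G) (use a2_indep in \<open>auto simp: perp2_def\<close>)

lemma ip_frame:
  assumes "y \<in> \<Omega>"
  shows "ip y (E1 y) (E1 y) = 1" "ip y (E2 y) (E2 y) = 1"
    "ip y (E1 y) (E2 y) = 0" "ip y (E2 y) (E1 y) = 0"
proof -
  have *: "inverse (sqrt x) * (inverse (sqrt x) * x) = 1" if "x > 0" for x :: real
    using that by (simp add: field_simps)
  show "ip y (E1 y) (E1 y) = 1"
    using *[OF ip_a1_pos[OF assms]] by (simp add: E1_def ip_bilinear)
  show "ip y (E2 y) (E2 y) = 1"
    using *[OF ip_perp2_pos[OF assms]] by (simp add: E2_def ip_bilinear)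
  have "ip y a1 (perp2 y) = 0"
    using ip_a1_pos[OF assms] by (simp add: perp2_def ip_bilinear)
  then show "ip y (E1 y) (E2 y) = 0"
    by (simp add: E1_def E2_def ip_bilinear)
  then show "ip y (E2 y) (E1 y) = 0"
    using ip_commute[OF assms] by simp
qed

lemma frame_at_orthonormal_point:
  assumes "ip y a1 a1 = 1" "ip y a2 a2 = 1" "ip y a1 a2 = 0"
  shows "E1 y = a1" "E2 y = a2"
  using assms by (simp_all add: E1_def E2_def perp2_def)

lemma smooth_E1: "smooth_on \<Omega> (\<lambda>z. E1 z $ m)"
  by (simp add: E1_def)
    (intro smooth_on_mult smooth_on_inverse_sqrt smooth_ip smooth_on_const open_patch ip_a1_pos)

lemma smooth_perp2: "smooth_on \<Omega> (\<lambda>z. perp2 z $ m)"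
  by (simp add: perp2_def)
    (intro smooth_on_diff smooth_on_mult smooth_on_inverse smooth_ip smooth_on_const open_patch ip_a1_pos)

lemma smooth_E2: "smooth_on \<Omega> (\<lambda>z. E2 z $ m)"
  by (simp add: E2_def)
    (intro smooth_on_mult smooth_on_inverse_sqrt smooth_ip smooth_perp2 open_patch ip_perp2_pos)

text \<open>Let N have the frame vectors as columns. Orthonormality says that the transpose of N,
  times G, is a left inverse of N; it is then also a right inverse, so N times its transpose is the
  inverse of G. Thus \<open>matrix_inv\<close> becomes a smooth expression in the frame.\<close>

lemma frame_matrix:
  assumes "y \<in> \<Omega>"
  defines "Q \<equiv> (\<chi> i j. E1 y $ i * E1 y $ j + E2 y $ i * E2 y $ j)"
  shows "Q ** G y = mat 1" "G y ** Q = mat 1"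
proof -
  define N :: "real^2^2" where "N = (\<chi> i a. if a = 1 then E1 y $ i else E2 y $ i)"
  have NT: "(transpose N ** G y) ** N = mat 1"
  proof -
    have "((transpose N ** G y) ** N) $ a $ b
        = ip y (if a = 1 then E1 y else E2 y) (if b = 1 then E1 y else E2 y)" for a b
      by (simp add: N_def matrix_matrix_mult_def transpose_def ip_expand sum_2 algebra_simps)
    then show ?thesis
      using ip_frame[OF assms(1)] by (auto simp: vec_eq_iff mat_def) (metis exhaust_2)+
  qed
  then have "N ** (transpose N ** G y) = mat 1"
    by (rule matrix_left_right_inverse[THEN iffD1])
  moreover have "N ** transpose N = Q"
    by (simp add: vec_eq_iff N_def Q_def matrix_matrix_mult_def transpose_def sum_2)
  ultimately show "Q ** G y = mat 1"
    by (simp add: matrix_mul_assoc)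
  then show "G y ** Q = mat 1"
    by (rule matrix_left_right_inverse[THEN iffD1])
qed

lemma matrix_inv_frame:
  assumes "y \<in> \<Omega>"
  shows "matrix_inv (G y) $ i $ j = E1 y $ i * E1 y $ j + E2 y $ i * E2 y $ j"
proof -
  let ?Q = "(\<chi> i j. E1 y $ i * E1 y $ j + E2 y $ i * E2 y $ j) :: real^2^2"
  have "\<exists>A. G y ** A = mat 1 \<and> A ** G y = mat 1"
    using frame_matrix[OF assms] by blast
  then have "matrix_inv (G y) ** G y = mat 1"
    unfolding matrix_inv_def by (rule someI2_ex) blast
  then have "matrix_inv (G y) = matrix_inv (G y) ** (G y ** ?Q)"
    by (simp only: frame_matrix[OF assms] matrix_mul_rid)
  also have "\<dots> = ?Q"
    using \<open>matrix_inv (G y) ** G y = mat 1\<close> by (simp only: matrix_mul_assoc matrix_mul_lid)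
  finally show ?thesis by simp
qed

lemma frame_expansion:
  assumes "y \<in> \<Omega>"
  shows "v = ip y (E1 y) v *\<^sub>R E1 y + ip y (E2 y) v *\<^sub>R E2 y"
proof -
  let ?Q = "(\<chi> i j. E1 y $ i * E1 y $ j + E2 y $ i * E2 y $ j) :: real^2^2"
  have "v = (?Q ** G y) *v v"
    using frame_matrix[OF assms] by simp
  also have "\<dots> = ?Q *v (G y *v v)"
    by (simp add: matrix_vector_mul_assoc)
  also have "\<dots> = ip y (E1 y) v *\<^sub>R E1 y + ip y (E2 y) v *\<^sub>R E2 y"
    by (simp add: vec_eq_iff ip_def inner_vec_def matrix_vector_mult_def[of ?Q] sum_2 algebra_simps)
  finally show ?thesis .
qed

section \<open>The Levi-Civita connection in the frame\<close>

abbreviation \<Gamma> :: "2 \<Rightarrow> 2 \<Rightarrow> 2 \<Rightarrow> real^2 \<Rightarrow> real" where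
  "\<Gamma> k i j y \<equiv> christoffel G k i j y"

lemma smooth_christoffel: "smooth_on \<Omega> (\<Gamma> k i j)"
proof (rule smooth_on_transform[OF open_patch])
  show "smooth_on \<Omega> (\<lambda>y. (1/2) * (\<Sum>m\<in>UNIV. (E1 y $ k * E1 y $ m + E2 y $ k * E2 y $ m) *
       (pd i (\<lambda>z. G z $ j $ m) y + pd j (\<lambda>z. G z $ i $ m) y - pd m (\<lambda>z. G z $ i $ j) y)))"
    by (intro smooth_on_mult smooth_on_const smooth_on_sum smooth_on_add smooth_on_diff smooth_E1
        smooth_E2 smooth_on_pd smooth_G_entry open_patch)
qed (simp add: christoffel_def matrix_inv_frame)

lemma pd_G_sym: "y \<in> \<Omega> \<Longrightarrow> pd i (\<lambda>z. G z $ j $ k) y = pd i (\<lambda>z. G z $ k $ j) y"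
  by (rule pd_transform_open[OF open_patch]) (auto simp: G_sym)

lemma christoffel_sym: "y \<in> \<Omega> \<Longrightarrow> \<Gamma> k i j y = \<Gamma> k j i y"
  using pd_G_sym[of y _ i j] by (simp add: christoffel_def add.commute)

lemma christoffel_lower:
  assumes "y \<in> \<Omega>"
  shows "(\<Sum>m\<in>UNIV. G y $ k $ m * \<Gamma> m i j y)
    = (1/2) * (pd i (\<lambda>z. G z $ j $ k) y + pd j (\<lambda>z. G z $ i $ k) y - pd k (\<lambda>z. G z $ i $ j) y)"
proof -
  let ?Q = "\<lambda>m l. E1 y $ m * E1 y $ l + E2 y $ m * E2 y $ l"
  let ?g = "\<lambda>l. pd i (\<lambda>z. G z $ j $ l) y + pd j (\<lambda>z. G z $ i $ l) y - pd l (\<lambda>z. G z $ i $ j) y"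
  have d: "(\<Sum>m\<in>UNIV. G y $ k $ m * ?Q m l) = (if k = l then 1 else 0)" for l
    using frame_matrix(2)[OF assms] by (simp add: vec_eq_iff matrix_matrix_mult_def mat_def)
  have "(\<Sum>m\<in>UNIV. G y $ k $ m * \<Gamma> m i j y)
      = (1/2) * (\<Sum>m\<in>UNIV. \<Sum>l\<in>UNIV. G y $ k $ m * ?Q m l * ?g l)"
    by (simp add: christoffel_def matrix_inv_frame[OF assms] sum_distrib_left mult.assoc mult.left_commute)
  also have "(\<Sum>m\<in>UNIV. \<Sum>l\<in>UNIV. G y $ k $ m * ?Q m l * ?g l)
      = (\<Sum>l\<in>UNIV. (\<Sum>m\<in>UNIV. G y $ k $ m * ?Q m l) * ?g l)"
    unfolding sum_distrib_right by (rule sum.swap)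
  also have "\<dots> = ?g k"
    unfolding d by (simp add: if_distrib if_distribR cong: if_cong)
  finally show ?thesis .
qed

text \<open>This is \<nabla>G = 0: in the sum of the two lowered Christoffel symbols all other
  derivatives of G cancel in pairs.\<close>

lemma metric_compatible:
  assumes "y \<in> \<Omega>"
  shows "pd i (\<lambda>z. G z $ j $ k) y
    = (\<Sum>m\<in>UNIV. \<Gamma> m i j y * G y $ m $ k) + (\<Sum>m\<in>UNIV. \<Gamma> m i k y * G y $ j $ m)"
proof -
  have "(\<Sum>m\<in>UNIV. \<Gamma> m i j y * G y $ m $ k) = (\<Sum>m\<in>UNIV. G y $ k $ m * \<Gamma> m i j y)"
    by (intro sum.cong refl) (simp add: G_sym[OF assms, of _ k] mult.commute)
  moreover have "(\<Sum>m\<in>UNIV. \<Gamma> m i k y * G y $ j $ m) = (\<Sum>m\<in>UNIV. G y $ j $ m * \<Gamma> m i k y)"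
    by (simp add: mult.commute)
  ultimately show ?thesis
    using christoffel_lower[OF assms, of k i j] christoffel_lower[OF assms, of j i k]
      pd_G_sym[OF assms, of i j k] pd_G_sym[OF assms, of j i k] pd_G_sym[OF assms, of k i j]
    by (simp add: field_simps)
qed

definition covd :: "2 \<Rightarrow> (real^2 \<Rightarrow> real^2) \<Rightarrow> real^2 \<Rightarrow> real^2" where
  "covd i v y = (\<chi> n. pd i (\<lambda>z. v z $ n) y + (\<Sum>k\<in>UNIV. \<Gamma> n i k y * v y $ k))"

lemma pd_ip:
  assumes y: "y \<in> \<Omega>" and u: "\<And>m. (\<lambda>z. u z $ m) differentiable (at y)"
    and v: "\<And>m. (\<lambda>z. v z $ m) differentiable (at y)"
  shows "pd i (\<lambda>z. ip z (u z) (v z)) y = ip y (covd i u y) (v y) + ip y (u y) (covd i v y)"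
proof -
  have g: "(\<lambda>z. G z $ j $ k) differentiable (at y)" for j k
    by (rule smooth_on_differentiable[OF smooth_G_entry y])
  have "pd i (\<lambda>z. ip z (u z) (v z)) y = (\<Sum>j\<in>UNIV. \<Sum>k\<in>UNIV. pd i (\<lambda>z. G z $ j $ k) y * (u y $ j * v y $ k)
      + G y $ j $ k * (pd i (\<lambda>z. u z $ j) y * v y $ k + u y $ j * pd i (\<lambda>z. v z $ k) y))"
    unfolding ip_expand
    by (simp add: pd_sum pd_mult g u v differentiable_mult differentiable_sum)
  also have "\<dots> = ip y (covd i u y) (v y) + ip y (u y) (covd i v y)"
    by (simp add: metric_compatible[OF y] ip_expand covd_def sum_2 algebra_simps)
  finally show ?thesis .
qed

text \<open>The connection 1-form of the frame, in coordinates.\<close>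

definition B :: "2 \<Rightarrow> real^2 \<Rightarrow> real" where
  "B i y = ip y (E2 y) (covd i E1 y)"

text \<open>Differentiating the three orthonormality relations shows that the connection matrix is
  skew, so the single form B determines it.\<close>

lemma covd_frame:
  assumes "y \<in> \<Omega>"
  shows "covd i E1 y = B i y *\<^sub>R E2 y" "covd i E2 y = - B i y *\<^sub>R E1 y"
proof -
  have d1: "(\<lambda>z. E1 z $ m) differentiable (at y)" for m
    by (rule smooth_on_differentiable[OF smooth_E1 assms])
  have d2: "(\<lambda>z. E2 z $ m) differentiable (at y)" for m
    by (rule smooth_on_differentiable[OF smooth_E2 assms])
  have c: "pd i (\<lambda>z. ip z (u z) (v z)) y = 0" if "\<And>z. z \<in> \<Omega> \<Longrightarrow> ip z (u z) (v z) = a" for u v a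
    using pd_transform_open[OF open_patch assms, of "\<lambda>z. ip z (u z) (v z)" "\<lambda>z. a" i] that by simp
  have "ip y (covd i E1 y) (E1 y) + ip y (E1 y) (covd i E1 y) = 0"
    using pd_ip[OF assms d1 d1] c[of E1 E1 1] ip_frame by simp
  then have 11: "ip y (E1 y) (covd i E1 y) = 0"
    using ip_commute[OF assms] by simp
  have "ip y (covd i E2 y) (E2 y) + ip y (E2 y) (covd i E2 y) = 0"
    using pd_ip[OF assms d2 d2] c[of E2 E2 1] ip_frame by simp
  then have 22: "ip y (E2 y) (covd i E2 y) = 0"
    using ip_commute[OF assms] by simp
  have "ip y (covd i E1 y) (E2 y) + ip y (E1 y) (covd i E2 y) = 0"
    using pd_ip[OF assms d1 d2] c[of E1 E2 0] ip_frame by simp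
  then have 12: "ip y (E1 y) (covd i E2 y) = - B i y"
    using ip_commute[OF assms] by (simp add: B_def)
  show "covd i E1 y = B i y *\<^sub>R E2 y"
    using frame_expansion[OF assms, of "covd i E1 y"] 11 by (simp add: B_def)
  show "covd i E2 y = - B i y *\<^sub>R E1 y"
    using frame_expansion[OF assms, of "covd i E2 y"] 12 22 by simp
qed

lemma pd_frame:
  assumes "y \<in> \<Omega>"
  shows "pd i (\<lambda>z. E1 z $ n) y = B i y * E2 y $ n - (\<Sum>k\<in>UNIV. \<Gamma> n i k y * E1 y $ k)"
    "pd i (\<lambda>z. E2 z $ n) y = - B i y * E1 y $ n - (\<Sum>k\<in>UNIV. \<Gamma> n i k y * E2 y $ k)"
  using covd_frame[OF assms, of i] by (simp_all add: covd_def vec_eq_iff algebra_simps)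

lemma smooth_B: "smooth_on \<Omega> (B i)"
proof -
  have "smooth_on \<Omega> (\<lambda>y. ip y (E2 y) (covd i E1 y))"
    by (rule smooth_ip, rule smooth_E2, simp add: covd_def)
      (intro smooth_on_add smooth_on_sum smooth_on_mult smooth_on_pd smooth_E1 smooth_christoffel open_patch)
  then show ?thesis
    by (simp add: B_def[abs_def])
qed

definition dB :: "2 \<Rightarrow> 2 \<Rightarrow> real^2 \<Rightarrow> real" where
  "dB i j y = pd i (B j) y - pd j (B i) y"

text \<open>Cartan's structure equation: second partials of the components of E2 commute, and after
  inserting \<open>pd_frame\<close> twice the terms quadratic in B cancel, leaving the curvature
  tensor against dB.\<close>

lemma curvature_frame:
  assumes y: "y \<in> \<Omega>"
  shows "(\<Sum>k\<in>UNIV. (pd i (\<Gamma> n j k) y - pd j (\<Gamma> n i k) y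
       + (\<Sum>m\<in>UNIV. \<Gamma> n i m y * \<Gamma> m j k y - \<Gamma> n j m y * \<Gamma> m i k y)) * E2 y $ k)
    = - dB i j y * E1 y $ n"
proof -
  have dE1: "(\<lambda>z. E1 z $ m) differentiable (at y)" and dE2: "(\<lambda>z. E2 z $ m) differentiable (at y)"
    and dB: "B a differentiable (at y)" and dG: "\<Gamma> k a b differentiable (at y)" for m a b k
    by (rule smooth_on_differentiable[OF _ y], rule smooth_E1 smooth_E2 smooth_B smooth_christoffel)+
  have second: "pd i (pd j (\<lambda>z. E2 z $ n)) y =
      - (pd i (B j) y * E1 y $ n + B j y * (B i y * E2 y $ n - (\<Sum>k\<in>UNIV. \<Gamma> n i k y * E1 y $ k)))
      - (\<Sum>k\<in>UNIV. pd i (\<Gamma> n j k) y * E2 y $ k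
          + \<Gamma> n j k y * (- B i y * E1 y $ k - (\<Sum>m\<in>UNIV. \<Gamma> k i m y * E2 y $ m)))" for i j
  proof -
    have "pd i (pd j (\<lambda>z. E2 z $ n)) y
        = pd i (\<lambda>z. - (B j z * E1 z $ n) - (\<Sum>k\<in>UNIV. \<Gamma> n j k z * E2 z $ k)) y"
      by (rule pd_transform_open[OF open_patch y]) (simp add: pd_frame)
    also have "\<dots> = - (pd i (B j) y * E1 y $ n + B j y * pd i (\<lambda>z. E1 z $ n) y)
      - (\<Sum>k\<in>UNIV. pd i (\<Gamma> n j k) y * E2 y $ k + \<Gamma> n j k y * pd i (\<lambda>z. E2 z $ k) y)"
      by (simp add: pd_diff pd_minus pd_sum pd_mult dE1 dE2 dB dG differentiable_mult
          differentiable_minus differentiable_sum)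
    finally show ?thesis
      by (simp add: pd_frame[OF y])
  qed
  have "pd i (pd j (\<lambda>z. E2 z $ n)) y = pd j (pd i (\<lambda>z. E2 z $ n)) y"
    by (rule pd_commute_smooth_real[OF open_patch smooth_E2 y])
  then show ?thesis
    unfolding second by (simp add: sum_2 dB_def algebra_simps)
qed

text \<open>By \<open>curvature_frame\<close>, R(E1,E2)E2 = -dB(E1,E2) E1, whose inner product with
  E1 is the sectional curvature of an orthonormal pair.\<close>

lemma dB_frame:
  assumes y: "y \<in> \<Omega>"
  shows "(\<Sum>i\<in>UNIV. \<Sum>j\<in>UNIV. dB i j y * E1 y $ i * E2 y $ j) = - K"
proof -
  let ?d = "\<Sum>i\<in>UNIV. \<Sum>j\<in>UNIV. dB i j y * E1 y $ i * E2 y $ j"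
  have "curvature G y (E1 y) (E2 y) (E2 y) = - ?d *\<^sub>R E1 y"
  proof (simp only: vec_eq_iff, intro allI)
    fix n
    have "curvature G y (E1 y) (E2 y) (E2 y) $ n = (\<Sum>i\<in>UNIV. \<Sum>j\<in>UNIV. (\<Sum>k\<in>UNIV. (pd i (\<Gamma> n j k) y - pd j (\<Gamma> n i k) y
       + (\<Sum>m\<in>UNIV. \<Gamma> n i m y * \<Gamma> m j k y - \<Gamma> n j m y * \<Gamma> m i k y)) * E2 y $ k) * (E1 y $ i * E2 y $ j))"
      unfolding curvature_def sum_distrib_right by (simp add: mult_ac)
    also have "\<dots> = (- ?d *\<^sub>R E1 y) $ n"
      unfolding curvature_frame[OF y] by (simp add: sum_2 algebra_simps)
    finally show "curvature G y (E1 y) (E2 y) (E2 y) $ n = (- ?d *\<^sub>R E1 y) $ n" .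
  qed
  then have "sectional_curvature G y (E1 y) (E2 y) = - ?d"
    using ip_frame[OF y] by (simp add: sectional_curvature_def ip_def[symmetric] ip_bilinear ip_minus_right)
  moreover have "E1 y \<noteq> E2 y"
    using ip_frame[OF y] by auto
  moreover have "independent {E1 y, E2 y}"
  proof -
    have "E2 y \<noteq> 0" "E1 y \<noteq> 0"
      using ip_frame[OF y] by (auto simp: ip_def)
    moreover have "E1 y \<noteq> x *\<^sub>R E2 y" for x
    proof
      assume "E1 y = x *\<^sub>R E2 y"
      then have "ip y (E1 y) (E1 y) = x * ip y (E1 y) (E2 y)"
        by (metis ip_bilinear(6))
      then show False
        using ip_frame[OF y] by simp
    qed
    ultimately show ?thesis
      by (auto simp: independent_insert span_singleton)
  qed
  ultimately show ?thesis
    using curv_G[OF y] by simp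
qed

section \<open>The isotropic frame\<close>

definition hv :: "real^2 \<Rightarrow> bool \<Rightarrow> 2 \<Rightarrow> complex" where
  "hv y s m = hvec (E1 y) (E2 y) s $ m"

text \<open>The isotropic vectors diagonalize the connection: h_s = E1 - s i E2 has covariant
  derivative s i B h_s. This i B is the form A of the overview.\<close>

definition conn :: "2 \<Rightarrow> real^2 \<Rightarrow> complex" where
  "conn i y = \<i> * of_real (B i y)"

text \<open>The coframe dual to \<open>hv\<close>. As h_s is isotropic, its dual covector pairs with
  the opposite vector, and 1/2 compensates (h_+,h_-) = 2.\<close>

definition cv :: "real^2 \<Rightarrow> bool \<Rightarrow> 2 \<Rightarrow> complex" where
  "cv y s m = (1/2) * (\<Sum>k\<in>UNIV. of_real (G y $ m $ k) * hv y (\<not> s) k)"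

lemma hv_eq: "hv y s m = of_real (E1 y $ m) - of_int (sg s) * \<i> * of_real (E2 y $ m)"
  by (simp add: hv_def hvec_def)

lemma smooth_hv: "smooth_on \<Omega> (\<lambda>z. hv z s m)"
  unfolding hv_eq
  by (intro smooth_on_diff smooth_on_mult smooth_on_const smooth_on_of_real smooth_E1 smooth_E2 open_patch)

lemma smooth_conn: "smooth_on \<Omega> (conn i)"
  unfolding conn_def[abs_def]
  by (intro smooth_on_mult smooth_on_const smooth_on_of_real smooth_B open_patch)

lemma smooth_cv: "smooth_on \<Omega> (\<lambda>z. cv z s m)"
  unfolding cv_def
  by (intro smooth_on_sum smooth_on_mult smooth_on_const smooth_on_of_real smooth_hv smooth_G_entry open_patch)

lemma pd_of_real: "F differentiable (at y) \<Longrightarrow> pd i (\<lambda>z. complex_of_real (F z)) y = of_real (pd i F y)"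
  by (rule pd_bounded_linear[OF bounded_linear_of_real])

lemma differentiable_of_real: "F differentiable (at y) \<Longrightarrow> (\<lambda>z. complex_of_real (F z)) differentiable (at y)"
  by (rule differentiable_bounded_linear[OF bounded_linear_of_real])

lemma pd_hv:
  assumes "y \<in> \<Omega>"
  shows "pd i (\<lambda>z. hv z s m) y
    = of_int (sg s) * conn i y * hv y s m - (\<Sum>j\<in>UNIV. hv y s j * of_real (\<Gamma> m i j y))"
proof -
  have d: "(\<lambda>z. E1 z $ m) differentiable (at y)" "(\<lambda>z. E2 z $ m) differentiable (at y)"
    by (rule smooth_on_differentiable[OF _ assms], rule smooth_E1 smooth_E2)+
  have "pd i (\<lambda>z. hv z s m) y
      = of_real (pd i (\<lambda>z. E1 z $ m) y) - of_int (sg s) * \<i> * of_real (pd i (\<lambda>z. E2 z $ m) y)"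
    unfolding hv_eq
    by (simp add: pd_diff pd_mult pd_of_real d differentiable_of_real differentiable_mult)
  then show ?thesis
    by (cases s) (simp_all add: pd_frame[OF assms] hv_eq conn_def sum_2 algebra_simps)
qed

lemma cv_hv:
  assumes "y \<in> \<Omega>"
  shows "(\<Sum>i\<in>UNIV. cv y s i * hv y s' i) = (if s = s' then 1 else 0)"
proof -
  have "(\<Sum>i\<in>UNIV. cv y s i * hv y s' i) = (1/2) * (of_real (ip y (E1 y) (E1 y))
      + of_int (sg s * sg s') * of_real (ip y (E2 y) (E2 y))
      + \<i> * (of_int (sg s) * of_real (ip y (E1 y) (E2 y)) - of_int (sg s') * of_real (ip y (E2 y) (E1 y))))"
    by (cases s; cases s') (simp_all add: cv_def hv_eq ip_expand sum_2 field_simps)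
  then show ?thesis
    using ip_frame[OF assms] by (cases s; cases s') simp_all
qed

lemma hv_cv:
  assumes "y \<in> \<Omega>"
  shows "(\<Sum>s\<in>UNIV. hv y s i * cv y s j) = (if i = j then 1 else 0)"
proof -
  have "(\<Sum>k\<in>UNIV. G y $ j $ k * (E1 y $ k * E1 y $ i + E2 y $ k * E2 y $ i)) = (if i = j then 1 else 0)"
    using frame_matrix(2)[OF assms] by (simp add: vec_eq_iff matrix_matrix_mult_def mat_def)
  moreover have "(\<Sum>s\<in>UNIV. hv y s i * cv y s j)
      = of_real (\<Sum>k\<in>UNIV. G y $ j $ k * (E1 y $ k * E1 y $ i + E2 y $ k * E2 y $ i))"
    by (simp add: UNIV_bool cv_def hv_eq sum_2 field_simps)
  ultimately show ?thesis by simp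
qed

lemma pd_cv:
  assumes y: "y \<in> \<Omega>"
  shows "pd i (\<lambda>z. cv z s m) y
    = of_int (sg s) * (- conn i y) * cv y s m - (\<Sum>j\<in>UNIV. cv y s j * (- of_real (\<Gamma> j i m y)))"
proof -
  have dG: "(\<lambda>z. G z $ j $ k) differentiable (at y)" for j k
    by (rule smooth_on_differentiable[OF smooth_G_entry y])
  have dh: "(\<lambda>z. hv z s k) differentiable (at y)" for s k
    by (rule smooth_on_differentiable[OF smooth_hv y])
  have "pd i (\<lambda>z. cv z s m) y = (1/2) * (\<Sum>k\<in>UNIV. of_real (pd i (\<lambda>z. G z $ m $ k) y) * hv y (\<not> s) k
      + of_real (G y $ m $ k) * pd i (\<lambda>z. hv z (\<not> s) k) y)"
    unfolding cv_def
    by (subst pd_mult, (intro differentiable_const differentiable_sum ballI differentiable_mult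
          differentiable_of_real dG dh finite)+)
      (simp add: pd_mult pd_sum pd_of_real dG dh differentiable_of_real differentiable_mult)
  then show ?thesis
    by (cases s) (simp_all add: metric_compatible[OF y] pd_hv[OF y] cv_def sum_2 algebra_simps)
qed

text \<open>On the pair h_+, h_- a 2-form takes 2i times its value on E1, E2. With the factor i of
  \<open>conn\<close> this gives -2 dB(E1,E2), and dB(E1,E2) = -K.\<close>

lemma conn_curvature:
  assumes y: "y \<in> \<Omega>"
  shows "(\<Sum>i\<in>UNIV. \<Sum>j\<in>UNIV. hv y True i * hv y False j * (pd i (conn j) y - pd j (conn i) y)) = of_real (2 * K)"
proof -
  have dB: "B a differentiable (at y)" for a
    by (rule smooth_on_differentiable[OF smooth_B y])
  have F: "pd i (conn j) y - pd j (conn i) y = \<i> * of_real (dB i j y)" for i j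
    unfolding conn_def[abs_def]
    by (simp add: pd_mult pd_of_real dB differentiable_of_real dB_def algebra_simps)
  have "(\<Sum>i\<in>UNIV. \<Sum>j\<in>UNIV. hv y True i * hv y False j * (pd i (conn j) y - pd j (conn i) y))
      = of_real (- 2 * (\<Sum>i\<in>UNIV. \<Sum>j\<in>UNIV. dB i j y * E1 y $ i * E2 y $ j))"
    unfolding F by (simp add: sum_2 hv_eq dB_def algebra_simps)
  then show ?thesis
    using dB_frame[OF y] by simp
qed

section \<open>Parallel sections\<close>

definition par_eq :: "nat \<Rightarrow> (2 list \<Rightarrow> real^2 \<Rightarrow> complex) \<Rightarrow> bool" where
  "par_eq k X \<longleftrightarrow> (\<forall>I. length I = k \<longrightarrow> smooth_on \<Omega> (X I)) \<and>
     (\<forall>y\<in>\<Omega>. \<forall>I. length I = k \<longrightarrow> (\<forall>i. pd i (X I) y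
          + (\<Sum>a<k. \<Sum>m\<in>UNIV. of_real (\<Gamma> (I ! a) i m y) * X (I[a := m]) y) = 0))"

definition tcomp :: "(2 list \<Rightarrow> real^2 \<Rightarrow> complex) \<Rightarrow> bool list \<Rightarrow> real^2 \<Rightarrow> complex" where
  "tcomp X w y = contract (cv y) w (\<lambda>I. X I y)"

lemma smooth_tcomp:
  assumes "par_eq k X" "length w = k"
  shows "smooth_on \<Omega> (tcomp X w)"
  unfolding tcomp_def[abs_def]
  by (rule contract_smooth[OF open_patch smooth_cv]) (use assms in \<open>auto simp: par_eq_def\<close>)

text \<open>\<open>pd_contract\<close> for the coframe: the covariant part is the parallel equation
  and vanishes, so only the weight term remains.\<close>

lemma pd_tcomp:
  assumes "par_eq k X" "length w = k" "y \<in> \<Omega>"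
  shows "pd i (tcomp X w) y = - of_int (weight w) * conn i y * tcomp X w y"
proof -
  have "pd i (tcomp X w) y
    = contract (cv y) w (\<lambda>I. pd i (\<lambda>z. X I z) y - slot_act (\<lambda>j m. - of_real (\<Gamma> j i m y)) (\<lambda>I. X I y) I)
      + of_int (weight w) * (- conn i y) * tcomp X w y"
    unfolding tcomp_def[abs_def]
    by (rule pd_contract) (use assms in \<open>auto simp: par_eq_def pd_cv
        intro: smooth_on_differentiable[OF smooth_cv] smooth_on_differentiable\<close>)
  also have "contract (cv y) w (\<lambda>I. pd i (\<lambda>z. X I z) y - slot_act (\<lambda>j m. - of_real (\<Gamma> j i m y)) (\<lambda>I. X I y) I)
      = contract (cv y) w (\<lambda>I. 0)"
    by (rule contract_cong) (use assms in \<open>auto simp: par_eq_def slot_act_def sum_negf\<close>)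
  finally show ?thesis
    by (simp add: contract_zero)
qed

text \<open>Commuting second partials of a solution of dx = -n x A gives n x dA = 0, and dA is
  nonzero by \<open>conn_curvature\<close> because K is.\<close>

lemma tcomp_unbalanced:
  assumes "K \<noteq> 0" "par_eq k X" "length w = k" "y \<in> \<Omega>" "weight w \<noteq> 0"
  shows "tcomp X w y = 0"
proof -
  let ?n = "of_int (weight w) :: complex"
  have dA: "conn a differentiable (at y)" for a
    by (rule smooth_on_differentiable[OF smooth_conn assms(4)])
  have dx: "tcomp X w differentiable (at y)"
    by (rule smooth_on_differentiable[OF smooth_tcomp[OF assms(2,3)] assms(4)])
  have second: "pd i (pd j (tcomp X w)) y = - ?n * pd i (conn j) y * tcomp X w y
      + ?n * ?n * conn j y * conn i y * tcomp X w y" for i j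
  proof -
    have "pd i (pd j (tcomp X w)) y = pd i (\<lambda>z. - ?n * conn j z * tcomp X w z) y"
      by (rule pd_transform_open[OF open_patch assms(4)]) (rule pd_tcomp[OF assms(2,3)])
    also have "\<dots> = - ?n * pd i (conn j) y * tcomp X w y + - ?n * conn j y * pd i (tcomp X w) y"
      by (simp add: pd_mult pd_minus dA dx differentiable_mult differentiable_minus)
    finally show ?thesis
      by (simp add: pd_tcomp[OF assms(2-4)])
  qed
  have "?n * tcomp X w y * (pd i (conn j) y - pd j (conn i) y) = 0" for i j
  proof -
    have "?n * tcomp X w y * (pd i (conn j) y - pd j (conn i) y)
        = pd j (pd i (tcomp X w)) y - pd i (pd j (tcomp X w)) y"
      unfolding second by (simp add: algebra_simps)
    then show ?thesis
      using pd_commute[OF open_patch smooth_tcomp[OF assms(2,3)] assms(4), of i j] by simp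
  qed
  then have "?n * tcomp X w y = 0 \<or> (\<forall>i j. pd i (conn j) y - pd j (conn i) y = 0)"
    by auto
  moreover have "\<not> (\<forall>i j. pd i (conn j) y - pd j (conn i) y = 0)"
  proof
    assume "\<forall>i j. pd i (conn j) y - pd j (conn i) y = 0"
    then show False
      using conn_curvature[OF assms(4)] assms(1) by simp
  qed
  ultimately show ?thesis
    using assms(5) by auto
qed

text \<open>For weight 0 the derivative vanishes; otherwise both values are 0. Convexity of S
  supplies the connectedness that a coordinate domain may lack.\<close>

lemma tcomp_constant:
  assumes "K \<noteq> 0" "par_eq k X" "length w = k" "convex S" "open S" "S \<subseteq> \<Omega>" "x \<in> S" "y \<in> S"
  shows "tcomp X w x = tcomp X w y"
proof (cases "weight w = 0")
  case True
  show ?thesis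
  proof (rule constant_if_pd_zero[OF assms(4,5,7,8)])
    fix z i assume "z \<in> S"
    then have z: "z \<in> \<Omega>" using assms(6) by blast
    show "tcomp X w differentiable (at z)"
      by (rule smooth_on_differentiable[OF smooth_tcomp[OF assms(2,3)] z])
    show "pd i (tcomp X w) z = 0"
      using pd_tcomp[OF assms(2,3) z] True by simp
  qed
next
  case False
  then show ?thesis
    using tcomp_unbalanced[OF assms(1-3)] assms(6-8) subsetD[OF assms(6)] by simp
qed

lemma tcomp_unique:
  assumes "y \<in> \<Omega>" "length w = k"
    and "\<And>I. length I = k \<Longrightarrow> X I y = (\<Sum>w\<in>{w. length w = k}. a w * (\<Prod>b<k. hv y (w ! b) (I ! b)))"
  shows "tcomp X w y = a w"
proof -
  have "tcomp X w y = contract (cv y) w (\<lambda>I. \<Sum>v\<in>{v. length v = k}. a v * (\<Prod>b<k. hv y (v ! b) (I ! b)))"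
    unfolding tcomp_def by (rule contract_cong) (simp add: assms)
  also have "\<dots> = (\<Sum>v\<in>{v. length v = k}. a v * (if w = v then 1 else 0))"
    unfolding contract_sum contract_scale
    by (intro sum.cong refl arg_cong[where f = "(*) _"])
      (use contract_dual_basis[OF cv_hv[OF assms(1)]] assms(2) in auto)
  also have "\<dots> = a w"
    using assms(2) by (simp add: if_distrib cong: if_cong)
  finally show ?thesis .
qed

lemma tcomp_expansion:
  assumes "y \<in> \<Omega>" "length I = k"
  shows "X I y = (\<Sum>w\<in>{w. length w = k}. tcomp X w y * (\<Prod>b<k. hv y (w ! b) (I ! b)))"
  unfolding tcomp_def by (rule dual_basis_expansion[OF hv_cv[OF assms(1)] assms(2)])

section \<open>Iterated covariant derivatives in the isotropic frame\<close>

definition fcomp :: "(real^2 \<Rightarrow> complex) \<Rightarrow> bool list \<Rightarrow> real^2 \<Rightarrow> complex" where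
  "fcomp u w y = contract (hv y) w (\<lambda>I. nabla_pow G (length w) u I y)"

text \<open>Covariant derivative along h_s of a component of weight n, that is, of a section of the
  n-th power of the line bundle whose connection form is given by \<open>conn\<close>.\<close>

definition D :: "int \<Rightarrow> bool \<Rightarrow> (real^2 \<Rightarrow> complex) \<Rightarrow> real^2 \<Rightarrow> complex" where
  "D n s \<phi> y = (\<Sum>i\<in>UNIV. hv y s i * (pd i \<phi> y - of_int n * conn i y * \<phi> y))"

lemma nabla_pow_Suc: "nabla_pow G (Suc k) u = cov_deriv G (nabla_pow G k u)"
  by (simp add: nabla_pow_def)

lemma fcomp_Nil [simp]: "fcomp u [] y = u y"
  by (simp add: fcomp_def nabla_pow_def)

lemma smooth_nabla_pow:
  assumes "open T" "T \<subseteq> \<Omega>" "smooth_on T u"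
  shows "smooth_on T (nabla_pow G k u I)"
proof (induction k arbitrary: I)
  case 0
  then show ?case
    using assms(3) by (cases "I = []") (simp_all add: nabla_pow_def smooth_on_const)
next
  case (Suc k)
  show ?case
  proof (cases I)
    case Nil
    then show ?thesis
      by (simp add: nabla_pow_Suc cov_deriv_def[abs_def] smooth_on_const)
  next
    case (Cons i J)
    show ?thesis
      unfolding nabla_pow_Suc cov_deriv_def[abs_def] Cons list.case
      by (intro smooth_on_diff smooth_on_sum smooth_on_mult smooth_on_pd smooth_on_of_real Suc assms(1)
          smooth_on_subset[OF smooth_christoffel assms(2)])
  qed
qed

lemma smooth_fcomp:
  assumes "open T" "T \<subseteq> \<Omega>" "smooth_on T u"
  shows "smooth_on T (fcomp u w)"
  unfolding fcomp_def[abs_def]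
  by (rule contract_smooth[OF assms(1) smooth_on_subset[OF smooth_hv assms(2)] smooth_nabla_pow[OF assms]])

text \<open>The weight term of \<open>pd_contract\<close> is exactly the connection term of D.
  Prepending letters thus means applying operators, and identities between operators become
  identities between words.\<close>

lemma fcomp_Cons:
  assumes T: "open T" "T \<subseteq> \<Omega>" "smooth_on T u" and y: "y \<in> T"
  shows "fcomp u (s # w) y = D (weight w) s (fcomp u w) y"
proof -
  have y': "y \<in> \<Omega>" using T y by blast
  have "contract (hv y) w (\<lambda>I. nabla_pow G (Suc (length w)) u (i # I) y)
      = pd i (fcomp u w) y - of_int (weight w) * conn i y * fcomp u w y" for i
  proof -
    have "pd i (fcomp u w) y = contract (hv y) w (\<lambda>I. pd i (\<lambda>z. nabla_pow G (length w) u I z) y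
          - slot_act (\<lambda>j m. of_real (\<Gamma> m i j y)) (\<lambda>I. nabla_pow G (length w) u I y) I)
        + of_int (weight w) * conn i y * fcomp u w y"
      unfolding fcomp_def[abs_def]
      by (rule pd_contract) (use y y' pd_hv[OF y'] in
          \<open>auto intro: smooth_on_differentiable[OF smooth_hv] smooth_on_differentiable[OF smooth_nabla_pow[OF T]]\<close>)
    then show ?thesis
      by (simp add: nabla_pow_Suc cov_deriv_def slot_act_def)
  qed
  then show ?thesis
    by (simp add: fcomp_def[of u "s # w"] D_def)
qed

lemma D_transform:
  assumes "open T" "y \<in> T" "\<And>z. z \<in> T \<Longrightarrow> \<phi> z = \<psi> z"
  shows "D n s \<phi> y = D n s \<psi> y"
  unfolding D_def using pd_transform_open[OF assms] assms(2,3) by simp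

lemma D_scale: "\<phi> differentiable (at y) \<Longrightarrow> D n s (\<lambda>z. a * \<phi> z) y = a * D n s \<phi> y"
  by (simp add: D_def pd_mult sum_distrib_left algebra_simps)

lemma D_sum:
  assumes "\<And>v. v \<in> A \<Longrightarrow> \<phi> v differentiable (at y)"
  shows "D n s (\<lambda>z. \<Sum>v\<in>A. a v * \<phi> v z) y = (\<Sum>v\<in>A. a v * D n s (\<phi> v) y)"
proof -
  have "D n s (\<lambda>z. \<Sum>v\<in>A. a v * \<phi> v z) y = (\<Sum>i\<in>UNIV. \<Sum>v\<in>A. a v * (hv y s i * (pd i (\<phi> v) y - of_int n * conn i y * \<phi> v y)))"
    using assms by (simp add: D_def pd_sum pd_mult differentiable_mult sum_distrib_left
        sum_subtractf right_diff_distrib mult_ac)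
  also have "\<dots> = (\<Sum>v\<in>A. a v * D n s (\<phi> v) y)"
    unfolding D_def sum_distrib_left by (rule sum.swap)
  finally show ?thesis .
qed

text \<open>Both orders contract the second covariant derivative Q of the function with h_+ and h_-.
  Its antisymmetric part is only the curvature of \<open>conn\<close>, because the Christoffel
  symbols are symmetric.\<close>

lemma D_commutator:
  assumes T: "open T" "T \<subseteq> \<Omega>" "smooth_on T \<phi>" and y: "y \<in> T"
  shows "D (n - 1) True (D n False \<phi>) y = D (n + 1) False (D n True \<phi>) y - of_int (2 * n) * of_real K * \<phi> y"
proof -
  have y': "y \<in> \<Omega>" using T y by blast
  define t where "t i z = pd i \<phi> z - of_int n * conn i z * \<phi> z" for i z
  have d\<phi>: "\<phi> differentiable (at y)" and dp: "pd i \<phi> differentiable (at y)" for i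
    using smooth_on_differentiable[OF _ y] smooth_on_pd T(3) by blast+
  have dA: "conn a differentiable (at y)" for a
    by (rule smooth_on_differentiable[OF smooth_conn y'])
  have dh: "(\<lambda>z. hv z s k) differentiable (at y)" for s k
    by (rule smooth_on_differentiable[OF smooth_hv y'])
  have dt: "t i differentiable (at y)" for i
    unfolding t_def[abs_def] by (intro differentiable_diff differentiable_mult differentiable_const dp dA d\<phi>)
  have pt: "pd i (t j) y = pd i (pd j \<phi>) y - of_int n * (pd i (conn j) y * \<phi> y + conn j y * pd i \<phi> y)" for i j
    unfolding t_def[abs_def]
    by (simp add: pd_diff pd_mult dp dA d\<phi> differentiable_mult mult.assoc)
  \<comment> \<open>Differentiating the inner frame vector produces the Christoffel term and a
    rotation term; the latter cancels \<open>sg s\<close> in the weight \<open>n + sg s\<close>, so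
    that Q involves n alone.\<close>
  define Q where "Q i j = pd i (t j) y - of_int n * conn i y * t j y - (\<Sum>m\<in>UNIV. of_real (\<Gamma> m i j y) * t m y)" for i j
  have DD: "D (n + sg s) s' (D n s \<phi>) y = (\<Sum>i\<in>UNIV. \<Sum>j\<in>UNIV. hv y s' i * hv y s j * Q i j)" for s s'
  proof -
    have "pd i (D n s \<phi>) y = (\<Sum>j\<in>UNIV. pd i (\<lambda>z. hv z s j) y * t j y + hv y s j * pd i (t j) y)" for i
      unfolding D_def[abs_def] t_def[symmetric]
      by (simp add: pd_sum pd_mult dh dt differentiable_mult)
    moreover have "D n s \<phi> y = (\<Sum>j\<in>UNIV. hv y s j * t j y)"
      by (simp add: D_def t_def)
    ultimately show ?thesis
      by (simp only: D_def[of "n + sg s"] pd_hv[OF y']) (simp add: Q_def sum_2 algebra_simps)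
  qed
  have Q: "Q i j - Q j i = - of_int n * (pd i (conn j) y - pd j (conn i) y) * \<phi> y" for i j
    using pd_commute[OF T(1,3) y, of i j] christoffel_sym[OF y', of _ i j]
    by (simp add: Q_def pt t_def algebra_simps)
  have "D (n - 1) True (D n False \<phi>) y - D (n + 1) False (D n True \<phi>) y
      = (\<Sum>i\<in>UNIV. \<Sum>j\<in>UNIV. hv y True i * hv y False j * (Q i j - Q j i))"
    using DD[of False True] DD[of True False] by (simp add: sum_2 algebra_simps)
  also have "\<dots> = - of_int n * \<phi> y *
      (\<Sum>i\<in>UNIV. \<Sum>j\<in>UNIV. hv y True i * hv y False j * (pd i (conn j) y - pd j (conn i) y))"
    unfolding Q sum_distrib_left by (simp add: mult_ac)
  finally show ?thesis
    unfolding conn_curvature[OF y'] by (simp add: algebra_simps)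
qed

text \<open>The operators D depend on the weight of what they act on. A balanced v does not change
  it, so the letters of w act on u' and on each \<open>fcomp u v\<close> by the same operators, and
  the constants \<open>a v\<close> pass through.\<close>

lemma fcomp_parallel_action:
  assumes T: "open T" "T \<subseteq> \<Omega>" "smooth_on T u"
    and a: "\<And>v. length v = k \<Longrightarrow> weight v \<noteq> 0 \<Longrightarrow> a v = 0"
    and u': "\<And>y. y \<in> T \<Longrightarrow> u' y = (\<Sum>v\<in>{v. length v = k}. a v * fcomp u v y)"
    and "smooth_on T u'" "y \<in> T"
  shows "fcomp u' w y = (\<Sum>v\<in>{v. length v = k}. a v * fcomp u (w @ v) y)"
  using \<open>y \<in> T\<close>
proof (induction w arbitrary: y)
  case Nil
  then show ?case using u' by simp
next
  case (Cons s w)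
  have "fcomp u' (s # w) y = D (weight w) s (fcomp u' w) y"
    by (rule fcomp_Cons[OF T(1,2) assms(6) Cons.prems])
  also have "\<dots> = D (weight w) s (\<lambda>z. \<Sum>v\<in>{v. length v = k}. a v * fcomp u (w @ v) z) y"
    by (rule D_transform[OF T(1) Cons.prems Cons.IH])
  also have "\<dots> = (\<Sum>v\<in>{v. length v = k}. a v * D (weight w) s (fcomp u (w @ v)) y)"
    by (rule D_sum) (rule smooth_on_differentiable[OF smooth_fcomp[OF T] Cons.prems])
  also have "\<dots> = (\<Sum>v\<in>{v. length v = k}. a v * fcomp u ((s # w) @ v) y)"
  proof (rule sum.cong[OF refl])
    fix v :: "bool list" assume "v \<in> {v. length v = k}"
    then show "a v * D (weight w) s (fcomp u (w @ v)) y = a v * fcomp u ((s # w) @ v) y"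
      using a[of v] fcomp_Cons[OF T Cons.prems, of s "w @ v"] by (cases "weight v = 0") auto
  qed
  finally show ?case .
qed

lemma contraction_tcomp:
  assumes "y \<in> \<Omega>"
  shows "(\<Sum>I\<in>{I. length I = k}. X I y * nabla_pow G k u I y)
    = (\<Sum>v\<in>{v. length v = k}. tcomp X v y * fcomp u v y)"
proof -
  have "(\<Sum>I\<in>{I. length I = k}. X I y * nabla_pow G k u I y)
      = (\<Sum>I\<in>{I. length I = k}. \<Sum>v\<in>{v. length v = k}.
          tcomp X v y * (\<Prod>b<k. hv y (v ! b) (I ! b)) * nabla_pow G k u I y)"
    by (rule sum.cong[OF refl], subst tcomp_expansion[OF assms]) (auto simp: sum_distrib_right)
  also have "\<dots> = (\<Sum>v\<in>{v. length v = k}. \<Sum>I\<in>{I. length I = k}.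
          tcomp X v y * ((\<Prod>b<k. hv y (v ! b) (I ! b)) * nabla_pow G k u I y))"
    by (subst sum.swap) (simp add: mult.assoc)
  also have "\<dots> = (\<Sum>v\<in>{v. length v = k}. tcomp X v y * fcomp u v y)"
    by (rule sum.cong[OF refl]) (auto simp: fcomp_def contract_eq_sum sum_distrib_left)
  finally show ?thesis .
qed

end

section \<open>Eigenfunctions\<close>

text \<open>One letter's share in \<open>Cfactor\<close>, which thereby becomes a product along the
  word read from the right (\<open>Cfactor_Cons\<close>).\<close>

definition step_factor :: "complex \<Rightarrow> real \<Rightarrow> bool \<Rightarrow> int \<Rightarrow> complex" where
  "step_factor lam K s n =
     (if \<bar>n + sg s\<bar> < \<bar>n\<bar> then - lam + of_int (\<bar>n\<bar> * (\<bar>n\<bar> - 1)) * of_real K else 1)"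

abbreviation canonical :: "int \<Rightarrow> bool list" where
  "canonical n \<equiv> replicate (nat \<bar>n\<bar>) (n > 0)"

lemma Cfactor_Nil [simp]: "Cfactor lam K [] = 1"
  by (simp add: Cfactor_def)

lemma Cfactor_Cons [simp]: "Cfactor lam K (s # w) = step_factor lam K s (weight w) * Cfactor lam K w"
proof -
  let ?f = "\<lambda>js q. weight (drop q js)"
  let ?Q = "\<lambda>js. {q. q < length js \<and> \<bar>?f js q\<bar> < \<bar>?f js (Suc q)\<bar>}"
  let ?F = "\<lambda>js q. - lam + of_int (\<bar>?f js (Suc q)\<bar> * (\<bar>?f js (Suc q)\<bar> - 1)) * complex_of_real K"
  let ?Z = "{q. q = 0 \<and> \<bar>sg s + weight w\<bar> < \<bar>weight w\<bar>}"
  have "?Q (s # w) = ?Z \<union> Suc ` ?Q w" (is "?L = ?R")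
  proof (rule set_eqI)
    show "q \<in> ?L \<longleftrightarrow> q \<in> ?R" for q by (cases q) auto
  qed
  then have "Cfactor lam K (s # w) = (\<Prod>q\<in>?Z. ?F (s # w) q) * (\<Prod>q\<in>Suc ` ?Q w. ?F (s # w) q)"
    by (simp add: Cfactor_def Let_def) (subst prod.union_disjoint; auto)
  also have "(\<Prod>q\<in>Suc ` ?Q w. ?F (s # w) q) = Cfactor lam K w"
    by (simp add: Cfactor_def Let_def prod.reindex)
  also have "(\<Prod>q\<in>?Z. ?F (s # w) q) = step_factor lam K s (weight w)"
    by (cases "\<bar>sg s + weight w\<bar> < \<bar>weight w\<bar>") (auto simp: step_factor_def add.commute)
  finally show ?thesis .
qed

declare sum_list_replicate [simp]

lemma weight_canonical: "weight (canonical n) = n"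
  by (simp add: sg_def)

context surface_patch
begin

text \<open>Since h_+ \<otimes> h_- + h_- \<otimes> h_+ = 2 (E1 \<otimes> E1 + E2 \<otimes> E2), the
  sum contracts the second covariant derivative with twice the inverse metric.\<close>

lemma fcomp_laplacian:
  assumes "y \<in> \<Omega>"
  shows "fcomp u [True, False] y + fcomp u [False, True] y = 2 * laplacian G u y"
proof -
  have *: "(2::nat) = Suc (Suc 0)" by simp
  show ?thesis
    by (simp add: fcomp_def laplacian_def matrix_inv_frame[OF assms] hv_eq sum_2 * algebra_simps
        del: One_nat_def)
qed

lemma fcomp_Cons_Cons:
  assumes T: "open T" "T \<subseteq> \<Omega>" "smooth_on T u" and y: "y \<in> T"
  shows "fcomp u (s # s' # w) y = D (weight w + sg s') s (D (weight w) s' (fcomp u w)) y"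
  using fcomp_Cons[OF T y, of s "s' # w"]
    D_transform[OF T(1) y fcomp_Cons[OF T, of _ s' w], where n = "weight (s' # w)" and s = s]
  by (simp add: add.commute)

text \<open>Ladder argument: the commutator moves the opposite letter past one s, the induction
  hypothesis evaluates the rest, and the curvature term 2(m+1)K raises m(m+1)K to
  (m+1)(m+2)K.\<close>

lemma fcomp_lower:
  assumes T: "open T" "T \<subseteq> \<Omega>" "smooth_on T u"
    and eig: "\<And>y. y \<in> T \<Longrightarrow> laplacian G u y = - lam * u y"
    and y: "y \<in> T"
  shows "fcomp u ((\<not> s) # replicate (Suc m) s) y
    = (- lam + of_nat (m * Suc m) * of_real K) * fcomp u (replicate m s) y"
  using y
proof (induction m arbitrary: y)
  case 0
  \<comment> \<open>At weight 0 the curvature term vanishes, so both orders agree and each is half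
    of their sum, that is, the Laplacian.\<close>
  have "D (0 - 1) True (D 0 False (fcomp u [])) y
      = D (0 + 1) False (D 0 True (fcomp u [])) y - of_int (2 * 0) * of_real K * fcomp u [] y"
    by (rule D_commutator[OF T(1,2) smooth_fcomp[OF T] 0])
  then have "fcomp u [True, False] y = fcomp u [False, True] y"
    using fcomp_Cons_Cons[OF T 0, of _ _ "[]"] by simp
  moreover have "fcomp u [True, False] y + fcomp u [False, True] y = 2 * (- lam * u y)"
    using fcomp_laplacian[of y u] T(2) 0 eig by auto
  ultimately have "fcomp u [True, False] y = - lam * u y \<and> fcomp u [False, True] y = - lam * u y"
    by (simp add: mult_2[symmetric])
  then show ?case
    by (cases s) simp_all
next
  case (Suc m)
  let ?\<phi> = "fcomp u (replicate (Suc m) s)" and ?n = "weight (replicate (Suc m) s)"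
  let ?c = "- lam + of_nat (m * Suc m) * of_real K :: complex"
  have n: "?n - sg s = weight (replicate m s)"
    by simp
  have "D (?n - sg s) s (D ?n (\<not> s) ?\<phi>) y = D (?n - sg s) s (\<lambda>z. ?c * fcomp u (replicate m s) z) y"
  proof (rule D_transform[OF T(1) Suc.prems])
    fix z assume z: "z \<in> T"
    show "D ?n (\<not> s) ?\<phi> z = ?c * fcomp u (replicate m s) z"
      using fcomp_Cons[OF T z, of "\<not> s" "replicate (Suc m) s"] Suc.IH[OF z] by simp
  qed
  also have "\<dots> = ?c * D (?n - sg s) s (fcomp u (replicate m s)) y"
    by (rule D_scale[OF smooth_on_differentiable[OF smooth_fcomp[OF T] Suc.prems]])
  also have "D (?n - sg s) s (fcomp u (replicate m s)) y = ?\<phi> y"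
    unfolding n using fcomp_Cons[OF T Suc.prems, of s "replicate m s"] by simp
  finally have *: "D (?n - sg s) s (D ?n (\<not> s) ?\<phi>) y = ?c * ?\<phi> y" .
  have "D (?n + sg s) (\<not> s) (D ?n s ?\<phi>) y = ?c * ?\<phi> y + 2 * of_nat (Suc m) * of_real K * ?\<phi> y"
  proof -
    define n d \<phi> where "n = ?n" and "d = ?c" and "\<phi> = ?\<phi>"
    have "D (n - 1) True (D n False \<phi>) y
        = D (n + 1) False (D n True \<phi>) y - of_int (2 * n) * of_real K * \<phi> y"
      unfolding \<phi>_def by (rule D_commutator[OF T(1,2) smooth_fcomp[OF T] Suc.prems])
    moreover have "(of_int (2 * n) :: complex) = 2 * of_int (sg s) * of_nat (Suc m)"
      by (simp add: n_def algebra_simps)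
    ultimately have "D (n - 1) True (D n False \<phi>) y
        = D (n + 1) False (D n True \<phi>) y - 2 * of_int (sg s) * of_nat (Suc m) * of_real K * \<phi> y"
      by (simp only:)
    moreover have "D (n - sg s) s (D n (\<not> s) \<phi>) y = d * \<phi> y"
      using * by (simp only: n_def d_def \<phi>_def)
    ultimately have "D (n + sg s) (\<not> s) (D n s \<phi>) y = d * \<phi> y + 2 * of_nat (Suc m) * of_real K * \<phi> y"
      by (cases s) (simp_all add: algebra_simps)
    then show ?thesis
      by (simp only: n_def d_def \<phi>_def)
  qed
  moreover have "fcomp u ((\<not> s) # replicate (Suc (Suc m)) s) y = D (?n + sg s) (\<not> s) (D ?n s ?\<phi>) y"
    using fcomp_Cons_Cons[OF T Suc.prems, of "\<not> s" s "replicate (Suc m) s"] by simp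
  ultimately have "fcomp u ((\<not> s) # replicate (Suc (Suc m)) s) y
      = ?c * ?\<phi> y + 2 * of_nat (Suc m) * of_real K * ?\<phi> y"
    by (rule trans[rotated])
  also have "\<dots> = (- lam + of_nat (Suc m * Suc (Suc m)) * of_real K) * ?\<phi> y"
    by (simp add: algebra_simps)
  finally show ?case .
qed

text \<open>By induction w may be replaced by the canonical word of its weight. The next letter
  either lengthens that word or meets letters of the opposite sign, where \<open>fcomp_lower\<close>
  applies.\<close>

lemma fcomp_eigenfunction:
  assumes T: "open T" "T \<subseteq> \<Omega>" "smooth_on T u"
    and eig: "\<And>y. y \<in> T \<Longrightarrow> laplacian G u y = - lam * u y"
    and y: "y \<in> T"
  shows "fcomp u w y = Cfactor lam K w * fcomp u (canonical (weight w)) y"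
  using y
proof (induction w arbitrary: y)
  case (Cons s w)
  let ?n = "weight w"
  have "fcomp u (s # w) y = D ?n s (fcomp u w) y"
    by (rule fcomp_Cons[OF T Cons.prems])
  also have "\<dots> = D ?n s (\<lambda>z. Cfactor lam K w * fcomp u (canonical ?n) z) y"
    by (rule D_transform[OF T(1) Cons.prems Cons.IH])
  also have "\<dots> = Cfactor lam K w * D ?n s (fcomp u (canonical ?n)) y"
    by (rule D_scale[OF smooth_on_differentiable[OF smooth_fcomp[OF T] Cons.prems]])
  also have "D ?n s (fcomp u (canonical ?n)) y = fcomp u (s # canonical ?n) y"
    using fcomp_Cons[OF T Cons.prems, of s "canonical ?n"] unfolding weight_canonical by simp
  also have "\<dots> = step_factor lam K s ?n * fcomp u (canonical (weight (s # w))) y"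
  proof (cases "\<bar>?n + sg s\<bar> < \<bar>?n\<bar>")
    case True
    \<comment> \<open>With |n| = m + 1 the constant m(m+1) of \<open>fcomp_lower\<close> is
      |n|(|n|-1).\<close>
    define m where "m = nat \<bar>?n\<bar> - 1"
    have s: "s = (\<not> ?n > 0)" and m: "nat \<bar>?n\<bar> = Suc m" "\<bar>?n\<bar> = int (Suc m)"
      using True by (cases s; auto simp: m_def split: if_splits)+
    have c: "canonical (weight (s # w)) = replicate m (?n > 0)"
    \<comment> \<open>At weight 0 the canonical word is empty, so its nominal sign
      \<open>False\<close> does no harm.\<close>
    proof (cases "m = 0")
      case True
      then show ?thesis using m(2) s by (cases s) auto
    next
      case False
      have "nat \<bar>weight (s # w)\<bar> = m"
        using m s by (cases s) auto
      moreover have "(weight (s # w) > 0) = (?n > 0)"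
        using m s False by (cases s) auto
      ultimately show ?thesis by (simp only:)
    qed
    show ?thesis
      using fcomp_lower[OF T eig Cons.prems, of "?n > 0" m] True
      unfolding c m(1) s[symmetric] by (simp add: step_factor_def m(2) s algebra_simps)
  next
    case False
    then have "nat \<bar>weight (s # w)\<bar> = Suc (nat \<bar>?n\<bar>)" "(weight (s # w) > 0) = s"
      "canonical ?n = replicate (nat \<bar>?n\<bar>) s"
      by (cases s; cases "?n = 0"; force)+
    then have "s # canonical ?n = canonical (weight (s # w))"
      by (simp only: replicate_Suc)
    then show ?thesis
      using False by (simp add: step_factor_def)
  qed
  finally show ?case by (simp add: mult_ac)
qed simp

lemma fcomp_linear:
  assumes T: "open T" "T \<subseteq> \<Omega>" "smooth_on T u" "smooth_on T u'" and y: "y \<in> T"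
  shows "fcomp (\<lambda>z. a * u z + b * u' z) w y = a * fcomp u w y + b * fcomp u' w y"
  using y
proof (induction w arbitrary: y)
  case (Cons s w)
  have sm: "smooth_on T (\<lambda>z. a * u z + b * u' z)"
    by (intro smooth_on_add smooth_on_mult smooth_on_const T)
  have "fcomp (\<lambda>z. a * u z + b * u' z) (s # w) y = D (weight w) s (fcomp (\<lambda>z. a * u z + b * u' z) w) y"
    by (rule fcomp_Cons[OF T(1,2) sm Cons.prems])
  also have "\<dots> = D (weight w) s (\<lambda>z. a * fcomp u w z + b * fcomp u' w z) y"
    by (rule D_transform[OF T(1) Cons.prems Cons.IH])
  also have "\<dots> = a * D (weight w) s (fcomp u w) y + b * D (weight w) s (fcomp u' w) y"
    using smooth_on_differentiable[OF smooth_fcomp[OF T(1,2,3)] Cons.prems]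
      smooth_on_differentiable[OF smooth_fcomp[OF T(1,2,4)] Cons.prems]
    by (simp add: D_def pd_add pd_mult differentiable_mult sum_distrib_left algebra_simps
        flip: sum.distrib)
  also have "\<dots> = a * fcomp u (s # w) y + b * fcomp u' (s # w) y"
    using fcomp_Cons[OF T(1,2,3) Cons.prems] fcomp_Cons[OF T(1,2,4) Cons.prems] by simp
  finally show ?case .
qed simp

end

section \<open>Transport of frames\<close>

lemma surface_patchI:
  assumes "riemannian_surface M" "constant_curvature M K" "c \<in> atlas M" "q \<in> dom_ch c"
    "orthonormal_frame M c q e1 e2"
  shows "surface_patch (metric M c) (img_ch c) K e1 e2"
proof
  show "open (img_ch c)"
    using assms by (auto simp: riemannian_surface_def smooth_atlas_def)
  show "smooth_on (img_ch c) (metric M c)"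
    using assms by (auto simp: riemannian_surface_def)
  show "transpose (metric M c y) = metric M c y" if "y \<in> img_ch c" for y
    using assms(1,3) that unfolding riemannian_surface_def by blast
  show "v \<bullet> (metric M c y *v v) > 0" if "y \<in> img_ch c" "v \<noteq> 0" for y v
    using assms(1,3) that unfolding riemannian_surface_def by blast
  show "sectional_curvature (metric M c) y u v = K"
    if "y \<in> img_ch c" "u \<noteq> v" "independent {u, v}" for y u v
    using assms(2,3) that unfolding constant_curvature_def by blast
  show "e1 \<noteq> 0"
    using assms(5) by (auto simp: orthonormal_frame_def Let_def)
  show "e2 \<noteq> x *\<^sub>R e1" for x
  proof
    assume e2: "e2 = x *\<^sub>R e1"
    then have "x = 0"
      using assms(5) by (auto simp: orthonormal_frame_def Let_def matrix_vector_mult_scaleR)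
    then show False
      using assms(5) e2 by (simp add: orthonormal_frame_def Let_def)
  qed
qed

lemma par_eqI:
  assumes "surface_patch (metric M c) (img_ch c) K e1 e2" "c \<in> atlas M" "parallel_section M k X"
  shows "surface_patch.par_eq (metric M c) (img_ch c) k (X c)"
  unfolding surface_patch.par_eq_def[OF assms(1)]
  using assms(2,3) unfolding parallel_section_def by blast

lemma frame_at_point:
  assumes "surface_patch (metric M c) (img_ch c) K e1 e2" "orthonormal_frame M c q e1 e2"
  shows "surface_patch.hv (metric M c) e1 e2 (crd c q) s m = hvec e1 e2 s $ m"
  using assms(2) surface_patch.frame_at_orthonormal_point[OF assms(1), of "crd c q"]
  by (simp add: surface_patch.hv_def[OF assms(1)] surface_patch.ip_def[OF assms(1)]
      orthonormal_frame_def Let_def)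

lemma tcomp_value_at:
  assumes "surface_patch (metric M c) (img_ch c) K e1 e2" "orthonormal_frame M c q e1 e2"
    "q \<in> dom_ch c" "value_at c q e1 e2 k X a" "length w = k"
  shows "surface_patch.tcomp (metric M c) e1 e2 (X c) w (crd c q) = a w"
proof (rule surface_patch.tcomp_unique[OF assms(1) _ assms(5)])
  show "crd c q \<in> img_ch c" using assms(3) by simp
qed (use assms(4) in \<open>simp add: value_at_def frame_at_point[OF assms(1,2)]\<close>)

text \<open>The frame at q' is the Gram-Schmidt frame of the chart. How far it turns on the way does
  not show: turning multiplies a component by a phase to the power of its weight, and parallel
  sections have only components of weight 0.\<close>

lemma transport_in_chart:
  assumes M: "riemannian_surface M" "constant_curvature M K" "K \<noteq> 0"
    and c: "c \<in> atlas M" "q \<in> dom_ch c" "q' \<in> dom_ch c" and on: "orthonormal_frame M c q e1 e2"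
    and S: "convex S" "open S" "S \<subseteq> img_ch c" "crd c q \<in> S" "crd c q' \<in> S"
  shows "\<exists>e1' e2'. orthonormal_frame M c q' e1' e2' \<and>
    (\<forall>k X a. parallel_section M k X \<longrightarrow> value_at c q e1 e2 k X a \<longrightarrow> value_at c q' e1' e2' k X a)"
proof -
  have P: "surface_patch (metric M c) (img_ch c) K e1 e2"
    by (rule surface_patchI[OF M(1,2) c(1,2) on])
  then interpret surface_patch "metric M c" "img_ch c" K e1 e2 .
  let ?y = "crd c q" and ?y' = "crd c q'"
  have y': "?y' \<in> img_ch c" using c by simp
  show ?thesis
  proof (intro exI conjI allI impI)
    show "orthonormal_frame M c q' (E1 ?y') (E2 ?y')"
      using ip_frame[OF y'] by (simp add: orthonormal_frame_def Let_def ip_def)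
  next
    fix k X a assume X: "parallel_section M k X" and a: "value_at c q e1 e2 k X a"
    have "tcomp (X c) w ?y' = a w" if "length w = k" for w
      using tcomp_constant[OF M(3) par_eqI[OF P c(1) X] that S] tcomp_value_at[OF P on c(2) a that] by simp
    then show "value_at c q' (E1 ?y') (E2 ?y') k X a"
      using tcomp_expansion[OF y', of _ k "X c"] by (simp add: value_at_def hv_def)
  qed
qed

lemma prod_sum_lists:
  fixes F :: "nat \<Rightarrow> 'a::finite \<Rightarrow> 'b::comm_semiring_1"
  shows "(\<Prod>b<k. \<Sum>j\<in>UNIV. F b j) = (\<Sum>I\<in>{I. length I = k}. \<Prod>b<k. F b (I ! b))"
proof (induction k arbitrary: F)
  case (Suc k)
  then show ?case
    by (simp add: prod.lessThan_Suc_shift sum_lists_Suc sum_product del: prod.lessThan_Suc)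
qed simp

text \<open>The same tangent vectors written in another chart. X and the frame transform by the same
  Jacobian, so the coefficients stay what they are.\<close>

lemma transport_to_chart:
  assumes M: "riemannian_surface M"
    and c: "c \<in> atlas M" "c' \<in> atlas M" "q \<in> dom_ch c" "q \<in> dom_ch c'"
    and on: "orthonormal_frame M c q e1 e2"
  defines "J \<equiv> jac c c' q"
  shows "orthonormal_frame M c' q (J *v e1) (J *v e2)"
    "parallel_section M k X \<Longrightarrow> value_at c q e1 e2 k X a \<Longrightarrow> value_at c' q (J *v e1) (J *v e2) k X a"
proof -
  have "metric M c (crd c q) = transpose J ** metric M c' (crd c' q) ** J"
    using M c unfolding riemannian_surface_def J_def by blast
  then have "u \<bullet> (metric M c (crd c q) *v v) = (J *v u) \<bullet> (metric M c' (crd c' q) *v (J *v v))" for u v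
  proof -
    have "u \<bullet> (transpose J *v z) = (J *v u) \<bullet> z" for z
      by (metis dot_lmul_matrix inner_commute transpose_matrix_vector)
    then show ?thesis
      by (simp only: \<open>metric M c (crd c q) = _\<close> matrix_vector_mul_assoc[symmetric])
  qed
  then show "orthonormal_frame M c' q (J *v e1) (J *v e2)"
    using on by (simp add: orthonormal_frame_def Let_def)
next
  assume X: "parallel_section M k X" and a: "value_at c q e1 e2 k X a"
  have h: "hvec (J *v e1) (J *v e2) s $ i = (\<Sum>j\<in>UNIV. of_real (J $ i $ j) * hvec e1 e2 s $ j)" for s i
    by (simp add: hvec_def matrix_vector_mult_def sum_2 algebra_simps)
  have prod: "(\<Prod>b<k. hvec (J *v e1) (J *v e2) (w ! b) $ (I ! b))
      = (\<Sum>I'\<in>{I'. length I' = k}. (\<Prod>b<k. of_real (J $ (I ! b) $ (I' ! b))) * (\<Prod>b<k. hvec e1 e2 (w ! b) $ (I' ! b)))" for w I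
    unfolding h prod_sum_lists prod.distrib ..
  show "value_at c' q (J *v e1) (J *v e2) k X a"
    unfolding value_at_def
  proof (intro allI impI)
    fix I :: "2 list" assume I: "length I = k"
    have "X c' I (crd c' q) = (\<Sum>I'\<in>{I'. length I' = k}. (\<Prod>b<k. of_real (J $ (I ! b) $ (I' ! b))) * X c I' (crd c q))"
      using X c I unfolding parallel_section_def J_def by blast
    also have "\<dots> = (\<Sum>I'\<in>{I'. length I' = k}. \<Sum>w\<in>{w. length w = k}.
        a w * ((\<Prod>b<k. of_real (J $ (I ! b) $ (I' ! b))) * (\<Prod>b<k. hvec e1 e2 (w ! b) $ (I' ! b))))"
      by (rule sum.cong[OF refl]) (use a in \<open>simp add: value_at_def sum_distrib_left mult_ac\<close>)
    also have "\<dots> = (\<Sum>w\<in>{w. length w = k}. a w * (\<Prod>b<k. hvec (J *v e1) (J *v e2) (w ! b) $ (I ! b)))"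
      unfolding prod sum_distrib_left by (rule sum.swap)
    finally show "X c' I (crd c' q) = (\<Sum>w\<in>{w. length w = k}. a w * (\<Prod>b<k. hvec (J *v e1) (J *v e2) (w ! b) $ (I ! b)))" .
  qed
qed

lemma chart_ball:
  assumes "smooth_atlas A" "c \<in> A" "open W" "q \<in> dom_ch c" "q \<in> W"
  obtains r where "r > 0" "ball (crd c q) r \<subseteq> crd c ` (dom_ch c \<inter> W)"
proof -
  have hom: "homeomorphism (dom_ch c) (img_ch c) (crd c) (par c)" and o: "open (dom_ch c)" "open (img_ch c)"
    using assms(1,2) by (auto simp: smooth_atlas_def)
  have "openin (top_of_set (img_ch c)) (crd c ` (dom_ch c \<inter> W))"
    by (rule homeomorphism_imp_open_map[OF hom]) (use o assms(3) in \<open>auto simp: openin_open\<close>)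
  then have "open (crd c ` (dom_ch c \<inter> W))"
    using o(2) openin_open_eq by blast
  then show ?thesis
    using assms(4,5) openE that by (metis IntI imageI)
qed

text \<open>Every point has a neighbourhood in which one good point makes all points good, so the
  good points and the others both form open sets. One frame at q serves all k and X at once, so that
  a single evaluation can respect every parallel section.\<close>

lemma transport:
  fixes M :: "('m::{t2_space,second_countable_topology}) surface"
  assumes M: "riemannian_surface M" "constant_curvature M K" "K \<noteq> 0" "connected (UNIV :: 'm set)"
    and c: "c \<in> atlas M" "p \<in> dom_ch c" and on: "orthonormal_frame M c p e1 e2"
  shows "\<exists>c'\<in>atlas M. q \<in> dom_ch c' \<and> (\<exists>e1' e2'. orthonormal_frame M c' q e1' e2' \<and>
    (\<forall>k X a. parallel_section M k X \<longrightarrow> value_at c p e1 e2 k X a \<longrightarrow> value_at c' q e1' e2' k X a))"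
proof -
  define A where "A = {q. \<exists>c'\<in>atlas M. q \<in> dom_ch c' \<and> (\<exists>e1' e2'. orthonormal_frame M c' q e1' e2' \<and>
    (\<forall>k X a. parallel_section M k X \<longrightarrow> value_at c p e1 e2 k X a \<longrightarrow> value_at c' q e1' e2' k X a))}"
  have at: "smooth_atlas (atlas M)"
    using M(1) by (simp add: riemannian_surface_def)
  have local: "\<exists>N. open N \<and> q \<in> N \<and> (\<forall>q1\<in>N. \<forall>q2\<in>N. q1 \<in> A \<longrightarrow> q2 \<in> A)" for q
  proof -
    obtain d where d: "d \<in> atlas M" "q \<in> dom_ch d"
      using at unfolding smooth_atlas_def by blast
    have hom: "homeomorphism (dom_ch d) (img_ch d) (crd d) (par d)" and o: "open (dom_ch d)"
      using at d(1) by (auto simp: smooth_atlas_def)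
    obtain r where r: "r > 0" "ball (crd d q) r \<subseteq> crd d ` (dom_ch d \<inter> UNIV)"
      by (rule chart_ball[OF at d(1) open_UNIV d(2) UNIV_I])
    let ?S = "ball (crd d q) r"
    let ?N = "dom_ch d \<inter> crd d -` ?S"
    have "open ?N"
      by (rule continuous_open_preimage[OF homeomorphism_cont1[OF hom] o open_ball])
    moreover have "q \<in> ?N" using d r by simp
    moreover have "q2 \<in> A" if q: "q1 \<in> ?N" "q2 \<in> ?N" "q1 \<in> A" for q1 q2
    proof -
      obtain c' f1 f2 where f: "c' \<in> atlas M" "q1 \<in> dom_ch c'" "orthonormal_frame M c' q1 f1 f2"
        "\<And>k X a. parallel_section M k X \<Longrightarrow> value_at c p e1 e2 k X a \<Longrightarrow> value_at c' q1 f1 f2 k X a"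
        using q(3) unfolding A_def by blast
      have q1d: "q1 \<in> dom_ch d" using q by blast
      obtain g1 g2 where g: "orthonormal_frame M d q2 g1 g2"
        "\<And>k X a. parallel_section M k X \<Longrightarrow>
          value_at d q1 (jac c' d q1 *v f1) (jac c' d q1 *v f2) k X a \<Longrightarrow> value_at d q2 g1 g2 k X a"
        using transport_in_chart[OF M(1-3) d(1) q1d _ transport_to_chart(1)[OF M(1) f(1) d(1) f(2) q1d f(3)]
            convex_ball open_ball, of q2 "crd d q" r] r q by auto
      show ?thesis
        unfolding A_def using d q(2) g f(4) transport_to_chart(2)[OF M(1) f(1) d(1) f(2) q1d f(3)] by blast
    qed
    ultimately show ?thesis by blast
  qed
  have "\<exists>N. open N \<and> x \<in> N \<and> N \<subseteq> A" if "x \<in> A" for x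
    using local[of x] that by (meson subsetI)
  then have "open A"
    by (simp add: open_subopen[of A])
  moreover have "\<exists>N. open N \<and> x \<in> N \<and> N \<subseteq> - A" if "x \<notin> A" for x
    using local[of x] that by (meson subsetI ComplI)
  then have "open (- A)"
    by (simp add: open_subopen[of "- A"])
  moreover have "p \<in> A"
    unfolding A_def using c on by blast
  ultimately have "- A = {}"
    using connectedD[OF M(4), of A "- A"] by blast
  then show ?thesis
    unfolding A_def by blast
qed

section \<open>Words in the isotropic frame acting on functions at a point\<close>

text \<open>\<open>E g w\<close> is the iterated covariant derivative of g contracted with w in a
  frame at a point q where f does not vanish. The frame is transported from p, so the coefficients
  of X at p are its components at q and, by local constancy, in a neighbourhood; they can be
  differentiated as constants.\<close>

proposition word_action:
  fixes M :: "('m::{t2_space,second_countable_topology}) surface"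
  assumes M: "riemannian_surface M" "connected (UNIV :: 'm set)" "constant_curvature M K" "K \<noteq> 0"
    and c: "c \<in> atlas M" "p \<in> dom_ch c" and on: "orthonormal_frame M c p e1 e2"
    and U: "open U" and f: "eigenfunction M U lam f"
  obtains E :: "('m \<Rightarrow> complex) \<Rightarrow> bool list \<Rightarrow> complex" where
    "\<And>g h a b w. g \<in> C_inf M U \<Longrightarrow> h \<in> C_inf M U \<Longrightarrow> E (\<lambda>q. a * g q + b * h q) w = a * E g w + b * E h w"
    "\<And>k X a v. parallel_section M k X \<Longrightarrow> value_at c p e1 e2 k X a \<Longrightarrow> length v = k \<Longrightarrow> weight v \<noteq> 0 \<Longrightarrow> a v = 0"
    "\<And>k X a g h w. parallel_section M k X \<Longrightarrow> value_at c p e1 e2 k X a \<Longrightarrow> g \<in> C_inf M U \<Longrightarrow> h \<in> C_inf M U \<Longrightarrow>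
       acts_to M U k X g h \<Longrightarrow> (\<Sum>v\<in>{v. length v = k}. a v * E g (w @ v)) = E h w"
    "\<And>w. weight w = 0 \<Longrightarrow> E f w = Cfactor lam K w * E f []"
    "E f [] \<noteq> 0"
proof -
  obtain q where q: "q \<in> U" "f q \<noteq> 0"
    using f by (auto simp: eigenfunction_def)
  obtain c' e1' e2' where c': "c' \<in> atlas M" "q \<in> dom_ch c'" "orthonormal_frame M c' q e1' e2'"
    and tr: "\<And>k X a. parallel_section M k X \<Longrightarrow> value_at c p e1 e2 k X a \<Longrightarrow> value_at c' q e1' e2' k X a"
    using transport[OF M(1,3,4,2) c on, of q] by blast
  have P: "surface_patch (metric M c') (img_ch c') K e1' e2'"
    by (rule surface_patchI[OF M(1,3) c'])
  then interpret surface_patch "metric M c'" "img_ch c'" K e1' e2' .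
  have at: "smooth_atlas (atlas M)"
    using M(1) by (simp add: riemannian_surface_def)
  have inj: "inj_on (crd c') (dom_ch c')"
    by (rule inj_on_inverseI[where g = "par c'"], rule homeomorphism_apply1)
      (use at c'(1) in \<open>auto simp: smooth_atlas_def\<close>)
  \<comment> \<open>A ball is convex, as \<open>tcomp_constant\<close> demands, and this one lies in
    the chart image of U, where the members of \<open>C_inf M U\<close> are smooth.\<close>
  obtain r where r: "r > 0" "ball (crd c' q) r \<subseteq> crd c' ` (dom_ch c' \<inter> U)"
    by (rule chart_ball[OF at c'(1) U c'(2) q(1)])
  let ?y = "crd c' q" and ?T = "ball (crd c' q) r"
  have y: "?y \<in> ?T" using r by simp
  have T: "open ?T" "?T \<subseteq> img_ch c'" using r by auto
  have point: "\<exists>x\<in>dom_ch c' \<inter> U. crd c' x = z \<and> par c' z = x" if "z \<in> ?T" for z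
    using that r(2) inv_into_f_f[OF inj] by blast
  have sm: "smooth_on ?T (g \<circ> par c')" if "g \<in> C_inf M U" for g
    using that c'(1) r(2) smooth_on_subset unfolding C_inf_def by blast
  define E where "E g w = fcomp (g \<circ> par c') w ?y" for g w
  show thesis
  proof
    fix g h a b w assume "g \<in> C_inf M U" "h \<in> C_inf M U"
    then show "E (\<lambda>q. a * g q + b * h q) w = a * E g w + b * E h w"
      using fcomp_linear[OF T sm sm y, of g h a b w] by (simp add: E_def o_def)
  next
    fix k X a and v :: "bool list"
    assume X: "parallel_section M k X" "value_at c p e1 e2 k X a" "length v = k" "weight v \<noteq> 0"
    have "tcomp (X c') v ?y = 0"
      by (rule tcomp_unbalanced[OF M(4) par_eqI[OF P c'(1) X(1)] X(3) _ X(4)]) (use c' in simp)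
    then show "a v = 0"
      using tcomp_value_at[OF P c'(3,2) tr[OF X(1,2)] X(3)] by simp
  next
    fix k X a g h w
    assume X: "parallel_section M k X" "value_at c p e1 e2 k X a"
      and g: "g \<in> C_inf M U" "h \<in> C_inf M U" and act: "acts_to M U k X g h"
    have val: "tcomp (X c') v z = a v" if "length v = k" "z \<in> ?T" for v z
      using tcomp_constant[OF M(4) par_eqI[OF P c'(1) X(1)] that(1) convex_ball T that(2) y]
        tcomp_value_at[OF P c'(3,2) tr[OF X] that(1)] by simp
    have bal: "a v = 0" if "length v = k" "weight v \<noteq> 0" for v
      using tcomp_unbalanced[OF M(4) par_eqI[OF P c'(1) X(1)] that(1) _ that(2), of ?y] val[OF that(1) y] c' by simp
    have hz: "(h \<circ> par c') z = (\<Sum>v\<in>{v. length v = k}. a v * fcomp (g \<circ> par c') v z)" if z: "z \<in> ?T" for z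
    proof -
      obtain x where x: "x \<in> dom_ch c' \<inter> U" "crd c' x = z" "par c' z = x"
        using point[OF z] by blast
      have "h x = (\<Sum>I\<in>{I. length I = k}. X c' I z * nabla_pow (metric M c') k (g \<circ> par c') I z)"
        using act c'(1) x unfolding acts_to_def by blast
      also have "\<dots> = (\<Sum>v\<in>{v. length v = k}. tcomp (X c') v z * fcomp (g \<circ> par c') v z)"
        by (rule contraction_tcomp) (use z T in blast)
      finally show ?thesis
        using val[OF _ z] x by simp
    qed
    show "(\<Sum>v\<in>{v. length v = k}. a v * E g (w @ v)) = E h w"
      unfolding E_def
      by (rule fcomp_parallel_action[OF T sm[OF g(1)] bal hz sm[OF g(2)] y, symmetric])
  next
    have fC: "f \<in> C_inf M U"
      using f by (simp add: eigenfunction_def)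
    have eig: "laplacian (metric M c') (f \<circ> par c') z = - lam * (f \<circ> par c') z" if z: "z \<in> ?T" for z
    proof -
      obtain x where x: "x \<in> dom_ch c' \<inter> U" "crd c' x = z" "par c' z = x"
        using point[OF z] by blast
      then have "- laplacian (metric M c') (f \<circ> par c') z = lam * f x"
        using f c'(1) unfolding eigenfunction_def by blast
      then show ?thesis
        using x by (simp add: minus_equation_iff)
    qed
    fix w :: "bool list" assume "weight w = 0"
    then show "E f w = Cfactor lam K w * E f []"
      using fcomp_eigenfunction[OF T sm[OF fC] eig y, of w] by (simp add: E_def)
  next
    show "E f [] \<noteq> 0"
      using q c'(2) inv_into_f_f[OF inj] by (simp add: E_def)
  qed
qed

section \<open>Linear extension\<close>

lemma lin_ext_superset:
  assumes "finite A" "Poly_Mapping.keys u \<subseteq> A"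
  shows "lin_ext \<phi> u = (\<Sum>x\<in>A. scal (Poly_Mapping.lookup u x) (\<phi> x))"
  unfolding lin_ext_def
  by (rule sum.mono_neutral_left) (use assms in \<open>auto simp: in_keys_iff\<close>)

lemma lin_ext_add: "lin_ext \<phi> (u + v) = lin_ext \<phi> u + lin_ext \<phi> v"
proof -
  let ?A = "Poly_Mapping.keys u \<union> Poly_Mapping.keys v"
  show ?thesis
    using lin_ext_superset[of ?A u \<phi>] lin_ext_superset[of ?A v \<phi>] lin_ext_superset[of ?A "u + v" \<phi>]
      Poly_Mapping.keys_add[of u v]
    by (simp add: lookup_add lc.scale_left_distrib sum.distrib)
qed

lemma lin_ext_scal: "lin_ext \<phi> (scal a u) = scal a (lin_ext \<phi> u)"
proof -
  have "Poly_Mapping.keys (scal a u) \<subseteq> Poly_Mapping.keys u"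
    by (auto simp: in_keys_iff)
  then show ?thesis
    using lin_ext_superset[of "Poly_Mapping.keys u" "scal a u" \<phi>] lin_ext_superset[of "Poly_Mapping.keys u" u \<phi>]
    by (simp add: lc.scale_sum_right)
qed

lemma lin_ext_zero [simp]: "lin_ext \<phi> 0 = 0"
  by (simp add: lin_ext_def)

lemma lin_ext_minus: "lin_ext \<phi> (- u) = - lin_ext \<phi> u"
  using lin_ext_scal[of \<phi> "-1" u] by simp

lemma lin_ext_diff: "lin_ext \<phi> (u - v) = lin_ext \<phi> u - lin_ext \<phi> v"
  using lin_ext_add[of \<phi> u "- v"] by (simp add: lin_ext_minus)

lemma lin_ext_sum: "lin_ext \<phi> (\<Sum>a\<in>A. u a) = (\<Sum>a\<in>A. lin_ext \<phi> (u a))"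
  by (induction A rule: infinite_finite_induct) (simp_all add: lin_ext_add)

lemma scal_zero_left [simp]: "scal 0 u = 0"
  by (rule lc.scale_zero_left)

lemma scal_zero_right [simp]: "scal a 0 = 0"
  by (rule lc.scale_zero_right)

lemma scal_one [simp]: "scal 1 u = u"
  by (rule lc.scale_one)

lemma lin_ext_ket [simp]: "lin_ext \<phi> (Poly_Mapping.single k 1) = \<phi> k"
  by (simp add: lin_ext_def)

lemmas lin_ext_simps = lin_ext_add lin_ext_diff lin_ext_sum lin_ext_scal

lemma lin_ext_comp: "lin_ext \<phi> (lin_ext \<psi> u) = lin_ext (\<lambda>k. lin_ext \<phi> (\<psi> k)) u"
  unfolding lin_ext_def[of \<psi>] lin_ext_def[of "\<lambda>k. lin_ext \<phi> (\<psi> k)"] by (simp add: lin_ext_sum lin_ext_scal)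

lemma lin_ext_fun_add: "lin_ext (\<lambda>k. \<phi> k + \<psi> k) u = lin_ext \<phi> u + lin_ext \<psi> u"
  by (simp add: lin_ext_def lc.scale_right_distrib sum.distrib)

lemma lin_ext_fun_scal: "lin_ext (\<lambda>k. scal a (\<phi> k)) u = scal a (lin_ext \<phi> u)"
  by (simp add: lin_ext_def lc.scale_sum_right lc.scale_scale mult.commute)

lemma lin_ext_eq_everywhere:
  assumes "\<And>k. lin_ext \<phi> (\<psi> k) = lin_ext \<phi>' (\<psi>' k)"
  shows "lin_ext \<phi> (lin_ext \<psi> u) = lin_ext \<phi>' (lin_ext \<psi>' u)"
  by (simp add: lin_ext_comp assms)

section \<open>Modes\<close>

abbreviation positive :: "(bool \<times> nat) list \<Rightarrow> bool" where
  "positive ns \<equiv> \<forall>(s, t)\<in>set ns. t \<ge> 1"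

definition annihil :: "complex \<Rightarrow> bool \<Rightarrow> nat \<Rightarrow> 'm fock \<Rightarrow> 'm fock" where
  "annihil l s m = lin_ext (\<lambda>(ns, w, g). annihil_ket l s m ns w g)"

lemma mode_ket [simp]:
  "create s t (ket ns w g) = ket ((s, t) # ns) w g"
  "zero_mode s (ket ns w g) = ket ns (s # w) g"
  "annihil l s m (ket ns w g) = annihil_ket l s m ns w g"
  by (simp_all add: create_def zero_mode_def annihil_def)

lemma hmodes_append: "hmodes l (as @ bs) u = hmodes l as (hmodes l bs u)"
  by (simp add: hmodes_def)

lemma hmodes_Nil [simp]: "hmodes l [] u = u"
  by (simp add: hmodes_def)

lemma hmodes_Cons [simp]: "hmodes l (a # as) u = hmode l (fst a) (snd a) (hmodes l as u)"
  by (simp add: hmodes_def case_prod_unfold)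

lemma hmodes_zer: "hmodes l (zer js) (ket ns w g) = ket ns (js @ w) g"
  by (induction js) (simp_all add: zer_def hmode_def)

lemma hmodes_neg:
  assumes "positive as"
  shows "hmodes l (neg as) (ket ns w g) = ket (as @ ns) w g"
  using assms by (induction as) (auto simp: neg_def hmode_def)

lemma hmodes_neg_zer: "positive as \<Longrightarrow> hmodes l (neg as @ zer js) (fvec f) = ket as js f"
  by (simp add: hmodes_append hmodes_zer hmodes_neg)

lemma hmode_cases:
  obtains t where "t \<ge> 1" "hmode l s n u = create s t u"
  | "hmode l s n u = zero_mode s u"
  | m where "m \<ge> 1" "hmode l s n u = annihil l s m u"
proof -
  consider "n < 0" | "n = 0" | "n > 0" by linarith
  then show thesis
  proof cases
    case 1
    then show ?thesis by (intro that(1)[of "nat (- n)"]) (auto simp: hmode_def)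
  next
    case 2
    then show ?thesis by (intro that(2)) (auto simp: hmode_def)
  next
    case 3
    then show ?thesis by (intro that(3)[of "nat n"]) (auto simp: hmode_def annihil_def)
  qed
qed

lemma mset_normal_order: "mset (normal_order as) = mset as"
proof -
  have "mset (normal_order as) = filter_mset (\<lambda>a. snd a < 0) (mset as)
      + (filter_mset (\<lambda>a. snd a > 0) (mset as) + filter_mset (\<lambda>a. snd a = 0) (mset as))"
    by (simp add: normal_order_def)
  also have "\<dots> = mset as"
    by (rule multiset_eqI) auto
  finally show ?thesis .
qed

lemma weight_count: "weight js = int (count_list js True) - int (count_list js False)"
  by (induction js) auto

text \<open>Infinite support is harmless here: \<open>Sum_any\<close> is then 0, which lies in V as
  well.\<close>

lemma Sum_any_in_subspace:
  assumes "lc.subspace V" "\<And>a. F a \<in> V"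
  shows "Sum_any F \<in> V"
  unfolding Sum_any.expand_set by (rule lc.subspace_sum[OF assms(1)]) (rule assms(2))

text \<open>A balanced word has total sign 0 and normal ordering only permutes its modes, so the
  shifts made by the single modes cancel.\<close>

lemma vmode_in_graded_subspace:
  assumes V: "\<And>\<tau>. lc.subspace (V \<tau>)"
    and mode: "\<And>\<tau> s n u. u \<in> V \<tau> \<Longrightarrow> hmode l s n u \<in> V (\<tau> + sg s)"
    and v: "v \<in> V_alg" and u: "u \<in> V \<tau>"
  shows "vmode l v n u \<in> V \<tau>"
proof -
  have hmodes: "hmodes l as u \<in> V (\<tau> + weight (map fst as))" for as
    by (induction as) (use u in \<open>auto dest: mode simp: algebra_simps\<close>)
  have "word_mode l x n u \<in> V \<tau>" if x: "x \<in> Poly_Mapping.keys v" for x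
    unfolding word_mode_def
  proof (rule Sum_any_in_subspace[OF V])
    fix ns :: "int list"
    have "weight (map fst x) = 0"
      using v x by (auto simp: V_alg_def weight_count simp del: map_map)
    moreover have "weight (map fst (normal_order (zip (map fst x) ns))) = weight (map fst x)"
      if "length ns = length x"
    proof -
      have "mset (map sg (map fst (normal_order (zip (map fst x) ns)))) = mset (map sg (map fst x))"
        using that by (simp only: mset_map mset_normal_order) (simp flip: mset_map)
      then show ?thesis
        by (metis sum_mset_sum_list)
    qed
    ultimately show "(if length ns = length x \<and> (\<Sum>j<length x. ns ! j + int (snd (x ! j))) = n + 1
      then scal (\<Prod>j<length x. (of_int (- (ns ! j) - 1)) gchoose (snd (x ! j) - 1))
            (hmodes l (normal_order (zip (map fst x) ns)) u) else 0) \<in> V \<tau>"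
      using hmodes[of "normal_order (zip (map fst x) ns)"] V[of \<tau>]
      by (auto intro: lc.subspace_scale lc.subspace_0)
  qed
  then show ?thesis
    unfolding vmode_def lin_ext_def by (intro lc.subspace_sum[OF V] lc.subspace_scale[OF V])
qed

section \<open>Extraction of single mode products\<close>

lemma finite_lists_over: "finite A \<Longrightarrow> finite {w. set w \<subseteq> A \<and> length w = k}"
  by (rule finite_lists_length_eq)

lemma sum_lists_over_Suc:
  fixes F :: "'a list \<Rightarrow> 'b::comm_monoid_add"
  shows "(\<Sum>w\<in>{w. set w \<subseteq> A \<and> length w = Suc k}. F w)
    = (\<Sum>s\<in>A. \<Sum>w\<in>{w. set w \<subseteq> A \<and> length w = k}. F (s # w))"
proof -
  have "{w. set w \<subseteq> A \<and> length w = Suc k} = (\<lambda>(s, w). s # w) ` (A \<times> {w. set w \<subseteq> A \<and> length w = k})"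
    by (auto simp: length_Suc_conv)
  moreover have "inj_on (\<lambda>(s, w). s # w) (A \<times> {w. set w \<subseteq> A \<and> length w = k})"
    by (auto simp: inj_on_def)
  ultimately show ?thesis
    by (simp add: sum.reindex sum.cartesian_product case_prod_unfold)
qed

text \<open>The coefficient of the mode -t in the derivative of order m - 1. For t between 1 and m - 1 it
  vanishes and for t = m it is 1, whereas t = 0 contributes a sign for every m: taking m larger than
  all t isolates t = 0, and then the system is triangular.\<close>

definition mode_coeff :: "nat \<Rightarrow> nat \<Rightarrow> complex" where
  "mode_coeff t m = of_int (int t - 1) gchoose (m - 1)"

lemma mode_coeff_0: "mode_coeff 0 m = (- 1) ^ (m - 1)"
  using gbinomial_minus[of "1::complex" "m - 1"] by (simp add: mode_coeff_def flip: binomial_gbinomial)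

lemma mode_coeff_pos: "t \<ge> 1 \<Longrightarrow> mode_coeff t m = of_nat ((t - 1) choose (m - 1))"
  by (simp add: mode_coeff_def binomial_gbinomial of_nat_diff)

lemma triangular_extraction:
  fixes Y :: "nat \<Rightarrow> 'k \<Rightarrow>\<^sub>0 complex"
  assumes V: "lc.subspace V" and sum: "\<And>m. m \<ge> 1 \<Longrightarrow> (\<Sum>t\<le>d. scal (mode_coeff t m) (Y t)) \<in> V"
    and t: "t \<le> d"
  shows "Y t \<in> V"
proof -
  \<comment> \<open>The choice m = d + 1 annihilates every coefficient with 1 \<le> t \<le>
    d.\<close>
  have "(\<Sum>t\<le>d. scal (mode_coeff t (Suc d)) (Y t)) = scal ((- 1) ^ d) (Y 0)"
    by (subst sum.remove[of _ 0]) (auto simp: mode_coeff_0 mode_coeff_pos intro!: sum.neutral)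
  then have "scal ((- 1) ^ d) (Y 0) \<in> V"
    using sum[of "Suc d"] by simp
  then have "scal ((- 1) ^ d) (scal ((- 1) ^ d) (Y 0)) \<in> V"
    by (rule lc.subspace_scale[OF V])
  then have Y0: "Y 0 \<in> V"
    by (simp add: lc.scale_scale flip: power_mult_distrib)
  show ?thesis
    using t
  \<comment> \<open>Downwards from t = d, taking m = t: larger indices are known, smaller positive
    ones have coefficient 0, and index 0 is already settled.\<close>
  proof (induction "d - t" arbitrary: t rule: less_induct)
    case less
    show ?case
    proof (cases "t = 0")
      case False
      then have t: "t \<ge> 1" by simp
      let ?h = "\<lambda>t'. scal (mode_coeff t' t) (Y t')"
      have "(\<Sum>t'\<le>d. ?h t') = ?h t + (\<Sum>t'\<in>{..d} - {t}. ?h t')"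
        by (rule sum.remove) (use less.prems in auto)
      moreover have "?h t = Y t"
        using t by (simp add: mode_coeff_pos)
      moreover have "(\<Sum>t'\<in>{..d} - {t}. ?h t') \<in> V"
      proof (rule lc.subspace_sum[OF V])
        fix t' assume t': "t' \<in> {..d} - {t}"
        consider "t' = 0" | "1 \<le> t'" "t' < t" | "t < t'" "t' \<le> d"
          using t' by force
        then show "?h t' \<in> V"
        proof cases
          case 1
          then show ?thesis using Y0 by (simp add: lc.subspace_scale[OF V])
        next
          case 2
          then have "mode_coeff t' t = 0"
            by (auto simp: mode_coeff_pos)
          then show ?thesis by (simp add: lc.subspace_0[OF V])
        next
          case 3
          then show ?thesis using less.hyps[of t'] by (simp add: lc.subspace_scale[OF V])
        qed
      qed
      ultimately have "Y t = (\<Sum>t'\<le>d. ?h t') - (\<Sum>t'\<in>{..d} - {t}. ?h t')" "(\<Sum>t'\<in>{..d} - {t}. ?h t') \<in> V"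
        by simp_all
      then show ?thesis
        using lc.subspace_diff[OF V sum[OF t]] by simp
    qed (use Y0 in simp)
  qed
qed

text \<open>The coefficients form a tensor power of the one-variable matrix, so
  \<open>triangular_extraction\<close> works one position at a time while the exponents of the other
  positions are held fixed.\<close>

lemma multi_extraction:
  fixes W :: "nat list \<Rightarrow> 'k \<Rightarrow>\<^sub>0 complex"
  assumes V: "lc.subspace V"
    and sum: "\<And>ms. length ms = k \<Longrightarrow> \<forall>m\<in>set ms. m \<ge> 1 \<Longrightarrow>
      (\<Sum>ts\<in>{ts. set ts \<subseteq> {..d} \<and> length ts = k}. scal (\<Prod>j<k. mode_coeff (ts ! j) (ms ! j)) (W ts)) \<in> V"
    and ts: "set ts \<subseteq> {..d}" "length ts = k"
  shows "W ts \<in> V"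
  using sum ts
proof (induction k arbitrary: W ts)
  case 0
  have "{ts. set ts \<subseteq> {..d} \<and> length ts = 0} = {[]}" by auto
  then show ?case using 0(1)[of "[]"] 0(3) by simp
next
  case (Suc k)
  obtain t ts' where ts: "ts = t # ts'" "t \<le> d" "set ts' \<subseteq> {..d}" "length ts' = k"
    using Suc.prems(2,3) by (auto simp: length_Suc_conv)
  have "W (t # ts') \<in> V"
  proof (rule Suc.IH[OF _ ts(3,4)])
    fix ms :: "nat list" assume ms: "length ms = k" "\<forall>m\<in>set ms. m \<ge> 1"
    show "(\<Sum>ts\<in>{ts. set ts \<subseteq> {..d} \<and> length ts = k}. scal (\<Prod>j<k. mode_coeff (ts ! j) (ms ! j)) (W (t # ts))) \<in> V"
    proof (rule triangular_extraction[OF V _ ts(2)])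
      fix m :: nat assume m: "m \<ge> 1"
      show "(\<Sum>t\<le>d. scal (mode_coeff t m)
          (\<Sum>ts\<in>{ts. set ts \<subseteq> {..d} \<and> length ts = k}. scal (\<Prod>j<k. mode_coeff (ts ! j) (ms ! j)) (W (t # ts)))) \<in> V"
        using Suc.prems(1)[of "m # ms"] m ms
        by (simp add: sum_lists_over_Suc prod.lessThan_Suc_shift lc.scale_sum_right lc.scale_scale
            del: prod.lessThan_Suc)
    qed
  qed
  then show ?case by (simp add: ts)
qed

text \<open>Zero modes act first and only lengthen the word in S; the rightmost positive mode then
  meets no creation operator and gives 0.\<close>

lemma hmodes_normal_order_positive:
  assumes "a \<in> set as" "snd a > 0"
  shows "hmodes l (normal_order as) (fvec f) = 0"
proof -
  let ?P = "filter (\<lambda>a. snd a > 0) as"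
  have hmode0: "hmode l s n 0 = 0" for s n
    by (simp add: hmode_def create_def zero_mode_def)
  have hmodes0: "hmodes l bs 0 = 0" for bs
    by (induction bs) (simp_all add: hmode0)
  have zeros: "hmodes l (filter (\<lambda>a. snd a = 0) as) (fvec f)
      = ket [] (map fst (filter (\<lambda>a. snd a = 0) as)) f"
    by (induction as) (auto simp: hmode_def)
  have "?P \<noteq> []"
    using assms by (auto simp: filter_empty_conv)
  then obtain bs b where P: "?P = bs @ [b]"
    by (metis rev_exhaust)
  then have "b \<in> set ?P"
    by simp
  then have "hmode l (fst b) (snd b) (ket [] w f) = 0" for w
    by (simp add: hmode_def)
  then have "hmodes l ?P (ket [] w f) = 0" for w
    by (simp add: P hmodes_append hmodes0)
  then show ?thesis
    by (simp add: normal_order_def hmodes_append zeros hmodes0)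
qed

text \<open>Tying n to the exponents fixes the weight d of the result, so that varying the exponents
  changes the scalars but not the vectors: this is the shape that \<open>multi_extraction\<close>
  needs. Positive modes contribute nothing, hence all modes lie between -d and 0.\<close>

lemma word_mode_fvec:
  fixes x :: "(bool \<times> nat) list" and d :: nat
  assumes n: "n + 1 = (\<Sum>j<length x. int (snd (x ! j))) - int d"
  shows "word_mode l x n (fvec f) =
    (\<Sum>ts\<in>{ts. set ts \<subseteq> {..d} \<and> length ts = length x}. scal (\<Prod>j<length x. mode_coeff (ts ! j) (snd (x ! j)))
       (if sum_list ts = d then hmodes l (normal_order (zip (map fst x) (map (\<lambda>t. - int t) ts))) (fvec f) else 0))"
proof -
  let ?neg = "map (\<lambda>t. - int t)" and ?A = "{ts. set ts \<subseteq> {..d} \<and> length ts = length x}"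
  let ?F = "\<lambda>ns. if length ns = length x \<and> (\<Sum>j<length x. ns ! j + int (snd (x ! j))) = n + 1
     then scal (\<Prod>j<length x. (of_int (- (ns ! j) - 1)) gchoose (snd (x ! j) - 1))
            (hmodes l (normal_order (zip (map fst x) ns)) (fvec f)) else 0"
  have constraint: "(\<Sum>j<length x. ns ! j + int (snd (x ! j))) = n + 1 \<longleftrightarrow> sum_list ns = - int d"
    if "length ns = length x" for ns
    using that n by (simp add: sum.distrib sum_list_sum_nth atLeast0LessThan)
  have sum_neg: "sum_list (?neg ts) = - int (sum_list ts)" for ts
    by (induction ts) auto
  have inj: "inj_on ?neg ?A"
    by (auto simp: inj_on_def map_injective inj_def)
  have "ns \<in> ?neg ` ?A" if "?F ns \<noteq> 0" for ns
  proof -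
    have len: "length ns = length x" and sum: "sum_list ns = - int d"
      and ne: "hmodes l (normal_order (zip (map fst x) ns)) (fvec f) \<noteq> 0"
      using that constraint by (auto split: if_splits)
    have nonpos: "m \<le> 0" if m: "m \<in> set ns" for m
    proof (rule ccontr)
      assume "\<not> m \<le> 0"
      moreover obtain j where "j < length ns" "ns ! j = m"
        using m by (auto simp: in_set_conv_nth)
      then have "(map fst x ! j, m) \<in> set (zip (map fst x) ns)"
        using len by (auto simp: in_set_zip intro!: exI[of _ j])
      ultimately show False
        using hmodes_normal_order_positive[of "(map fst x ! j, m)" "zip (map fst x) ns" l f] ne by simp
    qed
    define ts where "ts = map (\<lambda>m. nat (- m)) ns"
    have ns: "ns = ?neg ts"
      using nonpos by (auto simp: ts_def intro!: map_idI[symmetric])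
    have "sum_list ts = d"
      using sum by (simp add: ns sum_neg)
    then have "set ts \<subseteq> {..d}"
      using member_le_sum_list by fastforce
    then show ?thesis
      using len ns by auto
  qed
  then have "{ns. ?F ns \<noteq> 0} \<subseteq> ?neg ` ?A"
    by blast
  then have "word_mode l x n (fvec f) = (\<Sum>ns\<in>?neg ` ?A. ?F ns)"
    unfolding word_mode_def
    by (intro Sum_any.expand_superset finite_imageI finite_lists_over finite_atMost)
  also have "\<dots> = (\<Sum>ts\<in>?A. ?F (?neg ts))"
    by (rule sum.reindex_cong[OF inj]) simp_all
  also have "\<dots> = (\<Sum>ts\<in>?A. scal (\<Prod>j<length x. mode_coeff (ts ! j) (snd (x ! j)))
       (if sum_list ts = d then hmodes l (normal_order (zip (map fst x) (?neg ts))) (fvec f) else 0))"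
  proof (rule sum.cong[OF refl])
    fix ts assume ts: "ts \<in> ?A"
    have "(\<Prod>j<length x. (of_int (- (?neg ts ! j) - 1) :: complex) gchoose (snd (x ! j) - 1))
        = (\<Prod>j<length x. mode_coeff (ts ! j) (snd (x ! j)))"
      by (rule prod.cong) (use ts in \<open>auto simp: mode_coeff_def\<close>)
    then show "?F (?neg ts) = scal (\<Prod>j<length x. mode_coeff (ts ! j) (snd (x ! j)))
       (if sum_list ts = d then hmodes l (normal_order (zip (map fst x) (?neg ts))) (fvec f) else 0)"
      using constraint[of "?neg ts"] sum_neg[of ts] ts by simp
  qed
  finally show ?thesis .
qed

text \<open>Extraction over all exponents ms of words with the letters of \<open>as\<close> and js.
  The modes sought are -t for the letters of \<open>as\<close> and 0 for those of js, and their
  product is already normally ordered.\<close>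

lemma ket_in_V_U:
  assumes as: "positive as" and bal: "weight (map fst as) + weight js = 0"
  shows "ket as js f \<in> V_U R l f"
proof -
  let ?V = "V_U R l f" and ?is = "map fst as @ js" and ?ts = "map snd as @ replicate (length js) 0"
  let ?d = "sum_list (map snd as)"
  let ?W = "\<lambda>ts. if sum_list ts = ?d then hmodes l (normal_order (zip ?is (map (\<lambda>t. - int t) ts))) (fvec f) else 0"
  have "?W ?ts \<in> ?V"
  proof (rule multi_extraction)
    show "lc.subspace ?V"
      unfolding V_U_def by (rule lc.subspace_span)
    show "set ?ts \<subseteq> {..?d}"
      using member_le_sum_list by fastforce
    show "length ?ts = length ?is" by simp
    fix ms :: "nat list" assume ms: "length ms = length ?is" "\<forall>m\<in>set ms. m \<ge> 1"
    let ?x = "zip ?is ms"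
    let ?n = "(\<Sum>j<length ?x. int (snd (?x ! j))) - int ?d - 1"
    have "Poly_Mapping.single ?x 1 \<in> V_alg"
      using ms bal by (auto simp: V_alg_def weight_count[of ?is, symmetric] dest: set_zip_rightD)
        (use weight_count[of ?is] in simp)
    then have "vmode l (Poly_Mapping.single ?x 1) ?n (fvec f) \<in> ?V"
      unfolding V_U_def by (intro lc.span_base) blast
    then have "word_mode l ?x ?n (fvec f) \<in> ?V"
      by (simp add: vmode_def)
    moreover have x: "map fst ?x = ?is"
      using ms(1) by simp
    ultimately show "(\<Sum>ts\<in>{ts. set ts \<subseteq> {..?d} \<and> length ts = length ?is}.
        scal (\<Prod>j<length ?is. mode_coeff (ts ! j) (ms ! j)) (?W ts)) \<in> ?V"
      using word_mode_fvec[of ?n ?x ?d l f, unfolded x] ms by simp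
  qed
  moreover have "normal_order (zip ?is (map (\<lambda>t. - int t) ?ts)) = neg as @ zer js"
  proof -
    have "zip ?is (map (\<lambda>t. - int t) ?ts) = neg as @ zer js"
      by (rule nth_equalityI) (auto simp: neg_def zer_def nth_append case_prod_unfold)
    moreover have "filter (\<lambda>a. snd a < 0) (neg as) = neg as" "filter (\<lambda>a. snd a > 0) (neg as) = []"
      "filter (\<lambda>a. snd a = 0) (neg as) = []" "filter (\<lambda>a. snd a < 0) (zer js) = []"
      "filter (\<lambda>a. snd a > 0) (zer js) = []" "filter (\<lambda>a. snd a = 0) (zer js) = zer js"
      using as by (force simp: neg_def zer_def filter_id_conv filter_empty_conv)+
    ultimately show ?thesis
      by (simp add: normal_order_def)
  qed
  ultimately show ?thesis
    by (simp add: hmodes_neg_zer[OF as])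
qed

section \<open>The relations of F(S)\<close>

text \<open>The copy of S behind a fixed creation word. As F(S) is a tensor product, its relations
  are the placed relations of S, which makes the action of the modes on them transparent.\<close>

definition place :: "(bool \<times> nat) list \<Rightarrow> (bool list \<times> ('m \<Rightarrow> complex) \<Rightarrow>\<^sub>0 complex) \<Rightarrow> 'm fock" where
  "place ns = lin_ext (\<lambda>(w, g). ket ns w g)"

abbreviation sket :: "bool list \<Rightarrow> ('m \<Rightarrow> complex) \<Rightarrow> (bool list \<times> ('m \<Rightarrow> complex) \<Rightarrow>\<^sub>0 complex)" where
  "sket w g \<equiv> Poly_Mapping.single (w, g) 1"

definition S_rel :: "('m::topological_space) surface \<Rightarrow> 'm chart \<Rightarrow> 'm \<Rightarrow> real^2 \<Rightarrow> real^2 \<Rightarrow> 'm set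
    \<Rightarrow> (bool list \<times> ('m \<Rightarrow> complex) \<Rightarrow>\<^sub>0 complex) set" where
  "S_rel M c p e1 e2 U =
     {sket w (\<lambda>q. a * g q + b * h q) - scal a (sket w g) - scal b (sket w h) | w a b g h.
        g \<in> C_inf M U \<and> h \<in> C_inf M U} \<union>
     {(\<Sum>v\<in>{v. length v = k}. scal (a v) (sket (w @ v) g)) - sket w h | w k X a g h.
        g \<in> C_inf M U \<and> h \<in> C_inf M U \<and>
        parallel_section M k X \<and> value_at c p e1 e2 k X a \<and> acts_to M U k X g h}"

lemma F_rel_eq:
  "F_rel M c p e1 e2 U = lc.span {place ns r | ns r. positive ns \<and> r \<in> S_rel M c p e1 e2 U}"
proof -
  have "{place ns r | ns r. positive ns \<and> r \<in> S_rel M c p e1 e2 U} =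
     {ket ns w (\<lambda>q. a * g q + b * h q) - scal a (ket ns w g) - scal b (ket ns w h) | ns w a b g h.
        (\<forall>(s,t)\<in>set ns. t \<ge> 1) \<and> g \<in> C_inf M U \<and> h \<in> C_inf M U} \<union>
     {(\<Sum>v\<in>{v. length v = k}. scal (a v) (ket ns (w @ v) g)) - ket ns w h | ns w k X a g h.
        (\<forall>(s,t)\<in>set ns. t \<ge> 1) \<and> g \<in> C_inf M U \<and> h \<in> C_inf M U \<and>
        parallel_section M k X \<and> value_at c p e1 e2 k X a \<and> acts_to M U k X g h}"
    (is "?L = ?A \<union> ?B")
  proof (intro equalityI subsetI)
    fix x assume "x \<in> ?L"
    then obtain ns r where x: "x = place ns r" and ns: "positive ns" and r: "r \<in> S_rel M c p e1 e2 U"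
      by blast
    from r consider (lin) w a b g h where "r = sket w (\<lambda>q. a * g q + b * h q) - scal a (sket w g) - scal b (sket w h)"
        "g \<in> C_inf M U" "h \<in> C_inf M U"
      | (par) w k X a g h where "r = (\<Sum>v\<in>{v. length v = k}. scal (a v) (sket (w @ v) g)) - sket w h"
        "g \<in> C_inf M U" "h \<in> C_inf M U"
        "parallel_section M k X" "value_at c p e1 e2 k X a" "acts_to M U k X g h"
      unfolding S_rel_def by blast
    then show "x \<in> ?A \<union> ?B"
    proof cases
      case lin
      then have "x = ket ns w (\<lambda>q. a * g q + b * h q) - scal a (ket ns w g) - scal b (ket ns w h)"
        by (simp add: x place_def lin_ext_simps)
      with lin ns show ?thesis by blast
    next
      case par
      then have "x = (\<Sum>v\<in>{v. length v = k}. scal (a v) (ket ns (w @ v) g)) - ket ns w h"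
        by (simp add: x place_def lin_ext_simps)
      with par ns show ?thesis by blast
    qed
  next
    fix x assume "x \<in> ?A \<union> ?B"
    then consider (lin) ns w a b g h where "positive ns" "g \<in> C_inf M U" "h \<in> C_inf M U"
        "x = ket ns w (\<lambda>q. a * g q + b * h q) - scal a (ket ns w g) - scal b (ket ns w h)"
      | (par) ns w k X a g h where "positive ns" "g \<in> C_inf M U" "h \<in> C_inf M U"
        "parallel_section M k X" "value_at c p e1 e2 k X a" "acts_to M U k X g h"
        "x = (\<Sum>v\<in>{v. length v = k}. scal (a v) (ket ns (w @ v) g)) - ket ns w h"
      by blast
    then show "x \<in> ?L"
    proof cases
      case lin
      then have "x = place ns (sket w (\<lambda>q. a * g q + b * h q) - scal a (sket w g) - scal b (sket w h))"
        by (simp add: place_def lin_ext_simps)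
      with lin(1-3) show ?thesis unfolding S_rel_def by blast
    next
      case par
      then have "x = place ns ((\<Sum>v\<in>{v. length v = k}. scal (a v) (sket (w @ v) g)) - sket w h)"
        by (simp add: place_def lin_ext_simps)
      with par(1-6) show ?thesis unfolding S_rel_def by blast
    qed
  qed
  then show ?thesis
    by (simp add: F_rel_def)
qed

definition prepend :: "bool \<Rightarrow> (bool list \<times> ('m \<Rightarrow> complex) \<Rightarrow>\<^sub>0 complex) \<Rightarrow> (bool list \<times> ('m \<Rightarrow> complex) \<Rightarrow>\<^sub>0 complex)" where
  "prepend s = lin_ext (\<lambda>(w, g). sket (s # w) g)"

text \<open>Words grow on the left while parallel sections act on the right, so the two operations
  commute.\<close>

lemma prepend_S_rel:
  assumes "r \<in> S_rel M c p e1 e2 U"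
  shows "prepend s r \<in> S_rel M c p e1 e2 U"
  using assms unfolding S_rel_def
proof (elim UnE CollectE exE conjE)
  fix w a b g h
  assume r: "r = sket w (\<lambda>q. a * g q + b * h q) - scal a (sket w g) - scal b (sket w h)"
    and gh: "g \<in> C_inf M U" "h \<in> C_inf M U"
  have "prepend s r = sket (s # w) (\<lambda>q. a * g q + b * h q) - scal a (sket (s # w) g) - scal b (sket (s # w) h)"
    by (simp add: r prepend_def lin_ext_simps)
  with gh show "prepend s r \<in> {sket w (\<lambda>q. a * g q + b * h q) - scal a (sket w g) - scal b (sket w h) | w a b g h.
        g \<in> C_inf M U \<and> h \<in> C_inf M U} \<union>
     {(\<Sum>v\<in>{v. length v = k}. scal (a v) (sket (w @ v) g)) - sket w h | w k X a g h.
        g \<in> C_inf M U \<and> h \<in> C_inf M U \<and>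
        parallel_section M k X \<and> value_at c p e1 e2 k X a \<and> acts_to M U k X g h}"
    by blast
next
  fix w k X a g h
  assume r: "r = (\<Sum>v\<in>{v. length v = k}. scal (a v) (sket (w @ v) g)) - sket w h"
    and gh: "g \<in> C_inf M U" "h \<in> C_inf M U" "parallel_section M k X" "value_at c p e1 e2 k X a" "acts_to M U k X g h"
  have "prepend s r = (\<Sum>v\<in>{v. length v = k}. scal (a v) (sket ((s # w) @ v) g)) - sket (s # w) h"
    by (simp add: r prepend_def lin_ext_simps)
  with gh show "prepend s r \<in> {sket w (\<lambda>q. a * g q + b * h q) - scal a (sket w g) - scal b (sket w h) | w a b g h.
        g \<in> C_inf M U \<and> h \<in> C_inf M U} \<union>
     {(\<Sum>v\<in>{v. length v = k}. scal (a v) (sket (w @ v) g)) - sket w h | w k X a g h.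
        g \<in> C_inf M U \<and> h \<in> C_inf M U \<and>
        parallel_section M k X \<and> value_at c p e1 e2 k X a \<and> acts_to M U k X g h}"
    by blast
qed

lemma place_modes:
  "create s t (place ns r) = place ((s, t) # ns) r"
  "zero_mode s (place ns r) = place ns (prepend s r)"
  unfolding create_def zero_mode_def place_def prepend_def lin_ext_comp
  by (simp_all add: case_prod_unfold)

text \<open>An annihilating mode acts on the creation word alone and leaves r untouched, so
  relations are mapped to combinations of relations.\<close>

lemma annihil_place_Cons:
  "annihil l s m (place ((b, n) # ns) r)
    = create b n (annihil l s m (place ns r)) + (if m = n then scal (of_nat m * hform s b * l) (place ns r) else 0)"
proof -
  have "annihil l s m (place ((b, n) # ns) r) = lin_ext (\<lambda>(w, g). create b n (annihil_ket l s m ns w g)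
     + scal (if m = n then of_nat m * hform s b * l else 0) (ket ns w g)) r"
    by (auto simp: annihil_def place_def lin_ext_comp case_prod_unfold intro!: arg_cong[where f = "\<lambda>\<phi>. lin_ext \<phi> r"])
  also have "\<dots> = create b n (annihil l s m (place ns r)) + scal (if m = n then of_nat m * hform s b * l else 0) (place ns r)"
    by (simp add: annihil_def place_def create_def lin_ext_comp lin_ext_fun_add lin_ext_fun_scal case_prod_unfold)
  finally show ?thesis by simp
qed

lemma annihil_place_Nil: "annihil l s m (place [] r) = 0"
  by (simp add: annihil_def place_def lin_ext_comp case_prod_unfold) (simp add: lin_ext_def)

section \<open>The bookkeeping model of the quotient\<close>

text \<open>The target of the model has basis (A, n): a multiset A of creation operators, which forgets their
  order, and the vector n of the T(E_p)-module with basis \<open>h_\<epsilon>(0)^|n| f\<close>. A word acts by the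
  factors of \<open>Cfactor\<close>, except that its longest balanced suffix acts on functions through E.\<close>

locale word_model =
  fixes M :: "('m::topological_space) surface" and c :: "'m chart" and p :: 'm and e1 e2 :: "real^2"
    and U :: "'m set" and f :: "'m \<Rightarrow> complex" and lam l :: complex and K :: real
    and E :: "('m \<Rightarrow> complex) \<Rightarrow> bool list \<Rightarrow> complex"
  assumes E_linear: "\<And>g h a b w. g \<in> C_inf M U \<Longrightarrow> h \<in> C_inf M U \<Longrightarrow>
      E (\<lambda>q. a * g q + b * h q) w = a * E g w + b * E h w"
    and value_unbalanced: "\<And>k X a v. parallel_section M k X \<Longrightarrow> value_at c p e1 e2 k X a \<Longrightarrow>
      length v = k \<Longrightarrow> weight v \<noteq> 0 \<Longrightarrow> a v = 0"
    and E_parallel: "\<And>k X a g h w. parallel_section M k X \<Longrightarrow> value_at c p e1 e2 k X a \<Longrightarrow>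
      g \<in> C_inf M U \<Longrightarrow> h \<in> C_inf M U \<Longrightarrow> acts_to M U k X g h \<Longrightarrow>
      (\<Sum>v\<in>{v. length v = k}. a v * E g (w @ v)) = E h w"
    and E_eigen: "\<And>w. weight w = 0 \<Longrightarrow> E f w = Cfactor lam K w * E f []"
    and E_nonzero: "E f [] \<noteq> 0"
begin

text \<open>The outermost letter is tested first, so the longest balanced suffix takes precedence
  over shorter ones.\<close>

fun coef :: "bool list \<Rightarrow> ('m \<Rightarrow> complex) \<Rightarrow> complex" where
  "coef [] g = E g []"
| "coef (s # w) g = (if weight (s # w) = 0 then E g (s # w) else step_factor lam K s (weight w) * coef w g)"

definition model :: "'m fock \<Rightarrow> ((bool \<times> nat) multiset \<times> int \<Rightarrow>\<^sub>0 complex)" where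
  "model = lin_ext (\<lambda>(ns, w, g). scal (coef w g) (Poly_Mapping.single (mset ns, weight w) 1))"

lemma model_ket: "model (ket ns w g) = scal (coef w g) (Poly_Mapping.single (mset ns, weight w) 1)"
  by (simp add: model_def)

lemma model_simps:
  "model (u + v) = model u + model v" "model (u - v) = model u - model v" "model (scal a u) = scal a (model u)"
  by (simp_all add: model_def lin_ext_simps)

text \<open>For f both branches of the second clause agree by \<open>E_eigen\<close>. Hence
  prepending a letter to a ket of f multiplies its coefficient by a scalar that depends only on the
  letter and the weight.\<close>

lemma coef_eigen: "coef w f = Cfactor lam K w * E f []"
proof (induction w)
  case (Cons s w)
  then show ?case
    using E_eigen[of "s # w"] by (cases "weight (s # w) = 0") simp_all
qed simp

lemma coef_linear:
  assumes "g \<in> C_inf M U" "h \<in> C_inf M U"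
  shows "coef w (\<lambda>q. a * g q + b * h q) = a * coef w g + b * coef w h"
  by (induction w) (simp_all add: E_linear[OF assms] algebra_simps)

text \<open>Only balanced v count. Appending one changes no weight along w, so the step factors
  persist and the longest balanced suffix of w is merely extended by v, where
  \<open>E_parallel\<close> applies.\<close>

lemma coef_parallel:
  assumes X: "parallel_section M k X" "value_at c p e1 e2 k X a"
    and gh: "g \<in> C_inf M U" "h \<in> C_inf M U" "acts_to M U k X g h"
  shows "(\<Sum>v\<in>{v. length v = k}. a v * coef (w @ v) g) = coef w h"
proof (induction w)
  case Nil
  have "a v * coef v g = a v * E g v" if "length v = k" for v
    using value_unbalanced[OF X that] by (cases v) auto
  then have "(\<Sum>v\<in>{v. length v = k}. a v * coef v g) = (\<Sum>v\<in>{v. length v = k}. a v * E g v)"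
    by (intro sum.cong) auto
  then show ?case
    using E_parallel[OF X gh, of "[]"] by simp
next
  case (Cons s w)
  have "a v * coef ((s # w) @ v) g = a v * (if weight (s # w) = 0 then E g ((s # w) @ v)
      else step_factor lam K s (weight w) * coef (w @ v) g)" if "length v = k" for v
    using value_unbalanced[OF X that] by (cases "weight v = 0") auto
  then have "(\<Sum>v\<in>{v. length v = k}. a v * coef ((s # w) @ v) g)
      = (\<Sum>v\<in>{v. length v = k}. a v * (if weight (s # w) = 0 then E g ((s # w) @ v)
          else step_factor lam K s (weight w) * coef (w @ v) g))"
    by (intro sum.cong) auto
  also have "\<dots> = coef (s # w) h"
  proof (cases "weight (s # w) = 0")
    case True
    then show ?thesis
      using E_parallel[OF X gh, of "s # w"] by simp
  next
    case False
    then have "(\<Sum>v\<in>{v. length v = k}. a v * (if weight (s # w) = 0 then E g ((s # w) @ v)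
          else step_factor lam K s (weight w) * coef (w @ v) g))
        = step_factor lam K s (weight w) * (\<Sum>v\<in>{v. length v = k}. a v * coef (w @ v) g)"
      by (simp add: sum_distrib_left mult_ac)
    then show ?thesis
      using False Cons by simp
  qed
  finally show ?case .
qed

lemma model_place:
  assumes "r \<in> S_rel M c p e1 e2 U"
  shows "model (place ns r) = 0"
  using assms unfolding S_rel_def
proof (elim UnE CollectE exE conjE)
  fix w a b g h
  assume r: "r = sket w (\<lambda>q. a * g q + b * h q) - scal a (sket w g) - scal b (sket w h)"
    and gh: "g \<in> C_inf M U" "h \<in> C_inf M U"
  show "model (place ns r) = 0"
    by (simp add: r place_def lin_ext_simps model_def coef_linear[OF gh] lc.scale_left_distrib lc.scale_scale)
next
  fix w k X a g h
  assume r: "r = (\<Sum>v\<in>{v. length v = k}. scal (a v) (sket (w @ v) g)) - sket w h"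
    and gh: "g \<in> C_inf M U" "h \<in> C_inf M U" and X: "parallel_section M k X" "value_at c p e1 e2 k X a"
    and act: "acts_to M U k X g h"
  let ?b = "\<lambda>n. Poly_Mapping.single (mset ns, n) 1"
  have "scal (a v * coef (w @ v) g) (?b (weight w + weight v)) = scal (a v * coef (w @ v) g) (?b (weight w))"
    if "length v = k" for v
    using value_unbalanced[OF X that] by (cases "weight v = 0") auto
  then have "(\<Sum>v\<in>{v. length v = k}. scal (a v * coef (w @ v) g) (?b (weight w + weight v)))
      = (\<Sum>v\<in>{v. length v = k}. scal (a v * coef (w @ v) g) (?b (weight w)))"
    by (intro sum.cong) auto
  also have "\<dots> = scal (coef w h) (?b (weight w))"
    by (simp add: coef_parallel[OF X gh act] flip: lc.scale_sum_left)
  finally show "model (place ns r) = 0"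
    by (simp add: r place_def lin_ext_simps model_def lc.scale_scale)
qed

text \<open>The charge \<open>\<tau>\<close> is the total sign of all letters. \<open>V_U\<close> is
  the case of charge 0; the others are there because a single mode shifts the charge. Functions
  other than f occur only inside relations.\<close>

definition graded :: "int \<Rightarrow> 'm fock set" where
  "graded \<tau> = lc.span ({place ns r | ns r. positive ns \<and> r \<in> S_rel M c p e1 e2 U} \<union>
     {ket ns w f | ns w. positive ns \<and> weight (map fst ns) + weight w = \<tau>})"

lemma subspace_graded: "lc.subspace (graded \<tau>)"
  unfolding graded_def by (rule lc.subspace_span)

lemma place_graded: "positive ns \<Longrightarrow> r \<in> S_rel M c p e1 e2 U \<Longrightarrow> place ns r \<in> graded \<tau>"
  unfolding graded_def by (rule lc.span_base) blast

lemma ket_graded: "positive ns \<Longrightarrow> weight (map fst ns) + weight w = \<tau> \<Longrightarrow> ket ns w f \<in> graded \<tau>"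
  unfolding graded_def by (rule lc.span_base) blast

lemma graded_induct [consumes 1, case_names place ket zero step]:
  assumes "u \<in> graded \<tau>"
    and place: "\<And>ns r. positive ns \<Longrightarrow> r \<in> S_rel M c p e1 e2 U \<Longrightarrow> P (place ns r)"
    and ket: "\<And>ns w. positive ns \<Longrightarrow> weight (map fst ns) + weight w = \<tau> \<Longrightarrow> P (ket ns w f)"
    and zero: "P 0" and step: "\<And>a u v. P u \<Longrightarrow> P v \<Longrightarrow> P (scal a u + v)"
  shows "P u"
  using assms(1) unfolding graded_def
proof (induction rule: lc.span_induct_alt)
  case (step a u v)
  then have "P u" using place ket by blast
  then show ?case using step assms(5) by blast
qed (rule zero)

lemma create_graded:
  assumes "u \<in> graded \<tau>" "t \<ge> 1"
  shows "create s t u \<in> graded (\<tau> + sg s)"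
  using assms(1)
proof (induction rule: graded_induct)
  case (place ns r)
  then show ?case using assms(2) by (simp add: place_modes place_graded)
next
  case (ket ns w)
  then show ?case using assms(2) by (simp add: ket_graded)
next
  case zero
  then show ?case by (simp add: create_def lc.subspace_0[OF subspace_graded])
next
  case (step a u v)
  then show ?case
    by (simp add: create_def lin_ext_simps lc.subspace_add[OF subspace_graded] lc.subspace_scale[OF subspace_graded])
qed

lemma zero_mode_graded:
  assumes "u \<in> graded \<tau>"
  shows "zero_mode s u \<in> graded (\<tau> + sg s)"
  using assms
proof (induction rule: graded_induct)
  case (place ns r)
  then show ?case by (simp add: place_modes place_graded prepend_S_rel)
next
  case (ket ns w)
  then show ?case by (simp add: ket_graded)
next
  case zero
  then show ?case by (simp add: zero_mode_def lc.subspace_0[OF subspace_graded])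
next
  case (step a u v)
  then show ?case
    by (simp add: zero_mode_def lin_ext_simps lc.subspace_add[OF subspace_graded] lc.subspace_scale[OF subspace_graded])
qed

text \<open>The form vanishes on equal signs, so contraction removes a letter of the opposite sign;
  losing it changes the charge by \<open>sg s\<close>, just as adding s would.\<close>

lemma annihil_graded:
  assumes "u \<in> graded \<tau>"
  shows "annihil l s m u \<in> graded (\<tau> + sg s)"
  using assms
proof (induction rule: graded_induct)
  case (place ns r)
  then show ?case
  proof (induction ns arbitrary: \<tau>)
    case Nil
    then show ?case by (simp add: annihil_place_Nil lc.subspace_0[OF subspace_graded])
  next
    case (Cons bn ns)
    obtain b n where bn: "bn = (b, n)" by fastforce
    have "annihil l s m (place ns r) \<in> graded (\<tau> - sg b + sg s)"
      using Cons by auto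
    then have "create b n (annihil l s m (place ns r)) \<in> graded (\<tau> + sg s)"
      using create_graded[of _ "\<tau> - sg b + sg s" n b] Cons.prems by (auto simp: bn)
    moreover have "place ns r \<in> graded (\<tau> + sg s)"
      using Cons.prems by (intro place_graded) auto
    ultimately show ?case
      by (simp add: bn annihil_place_Cons lc.subspace_add[OF subspace_graded]
          lc.subspace_scale[OF subspace_graded] lc.subspace_0[OF subspace_graded])
  qed
next
  case (ket ns w)
  then show ?case
  proof (induction ns arbitrary: \<tau>)
    case Nil
    then show ?case by (simp add: lc.subspace_0[OF subspace_graded])
  next
    case (Cons bn ns)
    obtain b n where bn: "bn = (b, n)" by fastforce
    have "annihil l s m (ket ns w f) \<in> graded (\<tau> - sg b + sg s)"
      using Cons by (auto simp: bn)
    then have "create b n (annihil_ket l s m ns w f) \<in> graded (\<tau> + sg s)"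
      using create_graded[of _ "\<tau> - sg b + sg s" n b] Cons.prems by (auto simp: bn)
    moreover have "scal (of_nat m * hform s b * l) (ket ns w f) \<in> graded (\<tau> + sg s)"
    proof (cases "s = b")
      case True
      then show ?thesis by (simp add: hform_def lc.subspace_0[OF subspace_graded])
    next
      case False
      then have "sg b = - sg s"
        by (cases s; cases b) auto
      then have "ket ns w f \<in> graded (\<tau> + sg s)"
        using Cons.prems by (intro ket_graded) (auto simp: bn)
      then show ?thesis by (rule lc.subspace_scale[OF subspace_graded])
    qed
    ultimately show ?case
      by (cases "m = n") (simp_all add: bn lc.subspace_add[OF subspace_graded])
  qed
next
  case zero
  then show ?case by (simp add: annihil_def lc.subspace_0[OF subspace_graded])
next
  case (step a u v)
  then show ?case
    by (simp add: annihil_def lin_ext_simps lc.subspace_add[OF subspace_graded] lc.subspace_scale[OF subspace_graded])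
qed

lemma hmode_graded: "u \<in> graded \<tau> \<Longrightarrow> hmode l s n u \<in> graded (\<tau> + sg s)"
  by (rule hmode_cases[of l s n u]) (auto simp: create_graded zero_mode_graded annihil_graded)

section \<open>Compatibility of the model with the modes\<close>

lemma model_create: "model (create s t u) = lin_ext (\<lambda>(A, n). Poly_Mapping.single (add_mset (s, t) A, n) 1) (model u)"
  unfolding model_def create_def
  by (simp add: lin_ext_comp case_prod_unfold lin_ext_scal)

text \<open>For a general function, prepending a letter may complete a balanced word, where
  \<open>coef\<close> switches to E and no step factor governs the result. In \<open>graded\<close>
  only relations occur, with 0 on both sides, and kets of f, for which \<open>coef_eigen\<close>
  yields the step factor.\<close>

lemma model_zero_mode:
  assumes "u \<in> graded \<tau>"
  shows "model (zero_mode s u)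
    = lin_ext (\<lambda>(A, n). scal (step_factor lam K s n) (Poly_Mapping.single (A, n + sg s) 1)) (model u)"
  using assms
proof (induction rule: graded_induct)
  case (place ns r)
  then show ?case by (simp add: place_modes model_place prepend_S_rel)
next
  case (ket ns w)
  then show ?case
    by (simp add: model_ket coef_eigen lin_ext_scal lc.scale_scale add.commute mult_ac del: coef.simps)
next
  case zero
  then show ?case by (simp add: model_def zero_mode_def)
next
  case (step a u v)
  then show ?case by (simp add: model_def zero_mode_def lin_ext_simps)
qed

text \<open>With multisets read as monomials, this is 2ml times the partial derivative in the
  variable indexed by m and the opposite sign; the 2 is (h_+,h_-).\<close>

definition remove :: "bool \<Rightarrow> nat \<Rightarrow> ((bool \<times> nat) multiset \<times> int \<Rightarrow>\<^sub>0 complex) \<Rightarrow> ((bool \<times> nat) multiset \<times> int \<Rightarrow>\<^sub>0 complex)" where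
  "remove s m = lin_ext (\<lambda>(A, n). scal (of_nat (count A (\<not> s, m)) * (of_nat m * 2 * l))
     (Poly_Mapping.single (A - {#(\<not> s, m)#}, n) 1))"

lemma model_annihil: "model (annihil l s m u) = remove s m (model u)"
proof -
  have "model (annihil_ket l s m ns w g) = remove s m (model (ket ns w g))" for ns w g
  proof (induction ns)
    case Nil
    then show ?case by (simp add: model_def remove_def lin_ext_scal)
  next
    case (Cons bn ns)
    obtain b n where bn: "bn = (b, n)" by fastforce
    show ?case
    proof (cases "b = (\<not> s) \<and> n = m")
      case True
      let ?x = "(\<not> s, m)" and ?S = "mset ns"
      let ?b = "\<lambda>A. Poly_Mapping.single (A, weight w) (1::complex)" and ?k = "of_nat (count ?S ?x) :: complex"
      let ?q = "coef w g * (of_nat m * 2 * l)"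
      have "model (annihil_ket l s m (bn # ns) w g)
          = model (create (\<not> s) m (annihil_ket l s m ns w g)) + scal (of_nat m * 2 * l) (model (ket ns w g))"
        using True by (simp add: bn hform_def model_simps)
      also have "\<dots> = scal ?q (scal ?k (?b (add_mset ?x (?S - {#?x#}))) + ?b ?S)"
        by (simp add: model_create Cons model_ket remove_def lin_ext_scal lc.scale_scale lc.scale_right_distrib mult_ac)
      \<comment> \<open>If the letter does not occur, the scalar is 0; otherwise removing it and
        adding it back restores the multiset.\<close>
      also have "scal ?k (?b (add_mset ?x (?S - {#?x#}))) = scal ?k (?b ?S)"
        by (cases "?x \<in># ?S") (auto simp: not_in_iff)
      also have "scal ?q (scal ?k (?b ?S) + ?b ?S) = remove s m (model (ket (bn # ns) w g))"
        using True by (simp add: bn model_ket remove_def lin_ext_scal lc.scale_scale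
            lc.scale_left_distrib lc.scale_right_distrib algebra_simps)
      finally show ?thesis .
    next
      case False
      then have "hform s b = 0 \<or> m \<noteq> n"
        by (cases s; cases b) (auto simp: hform_def)
      then have "model (annihil_ket l s m (bn # ns) w g) = model (create b n (annihil_ket l s m ns w g))"
        by (auto simp: bn)
      also have "\<dots> = remove s m (model (ket (bn # ns) w g))"
        using False Cons
        by (auto simp: bn model_create model_ket lin_ext_simps remove_def lc.scale_scale)
      finally show ?thesis .
    qed
  qed
  then show ?thesis
    unfolding model_def annihil_def remove_def
    by (intro lin_ext_eq_everywhere) (auto simp: case_prod_unfold)
qed

section \<open>The submodule of vectors with model 0\<close>

definition kernel :: "int \<Rightarrow> 'm fock set" where
  "kernel \<tau> = {u \<in> graded \<tau>. model u = 0}"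

lemma subspace_kernel: "lc.subspace (kernel \<tau>)"
  by (rule lc.subspaceI)
    (auto simp: kernel_def model_def lin_ext_simps lc.subspace_0 lc.subspace_add lc.subspace_scale subspace_graded)

text \<open>On \<open>graded\<close> every single mode descends to a linear map of the target, so a
  vector with model 0 stays one.\<close>

lemma hmode_kernel: "u \<in> kernel \<tau> \<Longrightarrow> hmode l s n u \<in> kernel (\<tau> + sg s)"
  unfolding kernel_def
  by (rule hmode_cases[of l s n u])
    (auto simp: create_graded zero_mode_graded annihil_graded model_create model_zero_mode model_annihil remove_def)

lemma F_rel_kernel: "F_rel M c p e1 e2 U \<subseteq> kernel \<tau>"
  unfolding F_rel_eq
  by (rule lc.span_minimal[OF _ subspace_kernel]) (auto simp: kernel_def place_graded model_place)

text \<open>One inclusion expresses that balanced words preserve the charge, the other is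
  \<open>ket_in_V_U\<close>.\<close>

lemma V_U_eq: "V_U (F_rel M c p e1 e2 U) l f = graded 0"
proof
  show "V_U (F_rel M c p e1 e2 U) l f \<subseteq> graded 0"
    unfolding V_U_def
  proof (rule lc.span_minimal[OF _ subspace_graded])
    have "vmode l v n (fvec f) \<in> graded 0" if "v \<in> V_alg" for v n
      by (rule vmode_in_graded_subspace[OF subspace_graded hmode_graded that]) (assumption, rule ket_graded, simp_all)
    then show "F_rel M c p e1 e2 U \<union> {vmode l v n (fvec f) |v n. v \<in> V_alg} \<subseteq> graded 0"
      using F_rel_kernel[of 0] by (auto simp: kernel_def)
  qed
  show "graded 0 \<subseteq> V_U (F_rel M c p e1 e2 U) l f"
    unfolding graded_def
  proof (rule lc.span_minimal)
    show "lc.subspace (V_U (F_rel M c p e1 e2 U) l f)"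
      unfolding V_U_def by (rule lc.subspace_span)
    have "place ns r \<in> V_U (F_rel M c p e1 e2 U) l f" if "positive ns" "r \<in> S_rel M c p e1 e2 U" for ns r
    proof -
      have "place ns r \<in> F_rel M c p e1 e2 U"
        unfolding F_rel_eq by (rule lc.span_base) (use that in blast)
      then show ?thesis
        unfolding V_U_def by (intro lc.span_base) blast
    qed
    then show "{place ns r | ns r. positive ns \<and> r \<in> S_rel M c p e1 e2 U} \<union>
        {ket ns w f | ns w. positive ns \<and> weight (map fst ns) + weight w = 0} \<subseteq> V_U (F_rel M c p e1 e2 U) l f"
      using ket_in_V_U by blast
  qed
qed

lemma wt_part_lin_ext: "wt_part d u = lin_ext (\<lambda>x. if wt x = d then Poly_Mapping.single x 1 else 0) u"
proof -
  have "Poly_Mapping.single x (Poly_Mapping.lookup u x) = scal (Poly_Mapping.lookup u x) (Poly_Mapping.single x 1)" for x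
    by (rule poly_mapping_eqI) (simp add: lookup_single when_def)
  then show ?thesis
    by (simp add: wt_part_def lin_ext_def if_distrib[of "scal _"] sum.inter_filter cong: if_cong)
qed

lemma wt_part_graded:
  assumes "u \<in> graded \<tau>"
  shows "wt_part d u \<in> graded \<tau>"
  using assms
proof (induction rule: graded_induct)
  case (place ns r)
  have "wt_part d (place ns r) = (if sum_list (map snd ns) = d then place ns r else 0)"
    by (simp add: wt_part_lin_ext place_def lin_ext_comp case_prod_unfold wt_def) (simp add: lin_ext_def)
  with place show ?case by (simp add: place_graded lc.subspace_0[OF subspace_graded])
next
  case (ket ns w)
  then show ?case by (simp add: wt_part_lin_ext ket_graded lc.subspace_0[OF subspace_graded])
next
  case zero
  then show ?case by (simp add: wt_part_lin_ext lc.subspace_0[OF subspace_graded])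
next
  case (step a u v)
  then show ?case
    by (simp add: wt_part_lin_ext lin_ext_simps lc.subspace_add[OF subspace_graded] lc.subspace_scale[OF subspace_graded])
qed

text \<open>The weight of a ket depends only on its multiset of creation operators, so the grading
  descends to the target.\<close>

lemma model_wt_part:
  "model (wt_part d u) = lin_ext (\<lambda>(A, n). if sum_mset (image_mset snd A) = d then Poly_Mapping.single (A, n) 1 else 0) (model u)"
  unfolding model_def wt_part_lin_ext
  by (intro lin_ext_eq_everywhere)
    (auto simp: lin_ext_scal wt_def simp flip: sum_mset_sum_list mset_map)

lemma submodule_kernel: "submodule_VU (F_rel M c p e1 e2 U) l f (kernel 0)"
  unfolding submodule_VU_def V_U_eq
proof (intro conjI ballI allI)
  show "lc.subspace (kernel 0)" by (rule subspace_kernel)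
  show "F_rel M c p e1 e2 U \<subseteq> kernel 0" by (rule F_rel_kernel)
  show "kernel 0 \<subseteq> graded 0" by (auto simp: kernel_def)
  show "wt_part d u \<in> kernel 0" if "u \<in> kernel 0" for u d
    using that by (simp add: kernel_def wt_part_graded model_wt_part)
  show "vmode l v n u \<in> kernel 0" if "v \<in> V_alg" "u \<in> kernel 0" for v n u
    by (rule vmode_in_graded_subspace[OF subspace_kernel hmode_kernel that])
qed

lemma model_eigen_ket:
  "model (ket ns w f) = scal (Cfactor lam K w * E f []) (Poly_Mapping.single (mset ns, weight w) 1)"
  by (simp add: model_ket coef_eigen)

text \<open>Equal letters only lead away from weight 0. Hence canonical words keep the nonzero
  coefficient \<open>E f []\<close>.\<close>

lemma Cfactor_replicate: "Cfactor lam K (replicate n s) = 1"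
  by (induction n) (auto simp: step_factor_def sg_def)

lemma gens1_kernel: "gens1 l lam K f \<subseteq> kernel 0"
proof
  fix x assume "x \<in> gens1 l lam K f"
  then obtain as js where x: "x = hmodes l (neg as @ zer js) (fvec f)
        - scal (Cfactor lam K js) (hmodes l (neg as @ zer (canonical (weight js))) (fvec f))"
    and as: "positive as" and bal: "weight (map fst as @ js) = 0"
    unfolding gens1_def by blast
  have x: "x = ket as js f - scal (Cfactor lam K js) (ket as (canonical (weight js)) f)"
    unfolding x hmodes_neg_zer[OF as] ..
  have "x \<in> graded 0"
    unfolding x using as bal
    by (intro lc.subspace_diff lc.subspace_scale subspace_graded ket_graded) (simp_all only: weight_canonical map_append sum_list_append)
  moreover have "model x = 0"
  proof -
    have "model x = model (ket as js f) - scal (Cfactor lam K js) (model (ket as (canonical (weight js)) f))"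
      unfolding x model_simps ..
    then show ?thesis
      unfolding model_eigen_ket weight_canonical by (simp only: Cfactor_replicate lc.scale_scale mult_1 diff_self)
  qed
  ultimately show "x \<in> kernel 0"
    by (simp add: kernel_def)
qed

lemma gens2_kernel: "gens2 l f \<subseteq> kernel 0"
proof
  fix x assume "x \<in> gens2 l f"
  then obtain as js \<tau> where x: "x = hmodes l (neg as @ zer js) (fvec f)
        - hmodes l (neg (permute_list \<tau> as) @ zer js) (fvec f)"
    and as: "positive as" and bal: "weight (map fst as @ js) = 0" and \<tau>: "\<tau> permutes {..<length as}"
    unfolding gens2_def permute_list_def by blast
  have m: "mset (permute_list \<tau> as) = mset as"
    by (rule mset_permute_list[OF \<tau>])
  then have "set (permute_list \<tau> as) = set as"
    by (metis set_mset_mset)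
  then have as': "positive (permute_list \<tau> as)"
    using as by simp
  have "mset (map sg (map fst (permute_list \<tau> as))) = mset (map sg (map fst as))"
    by (simp only: mset_map m)
  then have wt: "weight (map fst (permute_list \<tau> as)) = weight (map fst as)"
    by (metis sum_mset_sum_list)
  have x: "x = ket as js f - ket (permute_list \<tau> as) js f"
    unfolding x hmodes_neg_zer[OF as] hmodes_neg_zer[OF as'] ..
  have "x \<in> graded 0"
    unfolding x using as as' bal wt
    by (intro lc.subspace_diff subspace_graded ket_graded) simp_all
  moreover have "model x = 0"
  proof -
    have "model x = model (ket as js f) - model (ket (permute_list \<tau> as) js f)"
      unfolding x model_simps ..
    then show ?thesis
      unfolding model_eigen_ket m by simp
  qed
  ultimately show "x \<in> kernel 0"
    by (simp add: kernel_def)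
qed

lemma kernel2_subset: "kernel2 (F_rel M c p e1 e2 U) l lam K f \<subseteq> kernel 0"
  unfolding kernel2_def kernel1_def gen_submodule_def
  using submodule_kernel gens1_kernel gens2_kernel by blast

section \<open>The basis\<close>

lemma partition_list_unique:
  assumes "partition_list ts" "partition_list ts'" "mset ts = mset ts'"
  shows "ts = ts'"
proof -
  have sorted: "sorted (rev ts)" "sorted (rev ts')"
    using assms(1,2) by (simp_all add: partition_list_def sorted_wrt_rev)
  have "sort (rev ts') = rev ts" "sort (rev ts') = rev ts'"
    by (rule properties_for_sort; use sorted assms(3) in simp)+
  then show ?thesis by simp
qed

definition index :: "bool \<Rightarrow> nat list \<Rightarrow> nat list \<Rightarrow> nat \<Rightarrow> bool" where
  "index s ts ts' z \<longleftrightarrow>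
     partition_list ts \<and> partition_list ts' \<and> length ts = length ts' + z \<and> (s \<or> z > 0)"

definition word :: "bool \<Rightarrow> nat list \<Rightarrow> nat list \<Rightarrow> (bool \<times> nat) list" where
  "word s ts ts' = map (Pair s) ts @ map (Pair (\<not> s)) ts'"

definition basis :: "'m fock set" where
  "basis = {ket (word s ts ts') (replicate z (\<not> s)) f | s ts ts' z. index s ts ts' z}"

lemma word_positive: "index s ts ts' z \<Longrightarrow> positive (word s ts ts')"
  by (auto simp: index_def word_def partition_list_def)

lemma word_weight:
  "weight (map fst (word s ts ts')) = sg s * (int (length ts) - int (length ts'))"
  by (cases s) (simp_all add: word_def o_def map_replicate_const)

text \<open>The letters of each sign determine one partition, and z is the difference of the two
  lengths.\<close>

lemma word_inject:
  assumes "index s ts ts' z" "index r us us' y" "mset (word s ts ts') = mset (word r us us')"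
  shows "s = r \<and> ts = us \<and> ts' = us' \<and> z = y"
proof -
  define part where "part b A = image_mset snd (filter_mset (\<lambda>x. fst x = b) A)" for b and A :: "(bool \<times> nat) multiset"
  have part: "part b (mset (word s ts ts')) = (if b = s then mset ts else mset ts')" for b s ts ts'
    by (auto simp: part_def word_def filter_mset_image_mset o_def multiset.map_comp simp flip: mset_map mset_filter)
  have eq: "(if b = s then mset ts else mset ts') = (if b = r then mset us else mset us')" for b
    using assms(3) part[of b s ts ts'] part[of b r us us'] by simp
  show ?thesis
  proof (cases "s = r")
    case True
    then have "mset ts = mset us" "mset ts' = mset us'"
      using eq[of s] eq[of "\<not> s"] by auto
    then show ?thesis
      using True assms(1,2) partition_list_unique[of ts us] partition_list_unique[of ts' us']
      by (auto simp: index_def)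
  next
    \<comment> \<open>Opposite signs exchange the two partitions, so each is at least as long as the
      other. Then z and y are 0, and both signs would have to be \<open>True\<close>.\<close>
    case False
    then have "mset ts = mset us'" "mset ts' = mset us"
      using eq[of s] eq[of r] by auto
    then have "length ts = length us'" "length ts' = length us"
      by (metis size_mset)+
    then show ?thesis
      using False assms(1,2) by (auto simp: index_def)
  qed
qed

lemma basis_vec_ket:
  assumes "partition_list ts" "partition_list ts'"
  shows "basis_vec l f s ts ts' z = ket (word s ts ts') (replicate z (\<not> s)) f"
proof -
  have "positive (word s ts ts')"
    using assms by (auto simp: word_def partition_list_def)
  moreover have "neg (map (Pair s) ts) @ neg (map (Pair (\<not> s)) ts') @ zer (replicate z (\<not> s))
      = neg (word s ts ts') @ zer (replicate z (\<not> s))"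
    by (simp add: neg_def word_def)
  ultimately show ?thesis
    by (simp only: basis_vec_def hmodes_neg_zer)
qed

lemma basis_vec_in_basis:
  assumes "index s ts ts' z"
  shows "basis_vec l f s ts ts' z \<in> basis"
proof -
  have "basis_vec l f s ts ts' z = ket (word s ts ts') (replicate z (\<not> s)) f"
    using assms by (intro basis_vec_ket) (simp_all add: index_def)
  with assms show ?thesis
    unfolding basis_def by blast
qed

lemma basis_eq:
  "{basis_vec l f True ts ts' 0 | r ts ts'.
      even r \<and> length ts = r div 2 \<and> length ts' = r div 2 \<and> partition_list ts \<and> partition_list ts'} \<union>
   {basis_vec l f True ts ts' (r - k) | r k ts ts'.
      even r \<and> r div 2 \<le> k \<and> k < r \<and> length ts = r div 2 \<and> length ts' = k - r div 2 \<and>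
      partition_list ts \<and> partition_list ts'} \<union>
   {basis_vec l f False ts ts' (r - k) | r k ts ts'.
      even r \<and> r div 2 \<le> k \<and> k < r \<and> length ts = r div 2 \<and> length ts' = k - r div 2 \<and>
      partition_list ts \<and> partition_list ts'} = basis" (is "?A \<union> ?B True \<union> ?B False = _")
proof (intro equalityI subsetI)
  fix x assume "x \<in> ?A \<union> ?B True \<union> ?B False"
  then consider (zero) r ts ts' where "x = basis_vec l f True ts ts' 0" "even r" "length ts = r div 2"
      "length ts' = r div 2" "partition_list ts" "partition_list ts'"
    | (pos) s r k ts ts' where "x = basis_vec l f s ts ts' (r - k)" "even r" "r div 2 \<le> k" "k < r"
      "length ts = r div 2" "length ts' = k - r div 2" "partition_list ts" "partition_list ts'"
    by blast
  then show "x \<in> basis"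
  proof cases
    case zero
    then have "index True ts ts' 0" by (simp add: index_def)
    with zero show ?thesis by (simp add: basis_vec_in_basis)
  next
    case pos
    then have "index s ts ts' (r - k)" by (auto simp: index_def elim!: evenE)
    with pos show ?thesis by (simp add: basis_vec_in_basis)
  qed
next
  fix x assume "x \<in> basis"
  then obtain s ts ts' z where x: "x = ket (word s ts ts') (replicate z (\<not> s)) f" and i: "index s ts ts' z"
    unfolding basis_def by blast
  have x: "x = basis_vec l f s ts ts' z"
    using x i basis_vec_ket by (simp add: index_def)
  show "x \<in> ?A \<union> ?B True \<union> ?B False"
  proof (cases "z = 0")
    case True
    then have "x = basis_vec l f True ts ts' 0 \<and> even (2 * length ts) \<and> length ts = (2 * length ts) div 2 \<and>
        length ts' = (2 * length ts) div 2 \<and> partition_list ts \<and> partition_list ts'"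
      using i x by (simp add: index_def)
    then show ?thesis by blast
  next
    case False
    \<comment> \<open>r counts all letters and k the creation operators; by balance
      \<open>length ts\<close> is half of r.\<close>
    define r k where "r = 2 * length ts" and "k = length ts + length ts'"
    have "x = basis_vec l f s ts ts' (r - k) \<and> even r \<and> r div 2 \<le> k \<and> k < r \<and> length ts = r div 2 \<and>
        length ts' = k - r div 2 \<and> partition_list ts \<and> partition_list ts'"
      using i x False by (simp add: index_def r_def k_def)
    then have "x \<in> ?B s" by blast
    then show ?thesis by (cases s) simp_all
  qed
qed

text \<open>The multiset alone tells the listed vectors apart, so each of them owns a coordinate of
  the target.\<close>

lemma basis_separated:
  assumes "b \<in> basis"
  shows "\<exists>k. \<forall>b'\<in>basis. Poly_Mapping.lookup (model b') k = (if b' = b then E f [] else 0)"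
proof -
  obtain s ts ts' z where b: "b = ket (word s ts ts') (replicate z (\<not> s)) f" and i: "index s ts ts' z"
    using assms unfolding basis_def by blast
  let ?k = "(mset (word s ts ts'), weight (replicate z (\<not> s)))"
  have "Poly_Mapping.lookup (model b') ?k = (if b' = b then E f [] else 0)" if basis: "b' \<in> basis" for b'
  proof -
    obtain r us us' y where b': "b' = ket (word r us us') (replicate y (\<not> r)) f" and j: "index r us us' y"
      using basis unfolding basis_def by blast
    have m: "model b' = scal (E f []) (Poly_Mapping.single (mset (word r us us'), weight (replicate y (\<not> r))) 1)"
      unfolding b' model_eigen_ket Cfactor_replicate by simp
    show ?thesis
    proof (cases "mset (word s ts ts') = mset (word r us us')")
      case True
      then have "s = r \<and> ts = us \<and> ts' = us' \<and> z = y"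
        by (rule word_inject[OF i j])
      then show ?thesis
        unfolding m by (simp add: b b')
    next
      case False
      then have "b' \<noteq> b"
        unfolding b b' by (metis lookup_single_eq lookup_single_not_eq prod.inject zero_neq_one)
      then show ?thesis
        unfolding m using False by (simp add: lookup_single when_def)
    qed
  qed
  then show ?thesis by blast
qed

section \<open>Spanning modulo the relations\<close>

lemma subspace_kernel2: "lc.subspace (kernel2 R l lam K f)"
  unfolding kernel2_def gen_submodule_def by (rule lc.subspace_Inter) (auto simp: submodule_VU_def)

lemma subset_kernel2: "R \<subseteq> kernel2 R l lam K f" "gens1 l lam K f \<subseteq> kernel2 R l lam K f"
  "gens2 l f \<subseteq> kernel2 R l lam K f"
  unfolding kernel2_def kernel1_def gen_submodule_def by (auto simp: submodule_VU_def)

text \<open>One relation of \<open>gens1\<close> straightens the zero modes into a canonical word,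
  then one of \<open>gens2\<close> sorts the creation operators.\<close>

lemma ket_in_basis_span:
  assumes as: "positive as" and bal: "weight (map fst as) + weight js = 0"
  shows "ket as js f \<in> lc.span (basis \<union> kernel2 R l lam K f)"
proof -
  let ?S = "lc.span (basis \<union> kernel2 R l lam K f)"
  \<comment> \<open>The remaining zero modes carry the sign opposite to s; weight 0 yields s =
    \<open>True\<close>, as \<open>index\<close> demands.\<close>
  define n s where "n = weight js" and "s = (\<not> weight js > 0)"
  define part where "part b = rev (sort (map snd (filter (\<lambda>x. fst x = b) as)))" for b
  let ?w = "word s (part s) (part (\<not> s))"
  have part: "partition_list (part b)" for b
    using as by (auto simp: part_def partition_list_def sorted_wrt_rev)
  have "mset (map (Pair b) (part b)) = filter_mset (\<lambda>x. fst x = b) (mset as)" for b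
  proof -
    have "map (Pair b) (map snd (filter (\<lambda>x. fst x = b) as)) = filter (\<lambda>x. fst x = b) as"
      by (induction as) auto
    then show ?thesis
      by (metis mset_filter mset_map mset_rev mset_sort part_def)
  qed
  then have m: "mset ?w = mset as"
    by (simp add: word_def)
  have "mset (map sg (map fst ?w)) = mset (map sg (map fst as))"
    by (simp only: mset_map m)
  then have "weight (map fst ?w) = - n"
    using bal unfolding n_def by (metis sum_mset_sum_list add_eq_0_iff2)
  then have len: "sg s * (int (length (part s)) - int (length (part (\<not> s)))) = - n"
    by (simp only: word_weight)
  then have i: "index s (part s) (part (\<not> s)) (nat \<bar>n\<bar>)"
    using part by (cases s) (auto simp: index_def s_def n_def)
  have can: "canonical n = replicate (nat \<bar>n\<bar>) (\<not> s)"
    by (simp add: s_def n_def)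
  obtain \<tau> where \<tau>: "\<tau> permutes {..<length as}" "permute_list \<tau> as = ?w"
    using mset_eq_permutation[OF m] by blast
  have "ket as js f - scal (Cfactor lam K js) (ket as (canonical n) f) \<in> gens1 l lam K f"
  proof -
    have "weight (map fst as @ js) = 0"
      using bal by simp
    then show ?thesis
      unfolding gens1_def hmodes_neg_zer[OF as, where l = l, symmetric] n_def using as by blast
  qed
  then have 1: "ket as js f - scal (Cfactor lam K js) (ket as (canonical n) f) \<in> ?S"
    using subset_kernel2(2) lc.span_base by blast
  have "ket as (canonical n) f - ket ?w (canonical n) f \<in> gens2 l f"
  proof -
    have "weight (map fst as @ canonical n) = 0"
      using bal by (simp only: map_append sum_list_append weight_canonical n_def)
    moreover have w: "?w = map (\<lambda>q. as ! \<tau> q) [0..<length as]"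
      using \<tau>(2) by (simp add: permute_list_def)
    ultimately show ?thesis
      unfolding gens2_def hmodes_neg_zer[OF as, where l = l, symmetric]
        hmodes_neg_zer[OF word_positive[OF i], where l = l, symmetric]
      unfolding w using as \<tau>(1) by blast
  qed
  then have 2: "ket as (canonical n) f - ket ?w (canonical n) f \<in> ?S"
    using subset_kernel2(3) lc.span_base by blast
  have "ket ?w (canonical n) f \<in> ?S"
    unfolding can by (rule lc.span_base) (use i in \<open>auto simp: basis_def\<close>)
  then have "ket as (canonical n) f \<in> ?S"
    using lc.span_add[OF 2] by fastforce
  then show ?thesis
    using lc.span_add[OF 1 lc.span_scale, of "ket as (canonical n) f" "Cfactor lam K js"] by simp
qed

lemma quotient_basis_basis:
  "quotient_basis (V_U (F_rel M c p e1 e2 U) l f) (kernel2 (F_rel M c p e1 e2 U) l lam K f) basis"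
  unfolding quotient_basis_def
proof (intro conjI ballI allI impI)
  let ?R = "F_rel M c p e1 e2 U"
  let ?N = "kernel2 ?R l lam K f"
  have "ket (word s ts ts') (replicate z (\<not> s)) f \<in> graded 0" if "index s ts ts' z" for s ts ts' z
    using that
    by (intro ket_graded word_positive[OF that]) (cases s; simp add: index_def word_weight del: map_map)
  then show "basis \<subseteq> V_U ?R l f"
    unfolding V_U_eq basis_def by blast
  fix u assume "u \<in> V_U ?R l f"
  then have "u \<in> graded 0" by (simp only: V_U_eq)
  then have "u \<in> lc.span (basis \<union> ?N)"
  proof (induction rule: graded_induct)
    case (place ns r)
    then have "place ns r \<in> ?R"
      unfolding F_rel_eq by (intro lc.span_base) blast
    then show ?case using subset_kernel2(1) lc.span_base by blast
  next
    case (ket ns w)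
    then show ?case by (rule ket_in_basis_span)
  qed (auto intro: lc.span_zero lc.span_add lc.span_scale)
  then obtain b n where "u = b + n" "b \<in> lc.span basis" "n \<in> lc.span ?N"
    unfolding lc.span_Un by blast
  moreover have "lc.span ?N = ?N"
    using subspace_kernel2 by (simp only: lc.span_eq_iff)
  ultimately show "\<exists>b\<in>lc.span basis. u - b \<in> ?N"
    by (intro bexI[of _ b]) simp_all
next
  fix T a b
  assume T: "finite T \<and> T \<subseteq> basis \<and> (\<Sum>b\<in>T. scal (a b) b) \<in> kernel2 (F_rel M c p e1 e2 U) l lam K f"
    and b: "b \<in> T"
  then have "model (\<Sum>b\<in>T. scal (a b) b) = 0"
    using kernel2_subset by (auto simp: kernel_def)
  then have zero: "(\<Sum>b\<in>T. scal (a b) (model b)) = 0"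
    by (simp add: model_def lin_ext_simps)
  obtain k where k: "\<And>b'. b' \<in> basis \<Longrightarrow> Poly_Mapping.lookup (model b') k = (if b' = b then E f [] else 0)"
    using basis_separated[of b] b T by blast
  have "0 = Poly_Mapping.lookup (\<Sum>b\<in>T. scal (a b) (model b)) k"
    by (simp add: zero)
  also have "\<dots> = (\<Sum>b'\<in>T. a b' * (if b' = b then E f [] else 0))"
    using k T by (auto simp: lookup_sum intro!: sum.cong)
  also have "\<dots> = a b * E f []"
    using T b by (simp add: if_distrib cong: if_cong)
  finally show "a b = 0"
    using E_nonzero by simp
qed

end

theorem theorem5p13:
  fixes M :: "('m::{t2_space,second_countable_topology}) surface"
    and K :: real and l lam :: complex and U :: "'m set" and f :: "'m \<Rightarrow> complex"
    and c :: "'m chart" and p :: 'm and e1 e2 :: "real^2"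
  assumes "riemannian_surface M"
    and "connected (UNIV :: 'm set)"
    and "complete_surface M"
    and "orientable (atlas M)"
    and "constant_curvature M K" and "K \<noteq> 0"
    and "c \<in> atlas M" and "p \<in> dom_ch c" and "orthonormal_frame M c p e1 e2"
    and "open U" and "l \<noteq> 0"
    and "eigenfunction M U lam f"
  shows "quotient_basis
      (V_U (F_rel M c p e1 e2 U) l f)
      (kernel2 (F_rel M c p e1 e2 U) l lam K f)
      ({basis_vec l f True ts ts' 0 | r ts ts'.
          even r \<and> length ts = r div 2 \<and> length ts' = r div 2 \<and>
          partition_list ts \<and> partition_list ts'} \<union>
       {basis_vec l f True ts ts' (r - k) | r k ts ts'.
          even r \<and> r div 2 \<le> k \<and> k < r \<and> length ts = r div 2 \<and> length ts' = k - r div 2 \<and>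
          partition_list ts \<and> partition_list ts'} \<union>
       {basis_vec l f False ts ts' (r - k) | r k ts ts'.
          even r \<and> r div 2 \<le> k \<and> k < r \<and> length ts = r div 2 \<and> length ts' = k - r div 2 \<and>
          partition_list ts \<and> partition_list ts'})"
proof -
  obtain E :: "('m \<Rightarrow> complex) \<Rightarrow> bool list \<Rightarrow> complex" where
    "word_model M c p e1 e2 U f lam K E"
    by (rule word_action[OF assms(1,2,5-10,12)]) (rule that, unfold_locales)
  then interpret word_model M c p e1 e2 U f lam l K E .
  show ?thesis
    unfolding basis_eq by (rule quotient_basis_basis)
qed

end
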